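(* Let $N\ge1$ be an integer, and let $0<\sigma<\infty$ if $N\le4$, $0<\sigma<\frac4{N-4}$ if $N\ge5$. Let $(c_n)_{n\ge1}$ be any sequence of positive numbers such that $c_n\to\infty$. Assume that for each $n$, $v_n$ is a minimizer for the problem $(\mathcal A_{c_n})$. Then there exist a subsequence $(c_{n_k})_{k\ge1}$, a sequence of points $(x_k)_{k\ge1}\subset\mathbb{R}^N$ and a minimizer $v$ for the problem $(\mathcal A)$ such that $v_{n_k}(\cdot+x_k)\to v$ strongly in $H^2(\mathbb{R}^N)$.
   Context: All functions are complex-valued. For $c>0$ and $v\in H^2(\mathbb{R}^N)$ let $$K_c(v)=\int_{\mathbb{R}^N}|\Delta v|^2dx-\frac2{\sqrt{1+c}}\int_{\mathbb{R}^N}|\nabla v|^2dx+\int_{\mathbb{R}^N}|v|^2dx,\qquad K(v)=\int_{\mathbb{R}^N}|\Delta v|^2dx+\int_{\mathbb{R}^N}|v|^2dx.$$ Problem $(\mathcal A_c)$: minimize $K_c(v)$ in $H^2(\mathbb{R}^N)$ under the constraint $\int_{\mathbb{R}^N}|v|^{2\sigma+2}dx=1$. Problem $(\mathcal A)$: minimize $K(v)$ in $H^2(\mathbb{R}^N)$ under the same constraint. *)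

theory Defs
  imports "HOL-Analysis.Analysis"
begin

text \<open>Iterated partial derivatives along a list of directions. In what follows the directions
  are always elements of \<^const>\<open>Basis\<close>.\<close>

primrec pderivs :: "'a::euclidean_space list \<Rightarrow> ('a \<Rightarrow> complex) \<Rightarrow> 'a \<Rightarrow> complex" where
  "pderivs [] f = f"
| "pderivs (b # bs) f = (\<lambda>x. frechet_derivative (pderivs bs f) (at x) b)"

text \<open>Differentiability of all iterated partial derivatives entails their continuity, so this is
  the class of infinitely differentiable functions with compact support.\<close>

definition test_function :: "('a::euclidean_space \<Rightarrow> complex) \<Rightarrow> bool" where
  "test_function \<phi> \<longleftrightarrow>
     (\<forall>bs. set bs \<subseteq> Basis \<longrightarrow> (\<forall>x. pderivs bs \<phi> differentiable (at x))) \<and>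
     compact (closure {x. \<phi> x \<noteq> 0})"

definition locally_integrable :: "('a::euclidean_space \<Rightarrow> complex) \<Rightarrow> bool" where
  "locally_integrable u \<longleftrightarrow>
     u \<in> borel_measurable lebesgue \<and> (\<forall>S. compact S \<longrightarrow> set_integrable lebesgue S u)"

definition L2 :: "('a::euclidean_space \<Rightarrow> complex) set" where
  "L2 = {u. u \<in> borel_measurable lebesgue \<and> integrable lebesgue (\<lambda>x. (cmod (u x))\<^sup>2)}"

text \<open>Local integrability is essential here: the Bochner integral of a function that is not
  integrable is \<open>0\<close> by convention.\<close>

definition has_weak_pderivs ::
  "'a::euclidean_space list \<Rightarrow> ('a \<Rightarrow> complex) \<Rightarrow> ('a \<Rightarrow> complex) \<Rightarrow> bool" where
  "has_weak_pderivs bs u g \<longleftrightarrow>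
     locally_integrable u \<and> locally_integrable g \<and>
     (\<forall>\<phi>. test_function \<phi> \<longrightarrow>
        (LINT x|lebesgue. u x * pderivs bs \<phi> x) =
        (-1) ^ length bs * (LINT x|lebesgue. g x * \<phi> x))"

text \<open>A representative of the weak derivative; it is unique almost everywhere, so the integrals
  below do not depend on the choice.\<close>

definition weak_pderivs :: "'a::euclidean_space list \<Rightarrow> ('a \<Rightarrow> complex) \<Rightarrow> 'a \<Rightarrow> complex" where
  "weak_pderivs bs u = (SOME g. has_weak_pderivs bs u g)"

definition directions2 :: "'a::euclidean_space list set" where
  "directions2 = {bs. set bs \<subseteq> Basis \<and> length bs \<le> 2}"

text \<open>Elements of \<open>H\<^sup>2\<close> are represented by functions, not by classes modulo equality almost
  everywhere.\<close>

definition H2 :: "('a::euclidean_space \<Rightarrow> complex) set" where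
  "H2 = {u \<in> L2. \<forall>bs\<in>directions2. \<exists>g\<in>L2. has_weak_pderivs bs u g}"

text \<open>The square of this norm is the sum of the squared \<open>L\<^sup>2\<close> norms of the function, of its
  gradient and of its full Hessian matrix (each mixed derivative occurs twice).\<close>

definition H2_norm :: "('a::euclidean_space \<Rightarrow> complex) \<Rightarrow> real" where
  "H2_norm u = sqrt (\<Sum>bs\<in>directions2. LINT x|lebesgue. (cmod (weak_pderivs bs u x))\<^sup>2)"

definition laplacian :: "('a::euclidean_space \<Rightarrow> complex) \<Rightarrow> 'a \<Rightarrow> complex" where
  "laplacian u x = (\<Sum>b\<in>Basis. weak_pderivs [b, b] u x)"

definition grad_sq :: "('a::euclidean_space \<Rightarrow> complex) \<Rightarrow> 'a \<Rightarrow> real" where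
  "grad_sq u x = (\<Sum>b\<in>Basis. (cmod (weak_pderivs [b] u x))\<^sup>2)"

definition K_c :: "real \<Rightarrow> ('a::euclidean_space \<Rightarrow> complex) \<Rightarrow> real" where
  "K_c c v = (LINT x|lebesgue. (cmod (laplacian v x))\<^sup>2)
     - 2 / sqrt (1 + c) * (LINT x|lebesgue. grad_sq v x)
     + (LINT x|lebesgue. (cmod (v x))\<^sup>2)"

definition K :: "('a::euclidean_space \<Rightarrow> complex) \<Rightarrow> real" where
  "K v = (LINT x|lebesgue. (cmod (laplacian v x))\<^sup>2) + (LINT x|lebesgue. (cmod (v x))\<^sup>2)"

definition admissible :: "real \<Rightarrow> ('a::euclidean_space \<Rightarrow> complex) set" where
  "admissible \<sigma> = {v \<in> H2. (LINT x|lebesgue. cmod (v x) powr (2 * \<sigma> + 2)) = 1}"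

definition minimizer ::
  "(('a::euclidean_space \<Rightarrow> complex) \<Rightarrow> real) \<Rightarrow> real \<Rightarrow> ('a \<Rightarrow> complex) \<Rightarrow> bool" where
  "minimizer F \<sigma> v \<longleftrightarrow> v \<in> admissible \<sigma> \<and> (\<forall>w\<in>admissible \<sigma>. F v \<le> F w)"

end

theory Submission
  imports Defs "HOL-Complex_Analysis.Great_Picard"
begin

text \<open>
  Write \<open>p = 2 * \<sigma> + 2\<close> and let \<open>m\<close> be the infimum of \<^const>\<open>K\<close> under the constraint. Integration by
  parts gives \<open>\<integral> \<bar>\<nabla>v\<bar>\<^sup>2 = - Re \<integral> v \<Delta>v\<^sup>* \<le> K v / 2\<close>, hence
  \<open>(1 - 1 / sqrt (1 + c)) * K v \<le> K_c c v \<le> K v\<close>. Therefore the given minimizers form a minimizing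
  sequence for \<^const>\<open>K\<close> as \<open>c\<close> tends to infinity, and the theorem is an instance of the statement
  that every minimizing sequence for \<^const>\<open>K\<close> is, up to translations, relatively compact in \<open>H\<^sup>2\<close>
  (\<open>minimizing_sequence_compact\<close>).

  That statement rests on the fact that \<^const>\<open>K\<close> is the square of a Hilbert norm, while the constraint
  is homogeneous of degree \<open>p > 2\<close>. For a weak limit \<open>w\<close> of the sequence, both \<^const>\<open>K\<close> and the
  constraint split asymptotically into the parts belonging to \<open>w\<close> and to the remainder
  (\<open>energy_expand\<close>, \<open>brezis_lieb_upper\<close>), and strict concavity of \<open>t powr (2 / p)\<close> forbids a proper
  splitting. So \<open>w\<close> takes everything or nothing, and the second case is excluded by translating the
  members of the sequence beforehand (\<open>nonvanishing\<close>).

  The analysis needed for this is based on translations. A class \<open>u\<close> in \<open>L\<^sup>2\<close> with weak derivative \<open>g\<close> in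
  direction \<open>b\<close> is differentiable along the translation group, so that difference quotients of \<open>u\<close>
  converge to \<open>g\<close> in norm (\<open>diffquot_tendsto\<close>). Since translations are isometries, exact summation by
  parts for difference quotients yields integration by parts and the identity between the \<open>L\<^sup>2\<close> norms
  of Hessian and Laplacian (\<open>hessian_energy\<close>), which makes \<^const>\<open>K\<close> equivalent to the square of the
  \<open>H\<^sup>2\<close> norm.

  The link between \<open>H\<^sup>2\<close> and \<open>L\<^sup>p\<close> are averages over balls of radius \<open>2\<^sup>-\<^sup>j\<close>. An average differs from the
  function by \<open>O(4\<^sup>-\<^sup>j)\<close> in \<open>L\<^sup>2\<close>, because only second differences survive in a symmetric average, and it is
  bounded by \<open>2 powr (j * N / 2)\<close> times the \<open>L\<^sup>2\<close> norm. Interpolation shows that in the subcritical range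
  the increments between consecutive scales decay geometrically in \<open>L\<^sup>p\<close> (\<open>dyadic_sobolev\<close>). This
  single estimate contains the Sobolev embedding, and it also shows that a function which carries unit
  mass in \<open>L\<^sup>p\<close> has an average, at a fixed scale, that is not small at some point. Averages of weakly
  convergent sequences converge pointwise, which gives almost everywhere convergence of a
  subsequence (\<open>weak_null_AE_subseq\<close>) and prevents the weak limit from vanishing.
\<close>

section \<open>Convexity and weak compactness in Hilbert space\<close>

text \<open>By the parallelogram law two points of nearly minimal norm are close as soon as their midpoint
  still competes for the minimum. Below, \<open>d i\<close> is the squared minimal norm in the convex set to which
  all \<open>x j\<close> with \<open>i \<le> j\<close> belong; the sets may shrink, which is why \<open>d\<close> is a sequence.\<close>

lemma Cauchy_if_norms_nearly_minimal:
  fixes x :: "nat \<Rightarrow> 'a::real_inner"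
  assumes mid: "\<And>i j. i \<le> j \<Longrightarrow> d i \<le> norm ((1/2) *\<^sub>R (x i + x j)) ^ 2"
    and up: "\<And>i. norm (x i) ^ 2 \<le> d i + e i"
    and d: "d \<longlonglongrightarrow> (D::real)" and e: "e \<longlonglongrightarrow> 0"
  shows "Cauchy x"
proof (rule metric_CauchyI)
  fix \<epsilon> :: real assume "\<epsilon> > 0"
  then have pos: "\<epsilon>\<^sup>2 / 16 > 0" by simp
  obtain N1 where N1: "\<And>n. n \<ge> N1 \<Longrightarrow> \<bar>d n - D\<bar> < \<epsilon>\<^sup>2 / 16"
    using LIMSEQ_D[OF d pos] by auto
  obtain N2 where N2: "\<And>n. n \<ge> N2 \<Longrightarrow> \<bar>e n\<bar> < \<epsilon>\<^sup>2 / 16"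
    using LIMSEQ_D[OF e pos] by auto
  have main: "norm (x i - x j) < \<epsilon>" if "i \<le> j" "i \<ge> max N1 N2" for i j
  proof -
    have par: "norm (x i - x j) ^ 2 = 2 * norm (x i) ^ 2 + 2 * norm (x j) ^ 2
        - 4 * norm ((1/2) *\<^sub>R (x i + x j)) ^ 2"
      by (simp add: power2_norm_eq_inner inner_diff inner_add inner_commute algebra_simps)
    have lin: "2 * a + 2 * b - 4 * m \<le> 2 * a' + 2 * b' - 4 * m'"
      if "a \<le> a'" "b \<le> b'" "m' \<le> m" for a a' b b' m m' :: real
      using that by linarith
    have "norm (x i - x j) ^ 2 \<le> 2 * (d i + e i) + 2 * (d j + e j) - 4 * d i"
      unfolding par by (rule lin[OF up up mid[OF that(1)]])
    also have "\<dots> < \<epsilon>\<^sup>2"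
    proof -
      have "\<bar>d i - D\<bar> < \<epsilon>\<^sup>2 / 16" "\<bar>d j - D\<bar> < \<epsilon>\<^sup>2 / 16" "\<bar>e i\<bar> < \<epsilon>\<^sup>2 / 16" "\<bar>e j\<bar> < \<epsilon>\<^sup>2 / 16"
        using N1[of i] N1[of j] N2[of i] N2[of j] that by auto
      then show ?thesis using zero_le_power2[of \<epsilon>] unfolding abs_less_iff by argo
    qed
    finally show ?thesis using \<open>\<epsilon> > 0\<close> by (simp add: power2_less_imp_less)
  qed
  show "\<exists>M. \<forall>m\<ge>M. \<forall>n\<ge>M. dist (x m) (x n) < \<epsilon>"
  proof (intro exI[of _ "max N1 N2"] allI impI)
    fix m n assume "max N1 N2 \<le> m" "max N1 N2 \<le> n"
    then show "dist (x m) (x n) < \<epsilon>"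
      using main[of m n] main[of n m] by (cases "m \<le> n") (auto simp: dist_norm norm_minus_commute)
  qed
qed

lemma exists_min_norm_closed_convex:
  fixes C :: "'a::{real_inner,complete_space} set"
  assumes "convex C" "closed C" "C \<noteq> {}"
  obtains x where "x \<in> C" "\<And>y. y \<in> C \<Longrightarrow> norm x \<le> norm y"
proof -
  define d where "d = Inf ((\<lambda>x. norm x ^ 2) ` C)"
  have bdd: "bdd_below ((\<lambda>x. norm x ^ 2) ` C)" by (rule bdd_belowI[of _ 0]) auto
  have lower: "d \<le> norm y ^ 2" if "y \<in> C" for y
    unfolding d_def using bdd that by (auto intro: cInf_lower)
  have "\<exists>x\<in>C. norm x ^ 2 < d + inverse (Suc n)" for n
  proof -
    have "d < d + inverse (real (Suc n))" by simp
    then have "\<exists>y\<in>(\<lambda>x. norm x ^ 2) ` C. y < d + inverse (real (Suc n))"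
      using cInf_less_iff[OF _ bdd, of "d + inverse (real (Suc n))"] \<open>C \<noteq> {}\<close> unfolding d_def by blast
    then show ?thesis by blast
  qed
  then obtain x where x: "\<And>n. x n \<in> C" "\<And>n. norm (x n) ^ 2 < d + inverse (Suc n)" by metis
  have "Cauchy x"
  proof (rule Cauchy_if_norms_nearly_minimal[where d = "\<lambda>_. d" and e = "\<lambda>n. inverse (real (Suc n))" and D = d])
    fix i j
    have "(1/2) *\<^sub>R (x i + x j) \<in> C"
      using convexD[OF assms(1) x(1)[of i] x(1)[of j], of "1/2" "1/2"] by (simp add: scaleR_add_right)
    then show "d \<le> norm ((1/2) *\<^sub>R (x i + x j)) ^ 2" by (rule lower)
  qed (use x(2) LIMSEQ_inverse_real_of_nat in \<open>auto intro: less_imp_le\<close>)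
  then obtain l where l: "x \<longlonglongrightarrow> l" using Cauchy_convergent convergent_def by blast
  have lC: "l \<in> C" using closed_sequentially[OF assms(2)] x(1) l by blast
  have "(\<lambda>n. norm (x n) ^ 2) \<longlonglongrightarrow> norm l ^ 2" using l by (intro tendsto_intros)
  moreover have "(\<lambda>n. d + inverse (real (Suc n))) \<longlonglongrightarrow> d + 0"
    by (intro tendsto_intros LIMSEQ_inverse_real_of_nat)
  ultimately have "norm l ^ 2 \<le> d"
    using x(2) by (intro LIMSEQ_le[where X = "\<lambda>n. norm (x n) ^ 2" and Y = "\<lambda>n. d + inverse (real (Suc n))"]) (auto intro: less_imp_le)
  then have "norm l ^ 2 \<le> norm y ^ 2" if "y \<in> C" for y using lower[OF that] by linarith
  then have "norm l \<le> norm y" if "y \<in> C" for y using that by (meson norm_ge_zero power2_le_imp_le)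
  with lC show thesis using that by blast
qed

text \<open>The point of minimal norm in the closure of \<open>x - S\<close> is orthogonal to \<open>S\<close>, hence zero.\<close>

lemma subspace_dense_if_trivial_orthogonal:
  fixes S :: "'a::{real_inner,complete_space} set"
  assumes S: "subspace S" and orth: "\<And>w. (\<And>s. s \<in> S \<Longrightarrow> inner w s = 0) \<Longrightarrow> w = 0"
  shows "closure S = UNIV"
proof -
  have "x \<in> closure S" for x
  proof -
    let ?C = "closure ((\<lambda>s. x - s) ` S)"
    have cv: "convex ((\<lambda>s. x - s) ` S)"
    proof -
      have "(\<lambda>s. x - s) ` S = (\<lambda>s. x + s) ` uminus ` S" by (force simp: image_image)
      then show ?thesis using subspace_imp_convex[OF S] by (simp add: convex_negations)
    qed
    have ne: "?C \<noteq> {}" using subspace_0[OF S] by auto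
    obtain z where z: "z \<in> ?C" "\<And>y. y \<in> ?C \<Longrightarrow> norm z \<le> norm y"
      using exists_min_norm_closed_convex[OF convex_closure[OF cv] closed_closure ne] by blast
    have shift: "z + t *\<^sub>R s \<in> ?C" if s: "s \<in> S" for s t
    proof -
      obtain f where f: "\<And>n. f n \<in> (\<lambda>s. x - s) ` S" "f \<longlonglongrightarrow> z"
        using z(1) closure_sequential by blast
      have "f n + t *\<^sub>R s \<in> (\<lambda>s. x - s) ` S" for n
      proof -
        obtain s' where "s' \<in> S" "f n = x - s'" using f(1) by blast
        then have "f n + t *\<^sub>R s = x - (s' - t *\<^sub>R s)" "s' - t *\<^sub>R s \<in> S"
          using s S by (auto intro: subspace_diff subspace_scale)
        then show ?thesis by blast
      qed
      moreover have "(\<lambda>n. f n + t *\<^sub>R s) \<longlonglongrightarrow> z + t *\<^sub>R s" using f(2) by (intro tendsto_intros)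
      ultimately show ?thesis unfolding closure_sequential by (intro exI[of _ "\<lambda>n. f n + t *\<^sub>R s"]) auto
    qed
    have "z = 0"
    proof (rule orth)
      fix s assume s: "s \<in> S"
      show "inner z s = 0"
      proof (rule ccontr)
        assume ne: "inner z s \<noteq> 0"
        then have s0: "s \<noteq> 0" by auto
        define t where "t = - inner z s / (norm s)\<^sup>2"
        have "norm z \<le> norm (z + t *\<^sub>R s)" by (rule z(2)[OF shift[OF s]])
        then have "norm z ^ 2 \<le> norm (z + t *\<^sub>R s) ^ 2" by (simp add: power_mono)
        also have "\<dots> = norm z ^ 2 + 2 * t * inner z s + t ^ 2 * norm s ^ 2"
          unfolding power2_norm_eq_inner
          by (simp add: inner_add_left inner_add_right inner_commute[of s z] power2_eq_square algebra_simps)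
        also have "\<dots> = norm z ^ 2 - (inner z s)\<^sup>2 / (norm s)\<^sup>2"
          using s0 by (simp add: t_def power2_eq_square field_simps)
        finally have "(inner z s)\<^sup>2 / (norm s)\<^sup>2 \<le> 0" by simp
        moreover have "(inner z s)\<^sup>2 / (norm s)\<^sup>2 > 0" using ne s0 by (intro divide_pos_pos) auto
        ultimately show False by simp
      qed
    qed
    then have "0 \<in> ?C" using z(1) by simp
    then obtain f where f: "\<And>n. f n \<in> (\<lambda>s. x - s) ` S" "f \<longlonglongrightarrow> 0"
      using closure_sequential by blast
    have "x - f n \<in> S" for n using f(1)[of n] by auto
    moreover have "(\<lambda>n. x - f n) \<longlonglongrightarrow> x - 0" using f(2) by (intro tendsto_intros)
    ultimately show ?thesis unfolding closure_sequential by (intro exI[of _ "\<lambda>n. x - f n"]) auto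
  qed
  then show ?thesis by blast
qed

text \<open>The points of minimal norm in the single sets have increasing and bounded norms, so they form a
  Cauchy sequence; its limit lies in every set.\<close>

lemma nested_closed_convex_nonempty:
  fixes C :: "nat \<Rightarrow> 'a::{real_inner,complete_space} set"
  assumes cv: "\<And>n. convex (C n)" and cl: "\<And>n. closed (C n)"
    and dec: "\<And>m n. m \<le> n \<Longrightarrow> C n \<subseteq> C m"
    and bd: "\<And>n. \<exists>x\<in>C n. norm x \<le> M"
  shows "(\<Inter>n. C n) \<noteq> {}"
proof -
  have "\<exists>x. x \<in> C n \<and> (\<forall>y\<in>C n. norm x \<le> norm y)" for n
    by (rule exists_min_norm_closed_convex[OF cv[of n] cl[of n]]) (use bd[of n] in auto)
  then obtain x where x: "\<And>n. x n \<in> C n" "\<And>n y. y \<in> C n \<Longrightarrow> norm (x n) \<le> norm y" by metis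
  define d where "d n = norm (x n) ^ 2" for n
  have "norm (x m) \<le> norm (x n)" if "m \<le> n" for m n
    by (rule x(2)) (use dec[OF that] x(1)[of n] in blast)
  then have "incseq d" unfolding d_def incseq_def by (auto intro!: power_mono)
  moreover have "d n \<le> M ^ 2" for n
  proof -
    obtain y where "y \<in> C n" "norm y \<le> M" using bd by blast
    then have "norm (x n) \<le> M" using x(2)[of y n] by linarith
    then show ?thesis unfolding d_def by (simp add: power_mono)
  qed
  ultimately obtain D where D: "d \<longlonglongrightarrow> D" using incseq_convergent[of d "M ^ 2"] by metis
  have "Cauchy x"
  proof (rule Cauchy_if_norms_nearly_minimal[where d = d and e = "\<lambda>n. 0" and D = D])
    fix i j :: nat assume "i \<le> j"
    then have "x j \<in> C i" using x(1) dec by blast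
    then have "(1/2) *\<^sub>R (x i + x j) \<in> C i"
      using convexD[OF cv x(1)[of i], of "x j" "1/2" "1/2"] by (simp add: scaleR_add_right)
    then show "d i \<le> norm ((1/2) *\<^sub>R (x i + x j)) ^ 2"
      unfolding d_def by (intro power_mono x(2) norm_ge_zero)
  qed (use D in \<open>auto simp: d_def\<close>)
  then obtain l where l: "x \<longlonglongrightarrow> l" using Cauchy_convergent convergent_def by blast
  have "l \<in> C n" for n
  proof (rule closed_sequentially[OF cl])
    show "x (k + n) \<in> C n" for k using x(1)[of "k + n"] dec[of n "k + n"] by auto
    show "(\<lambda>k. x (k + n)) \<longlonglongrightarrow> l" using l by (rule LIMSEQ_ignore_initial_segment)
  qed
  then show ?thesis by blast
qed

text \<open>Any common point of the closed convex hulls of all tails serves: a slab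
  \<open>{x. \<bar>\<psi> \<bullet> x - a\<bar> \<le> e}\<close> that contains a tail also contains its closed convex hull.\<close>

lemma bounded_has_tail_hull_point:
  fixes u :: "nat \<Rightarrow> 'a::{real_inner,complete_space}"
  assumes "\<And>n. norm (u n) \<le> M"
  obtains w where "\<And>\<psi> a. (\<lambda>n. inner (u n) \<psi>) \<longlonglongrightarrow> a \<Longrightarrow> inner w \<psi> = a"
    "w \<in> closure (span (range u))"
proof -
  define C where "C n = closure (convex hull (u ` {n..}))" for n
  have sub: "u k \<in> C n" if "n \<le> k" for n k
    unfolding C_def using that by (meson atLeast_iff closure_subset hull_inc image_eqI subsetD)
  have "(\<Inter>n. C n) \<noteq> {}"
  proof (rule nested_closed_convex_nonempty[where M = M])
    show "C n \<subseteq> C m" if "m \<le> n" for m n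
      unfolding C_def using that by (intro closure_mono hull_mono) auto
    show "\<exists>x\<in>C n. norm x \<le> M" for n using sub[of n n] assms by auto
  qed (auto simp: C_def intro: convex_closure)
  then obtain w where w: "\<And>n. w \<in> C n" by blast
  show thesis
  proof (rule that)
    fix \<psi> a assume lim: "(\<lambda>n. inner (u n) \<psi>) \<longlonglongrightarrow> a"
    have "dist (inner w \<psi>) a \<le> e" if e: "e > 0" for e
    proof -
      obtain n where n: "\<And>k. k \<ge> n \<Longrightarrow> dist (inner (u k) \<psi>) a \<le> e"
        using metric_LIMSEQ_D[OF lim e] by (auto intro: less_imp_le)
      define P where "P = {x. inner \<psi> x \<ge> a - e} \<inter> {x. inner \<psi> x \<le> a + e}"
      have "convex P" unfolding P_def
        by (intro convex_Int convex_halfspace_ge convex_halfspace_le)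
      moreover have "closed P" unfolding P_def
        by (intro closed_Int closed_halfspace_ge closed_halfspace_le)
      moreover have "u ` {n..} \<subseteq> P"
        using n by (auto simp: P_def dist_real_def inner_commute abs_le_iff algebra_simps)
      ultimately have "C n \<subseteq> P" unfolding C_def by (simp add: closure_minimal hull_minimal)
      then show ?thesis using w[of n]
        by (auto simp: P_def dist_real_def inner_commute abs_le_iff algebra_simps)
    qed
    then have "dist (inner w \<psi>) a \<le> 0" by (metis add_0 field_le_epsilon)
    then show "inner w \<psi> = a" by simp
  next
    have "C 0 \<subseteq> closure (span (range u))"
      unfolding C_def by (intro closure_mono hull_minimal subspace_imp_convex)
        (auto intro: span_base)
    then show "w \<in> closure (span (range u))" using w[of 0] by blast
  qed
qed

lemma inner_closure_span_zero:
  fixes z :: "'a::real_inner"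
  assumes "\<And>s. s \<in> S \<Longrightarrow> inner z s = 0" "y \<in> closure (span S)"
  shows "inner z y = 0"
proof -
  have "closed {x. inner z x = 0}" by (rule closed_hyperplane)
  moreover have "span S \<subseteq> {x. inner z x = 0}"
    using assms(1) by (intro span_minimal) (auto simp: subspace_def inner_add_right)
  ultimately show ?thesis using closure_minimal assms(2) by blast
qed

text \<open>Every subsequence has a tail hull point, which is its only possible weak limit; the task is to
  pass to a subsequence all of whose subsequences share that point. A diagonal extraction makes the
  inner products with the members of the sequence converge, and these limits determine a point of
  the closed span.\<close>

theorem bounded_weakly_convergent_subsequence:
  fixes u :: "nat \<Rightarrow> 'a::{real_inner,complete_space}"
  assumes bd: "\<And>n. norm (u n) \<le> M"
  obtains r w where "strict_mono (r::nat \<Rightarrow> nat)" "\<And>\<psi>. (\<lambda>n. inner (u (r n)) \<psi>) \<longlonglongrightarrow> inner w \<psi>"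
proof -
  have M0: "0 \<le> M" using bd[of 0] norm_ge_zero order_trans by blast
  have bdi: "norm (inner (u n) \<psi>) \<le> M * norm \<psi>" for n \<psi>
    using Cauchy_Schwarz_ineq2[of "u n" \<psi>] mult_right_mono[OF bd[of n] norm_ge_zero[of \<psi>]] by simp
  have "norm (inner (u n) (u m)) \<le> M * M" for n m
    using bdi[of n "u m"] mult_left_mono[OF bd[of m] M0] by linarith
  then have "\<exists>r. strict_mono (r::nat\<Rightarrow>nat) \<and> (\<forall>m. \<exists>l. (\<lambda>n. inner (u (r n)) (u m)) \<longlonglongrightarrow> l)"
    using function_convergent_subsequence[where S = "UNIV :: nat set" and f = "\<lambda>n m. inner (u n) (u m)"
        and M = "M * M" and thesis = "\<exists>r. strict_mono (r::nat\<Rightarrow>nat) \<and> (\<forall>m. \<exists>l. (\<lambda>n. inner (u (r n)) (u m)) \<longlonglongrightarrow> l)"]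
    by blast
  then obtain r where r: "strict_mono (r::nat\<Rightarrow>nat)"
      "\<forall>m. \<exists>l. (\<lambda>n. inner (u (r n)) (u m)) \<longlonglongrightarrow> l" by blast
  then obtain l where l: "\<And>m. (\<lambda>n. inner (u (r n)) (u m)) \<longlonglongrightarrow> l m" by metis
  have ex: "\<exists>w. (\<forall>\<psi> a. (\<lambda>n. inner (u (r (s n))) \<psi>) \<longlonglongrightarrow> a \<longrightarrow> inner w \<psi> = a) \<and>
      w \<in> closure (span (range u)) \<and> (\<forall>m. inner w (u m) = l m)" if s: "strict_mono s" for s :: "nat \<Rightarrow> nat"
  proof -
    obtain w where w: "\<And>\<psi> a. (\<lambda>n. inner (u (r (s n))) \<psi>) \<longlonglongrightarrow> a \<Longrightarrow> inner w \<psi> = a"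
      "w \<in> closure (span (range (\<lambda>n. u (r (s n)))))"
      using bounded_has_tail_hull_point[of "\<lambda>n. u (r (s n))" M] bd by blast
    have "closure (span (range (\<lambda>n. u (r (s n))))) \<subseteq> closure (span (range u))"
      by (intro closure_mono span_mono) auto
    moreover have "inner w (u m) = l m" for m
      using w(1) LIMSEQ_subseq_LIMSEQ[OF l[of m] s] by (simp add: o_def)
    ultimately have "w \<in> closure (span (range u)) \<and> (\<forall>m. inner w (u m) = l m)"
      using w(2) by blast
    then show ?thesis using w(1) by (intro exI[of _ w] conjI allI impI) auto
  qed
  have "strict_mono (id :: nat \<Rightarrow> nat)" by (simp add: strict_mono_def)
  from ex[OF this] obtain w where w: "w \<in> closure (span (range u))" "\<And>m. inner w (u m) = l m"
    by (elim exE conjE) (rule that, assumption, erule spec)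
  have lim: "(\<lambda>n. inner (u (r n)) \<psi>) \<longlonglongrightarrow> inner w \<psi>" for \<psi>
  proof (rule ccontr)
    assume "\<not> ?thesis"
    then obtain e where e: "e > 0" "\<And>N. \<exists>n\<ge>N. dist (inner (u (r n)) \<psi>) (inner w \<psi>) \<ge> e"
      unfolding lim_sequentially by (meson not_le)
    define B where "B = {n. dist (inner (u (r n)) \<psi>) (inner w \<psi>) \<ge> e}"
    have "infinite B" unfolding B_def infinite_nat_iff_unbounded_le using e(2) by auto
    then obtain s where s: "strict_mono (s::nat\<Rightarrow>nat)" "\<And>n. s n \<in> B"
      using infinite_enumerate by blast
    have "bounded (range (\<lambda>n. inner (u (r (s n))) \<psi>))"
      by (rule boundedI[of _ "M * norm \<psi>"]) (use bdi in auto)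
    then obtain a t where t: "strict_mono (t::nat\<Rightarrow>nat)" "(\<lambda>n. inner (u (r (s (t n)))) \<psi>) \<longlonglongrightarrow> a"
      using bounded_imp_convergent_subsequence[of "\<lambda>n. inner (u (r (s n))) \<psi>"] by (auto simp: o_def)
    obtain w' where w': "inner w' \<psi> = a" "w' \<in> closure (span (range u))" "\<And>m. inner w' (u m) = l m"
    proof -
      have "strict_mono (s \<circ> t)" by (rule strict_mono_o[OF s(1) t(1)])
      from ex[OF this] obtain w' where w': "\<forall>\<psi> a. (\<lambda>n. inner (u (r ((s \<circ> t) n))) \<psi>) \<longlonglongrightarrow> a \<longrightarrow> inner w' \<psi> = a"
        "w' \<in> closure (span (range u))" "\<forall>m. inner w' (u m) = l m" by (elim exE conjE)
      have "(\<lambda>n. inner (u (r ((s \<circ> t) n))) \<psi>) \<longlonglongrightarrow> a" using t(2) by (simp only: o_apply)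
      then have "inner w' \<psi> = a" using w'(1) by (elim allE impE)
      then show thesis using w'(2,3) that by simp
    qed
    have "inner (w - w') s = 0" if "s \<in> range u" for s
      using that w(2) w'(3) by (auto simp: inner_diff_left)
    then have z: "inner (w - w') y = 0" if "y \<in> closure (span (range u))" for y
      using inner_closure_span_zero that by blast
    have "inner (w - w') (w - w') = 0"
      using z[OF w(1)] z[OF w'(2)] by (simp add: inner_diff_right)
    then have "w = w'" by simp
    have "e \<le> dist a (inner w \<psi>)"
      using t(2) s(2) by (intro tendsto_lowerbound[OF tendsto_dist[OF t(2) tendsto_const]]) (auto simp: B_def)
    with \<open>w = w'\<close> w'(1) e(1) show False by simp
  qed
  show thesis by (rule that[OF r(1) lim])
qed

section \<open>The Hilbert space of square integrable classes\<close>

text \<open>Borel representatives make \<open>f (x + y)\<close> jointly measurable in \<open>x\<close> and \<open>y\<close>, so that Tonelli's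
  theorem applies to averages of translates.\<close>

definition sqint :: "('a::euclidean_space \<Rightarrow> complex) set" where
  "sqint = {f \<in> borel_measurable borel. integrable lborel (\<lambda>x. (cmod (f x))\<^sup>2)}"

lemma sqint_measurable [measurable_dest]: "f \<in> sqint \<Longrightarrow> f \<in> borel_measurable borel"
  by (simp add: sqint_def)

lemma sqint_integrable: "f \<in> sqint \<Longrightarrow> integrable lborel (\<lambda>x. (cmod (f x))\<^sup>2)"
  by (simp add: sqint_def)

lemma sqintI:
  "f \<in> borel_measurable borel \<Longrightarrow> integrable lborel (\<lambda>x. (cmod (f x))\<^sup>2) \<Longrightarrow> f \<in> sqint"
  by (simp add: sqint_def)

lemma sqint_bound:
  assumes "f \<in> sqint" "g \<in> sqint" "h \<in> borel_measurable borel"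
    and "\<And>x. cmod (h x) \<le> a * (cmod (f x) + cmod (g x))"
  shows "h \<in> sqint"
proof (rule sqintI[OF assms(3)])
  have "integrable lborel (\<lambda>x. 2 * a\<^sup>2 * ((cmod (f x))\<^sup>2 + (cmod (g x))\<^sup>2))"
    using assms(1,2) by (intro integrable_mult_right Bochner_Integration.integrable_add sqint_integrable)
  then show "integrable lborel (\<lambda>x. (cmod (h x))\<^sup>2)"
  proof (rule Bochner_Integration.integrable_bound)
    show "(\<lambda>x. (cmod (h x))\<^sup>2) \<in> borel_measurable lborel" using assms(3) by measurable
    show "AE x in lborel. norm ((cmod (h x))\<^sup>2) \<le> norm (2 * a\<^sup>2 * ((cmod (f x))\<^sup>2 + (cmod (g x))\<^sup>2))"
    proof (intro AE_I2)
      fix x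
      have "(cmod (h x))\<^sup>2 \<le> (a * (cmod (f x) + cmod (g x)))\<^sup>2"
        by (rule power_mono[OF assms(4)]) simp
      also have "\<dots> = a\<^sup>2 * (cmod (f x) + cmod (g x))\<^sup>2" by (simp add: power_mult_distrib)
      also have "\<dots> \<le> a\<^sup>2 * (2 * ((cmod (f x))\<^sup>2 + (cmod (g x))\<^sup>2))"
        by (intro mult_left_mono) (use sum_squares_bound[of "cmod (f x)" "cmod (g x)"] in \<open>auto simp: power2_sum\<close>)
      finally show "norm ((cmod (h x))\<^sup>2) \<le> norm (2 * a\<^sup>2 * ((cmod (f x))\<^sup>2 + (cmod (g x))\<^sup>2))"
        by (simp add: algebra_simps)
    qed
  qed
qed

lemma sqint_zero: "(\<lambda>x. 0) \<in> sqint"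
  by (rule sqintI) auto

lemma sqint_mono:
  assumes "f \<in> sqint" "h \<in> borel_measurable borel" "\<And>x. cmod (h x) \<le> a * cmod (f x)"
  shows "h \<in> sqint"
  by (rule sqint_bound[OF assms(1) sqint_zero assms(2), of a]) (use assms(3) in simp)

lemma sqint_add: "f \<in> sqint \<Longrightarrow> g \<in> sqint \<Longrightarrow> (\<lambda>x. f x + g x) \<in> sqint"
  by (rule sqint_bound[of f g _ 1]) (auto simp: norm_triangle_ineq intro: sqint_measurable)

lemma sqint_diff: "f \<in> sqint \<Longrightarrow> g \<in> sqint \<Longrightarrow> (\<lambda>x. f x - g x) \<in> sqint"
  by (rule sqint_bound[of f g _ 1]) (auto simp: norm_triangle_ineq4 intro: sqint_measurable)

lemma sqint_bounded_linear:
  assumes "bounded_linear L" "f \<in> sqint" shows "(\<lambda>x. L (f x)) \<in> sqint"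
proof -
  obtain a where a: "\<And>z. cmod (L z) \<le> cmod z * a" using bounded_linear.bounded[OF assms(1)] by blast
  have "L \<in> borel_measurable borel"
    by (intro borel_measurable_continuous_onI linear_continuous_on assms(1))
  then show ?thesis
    by (intro sqint_mono[OF assms(2), of _ a])
      (use a sqint_measurable[OF assms(2)] in \<open>auto simp: mult.commute intro: measurable_compose\<close>)
qed

lemma sqint_scaleR: "f \<in> sqint \<Longrightarrow> (\<lambda>x. r *\<^sub>R f x) \<in> sqint"
  by (rule sqint_bounded_linear[OF bounded_linear_scaleR_right])

lemma sqint_minus: "f \<in> sqint \<Longrightarrow> (\<lambda>x. - f x) \<in> sqint"
  using sqint_scaleR[of f "-1"] by simp

lemma sqint_mult_i: "f \<in> sqint \<Longrightarrow> (\<lambda>x. \<i> * f x) \<in> sqint"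
  by (rule sqint_bounded_linear[OF bounded_linear_mult_right])

lemma sqint_cnj: "f \<in> sqint \<Longrightarrow> (\<lambda>x. cnj (f x)) \<in> sqint"
  by (rule sqint_bounded_linear[OF bounded_linear_cnj])

lemma sqint_integrable_mult:
  assumes "f \<in> sqint" "g \<in> sqint" shows "integrable lborel (\<lambda>x. cmod (f x) * cmod (g x))"
proof -
  have "integrable lborel (\<lambda>x. (cmod (f x))\<^sup>2 + (cmod (g x))\<^sup>2)"
    using assms by (intro Bochner_Integration.integrable_add sqint_integrable)
  then show ?thesis
  proof (rule Bochner_Integration.integrable_bound)
    show "(\<lambda>x. cmod (f x) * cmod (g x)) \<in> borel_measurable lborel"
      using assms by (auto dest!: sqint_measurable)
    show "AE x in lborel. norm (cmod (f x) * cmod (g x)) \<le> norm ((cmod (f x))\<^sup>2 + (cmod (g x))\<^sup>2)"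
    proof (intro AE_I2)
      fix x
      have "2 * (cmod (f x) * cmod (g x)) \<le> (cmod (f x))\<^sup>2 + (cmod (g x))\<^sup>2"
        using sum_squares_bound[of "cmod (f x)" "cmod (g x)"] by simp
      moreover have "0 \<le> cmod (f x) * cmod (g x)" by simp
      ultimately show "norm (cmod (f x) * cmod (g x)) \<le> norm ((cmod (f x))\<^sup>2 + (cmod (g x))\<^sup>2)"
        unfolding real_norm_def by linarith
    qed
  qed
qed

lemma sqint_integrable_complex_mult:
  assumes "f \<in> sqint" "g \<in> sqint" shows "integrable lborel (\<lambda>x. f x * g x)"
  by (rule Bochner_Integration.integrable_bound[OF sqint_integrable_mult[OF assms]])
    (use assms in \<open>auto simp: norm_mult dest!: sqint_measurable\<close>)

lemma sqint_integrable_inner: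
  assumes "f \<in> sqint" "g \<in> sqint" shows "integrable lborel (\<lambda>x. f x \<bullet> g x)"
  by (rule Bochner_Integration.integrable_bound[OF sqint_integrable_mult[OF assms]])
    (use assms in \<open>auto simp: Cauchy_Schwarz_ineq2 abs_mult dest!: sqint_measurable\<close>)

text \<open>As a type, the space \<open>L\<^sup>2\<close> becomes an instance of the abstract theory of real Hilbert spaces. Its
  inner product is the real part of the Hermitian one; complex pairings are recovered by testing also
  with \<open>\<i>\<close>-multiples.\<close>

quotient_type (overloaded) 'a l2 = "'a::euclidean_space \<Rightarrow> complex" / partial:
  "\<lambda>f g. f \<in> sqint \<and> g \<in> sqint \<and> (AE x in lborel. f x = g x)"
  morphisms Rep_quot cls
proof (rule part_equivpI)
  show "\<exists>f :: 'a \<Rightarrow> complex. f \<in> sqint \<and> f \<in> sqint \<and> (AE x in lborel. f x = f x)"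
    using sqint_zero by auto
  show "symp (\<lambda>f g :: 'a \<Rightarrow> complex. f \<in> sqint \<and> g \<in> sqint \<and> (AE x in lborel. f x = g x))"
    by (rule sympI) (auto elim: AE_mp simp: eq_commute)
  show "transp (\<lambda>f g :: 'a \<Rightarrow> complex. f \<in> sqint \<and> g \<in> sqint \<and> (AE x in lborel. f x = g x))"
  proof (rule transpI, elim conjE, intro conjI)
    fix f g h :: "'a \<Rightarrow> complex"
    assume "AE x in lborel. f x = g x" "AE x in lborel. g x = h x"
    then show "AE x in lborel. f x = h x" by eventually_elim simp
  qed
qed

definition rep :: "'a::euclidean_space l2 \<Rightarrow> 'a \<Rightarrow> complex" where
  "rep u = (SOME f. f \<in> sqint \<and> cls f = u)"

lemma rep_sqint [simp, intro]: "rep u \<in> sqint" and cls_rep [simp]: "cls (rep u) = u"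
proof -
  have "\<exists>f. f \<in> sqint \<and> cls f = u"
    using Quotient_abs_rep[OF Quotient_l2, of u] Quotient_rep_reflp[OF Quotient_l2, of u] by auto
  from someI_ex[OF this] show "rep u \<in> sqint" "cls (rep u) = u" by (auto simp: rep_def)
qed

lemma rep_measurable [measurable]: "rep u \<in> borel_measurable borel"
  by (rule sqint_measurable) simp

lemma cls_eq_iff:
  "f \<in> sqint \<Longrightarrow> g \<in> sqint \<Longrightarrow> cls f = cls g \<longleftrightarrow> (AE x in lborel. f x = g x)"
  using Quotient_rel[OF Quotient_l2, of f g] by auto

lemma AE_rep_cls: "f \<in> sqint \<Longrightarrow> AE x in lborel. rep (cls f) x = f x"
  using cls_eq_iff[of "rep (cls f)" f] by simp

instantiation l2 :: (euclidean_space) real_inner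
begin

lift_definition zero_l2 :: "'a l2" is "\<lambda>x. 0" by (simp add: sqint_zero)

lift_definition plus_l2 :: "'a l2 \<Rightarrow> 'a l2 \<Rightarrow> 'a l2" is "\<lambda>f g x. f x + g x"
  by (auto intro: sqint_add)

lift_definition minus_l2 :: "'a l2 \<Rightarrow> 'a l2 \<Rightarrow> 'a l2" is "\<lambda>f g x. f x - g x"
  by (auto intro: sqint_diff)

lift_definition uminus_l2 :: "'a l2 \<Rightarrow> 'a l2" is "\<lambda>f x. - f x"
  by (auto intro: sqint_minus)

lift_definition scaleR_l2 :: "real \<Rightarrow> 'a l2 \<Rightarrow> 'a l2" is "\<lambda>r f x. r *\<^sub>R f x"
  by (auto intro: sqint_scaleR)

lift_definition inner_l2 :: "'a l2 \<Rightarrow> 'a l2 \<Rightarrow> real" is "\<lambda>f g. LINT x|lborel. f x \<bullet> g x"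
  by (rule integral_cong_AE) (auto dest!: sqint_measurable elim: AE_mp)

definition norm_l2 :: "'a l2 \<Rightarrow> real" where "norm_l2 u = sqrt (inner u u)"
definition dist_l2 :: "'a l2 \<Rightarrow> 'a l2 \<Rightarrow> real" where "dist_l2 u v = norm (u - v)"
definition sgn_l2 :: "'a l2 \<Rightarrow> 'a l2" where "sgn_l2 u = scaleR (inverse (norm u)) u"
definition uniformity_l2 :: "('a l2 \<times> 'a l2) filter" where
  "uniformity_l2 = (INF e\<in>{0 <..}. principal {(x, y). dist x y < e})"
definition open_l2 :: "'a l2 set \<Rightarrow> bool" where
  "open_l2 U \<longleftrightarrow> (\<forall>x\<in>U. \<forall>\<^sub>F (x', y) in uniformity. x' = x \<longrightarrow> y \<in> U)"

instance
proof
  fix u v w :: "'a l2" and r s :: real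
  show "u + v + w = u + (v + w)" by transfer (auto intro: sqint_add simp: add.assoc)
  show "u + v = v + u" by transfer (auto intro: sqint_add simp: add.commute)
  show "0 + u = u" by transfer auto
  show "- u + u = 0" by transfer (auto simp: sqint_zero)
  show "u - v = u + - v" by transfer (auto intro: sqint_diff sqint_add sqint_minus)
  show "r *\<^sub>R (u + v) = r *\<^sub>R u + r *\<^sub>R v"
    by transfer (auto intro: sqint_scaleR sqint_add simp: scaleR_add_right)
  show "(r + s) *\<^sub>R u = r *\<^sub>R u + s *\<^sub>R u"
    by transfer (auto intro: sqint_scaleR sqint_add simp: scaleR_add_left)
  show "r *\<^sub>R s *\<^sub>R u = (r * s) *\<^sub>R u" by transfer (auto intro: sqint_scaleR)
  show "1 *\<^sub>R u = u" by transfer auto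
  show "dist u v = norm (u - v)" by (rule dist_l2_def)
  show "sgn u = scaleR (inverse (norm u)) u" by (rule sgn_l2_def)
  show "uniformity = (INF e\<in>{0 <..}. principal {(x :: 'a l2, y). dist x y < e})" by (rule uniformity_l2_def)
  show "open U \<longleftrightarrow> (\<forall>x\<in>U. \<forall>\<^sub>F (x', y) in uniformity. x' = x \<longrightarrow> y \<in> U)" for U :: "'a l2 set"
    by (rule open_l2_def)
  show "inner u v = inner v u" by transfer (simp add: inner_commute)
  show "inner (u + v) w = inner u w + inner v w"
    by transfer (simp add: inner_add_left sqint_integrable_inner)
  show "inner (r *\<^sub>R u) v = r * inner u v" by transfer simp
  show "0 \<le> inner u u" by transfer simp
  show "inner u u = 0 \<longleftrightarrow> u = 0"
  proof (transfer, clarsimp)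
    fix f :: "'a \<Rightarrow> complex" assume f: "f \<in> sqint"
    have "(LINT x|lborel. f x \<bullet> f x) = 0 \<longleftrightarrow> (AE x in lborel. f x \<bullet> f x = 0)"
      by (rule integral_nonneg_eq_0_iff_AE) (auto intro: sqint_integrable_inner f)
    then show "(LINT x|lborel. f x \<bullet> f x) = 0 \<longleftrightarrow> (\<lambda>x::'a. 0::complex) \<in> sqint \<and> (AE x in lborel. f x = 0)"
      by (simp add: sqint_zero)
  qed
  show "norm u = sqrt (inner u u)" by (rule norm_l2_def)
qed

end

lemma cls_zero: "cls (\<lambda>x. 0) = 0"
  by (simp add: zero_l2.abs_eq)

lemma cls_add: "f \<in> sqint \<Longrightarrow> g \<in> sqint \<Longrightarrow> cls (\<lambda>x. f x + g x) = cls f + cls g"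
  by (simp add: plus_l2.abs_eq)

lemma cls_diff: "f \<in> sqint \<Longrightarrow> g \<in> sqint \<Longrightarrow> cls (\<lambda>x. f x - g x) = cls f - cls g"
  by (simp add: minus_l2.abs_eq)

lemma cls_scaleR: "f \<in> sqint \<Longrightarrow> cls (\<lambda>x. r *\<^sub>R f x) = r *\<^sub>R cls f"
  by (simp add: scaleR_l2.abs_eq)

lemma inner_cls: "f \<in> sqint \<Longrightarrow> g \<in> sqint \<Longrightarrow> inner (cls f) (cls g) = (LINT x|lborel. f x \<bullet> g x)"
  by (simp add: inner_l2.abs_eq)

lemma inner_l2_rep: "inner u v = (LINT x|lborel. rep u x \<bullet> rep v x)"
  using inner_cls[of "rep u" "rep v"] by simp

lemma norm_cls_sq: "f \<in> sqint \<Longrightarrow> (norm (cls f))\<^sup>2 = (LINT x|lborel. (cmod (f x))\<^sup>2)"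
  by (simp add: power2_norm_eq_inner inner_cls)

lemma norm_l2_rep: "(norm u)\<^sup>2 = (LINT x|lborel. (cmod (rep u x))\<^sup>2)"
  using norm_cls_sq[of "rep u"] by simp

lemma nn_integral_sqint:
  "f \<in> sqint \<Longrightarrow> (\<integral>\<^sup>+x. ennreal ((cmod (f x))\<^sup>2) \<partial>lborel) = ennreal ((norm (cls f))\<^sup>2)"
  by (simp add: norm_cls_sq nn_integral_eq_integral sqint_integrable)

lemma AE_rep_add: "AE x in lborel. rep (u + v) x = rep u x + rep v x"
  using AE_rep_cls[OF sqint_add[of "rep u" "rep v"]] by (simp add: cls_add)

lemma AE_rep_diff: "AE x in lborel. rep (u - v) x = rep u x - rep v x"
  using AE_rep_cls[OF sqint_diff[of "rep u" "rep v"]] by (simp add: cls_diff)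

lemma AE_rep_scaleR: "AE x in lborel. rep (r *\<^sub>R u) x = r *\<^sub>R rep u x"
  using AE_rep_cls[OF sqint_scaleR[of "rep u" r]] by (simp add: cls_scaleR)

lemma sqint_norm_le:
  assumes [measurable]: "f \<in> borel_measurable borel"
    and "(\<integral>\<^sup>+x. ennreal ((cmod (f x))\<^sup>2) \<partial>lborel) \<le> ennreal (c\<^sup>2)" "0 \<le> c"
  shows "f \<in> sqint" "norm (cls f) \<le> c"
proof -
  show f: "f \<in> sqint"
  proof (rule sqintI)
    show "integrable lborel (\<lambda>x. (cmod (f x))\<^sup>2)"
      by (rule integrableI_bounded) (use assms(2) in \<open>auto intro: le_less_trans\<close>)
  qed simp
  have "(norm (cls f))\<^sup>2 \<le> c\<^sup>2"
    using assms(2) by (simp add: nn_integral_sqint[OF f])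
  then show "norm (cls f) \<le> c" using assms(3) by (rule power2_le_imp_le)
qed

text \<open>On a space of infinite measure, \<open>L\<^sup>2\<close> bounds do not give \<open>L\<^sup>1\<close> bounds. They do after
  multiplication by a positive square integrable weight, which leaves almost everywhere convergence
  unchanged.\<close>

lemma obtain_l2_weight:
  obtains \<rho> :: "'a::euclidean_space \<Rightarrow> real" where
    "\<rho> \<in> borel_measurable borel" "\<And>x. 0 < \<rho> x" "\<And>x. \<rho> x \<le> 1"
    "integrable lborel \<rho>" "(\<lambda>x. complex_of_real (\<rho> x)) \<in> sqint"
proof -
  obtain \<rho> :: "'a \<Rightarrow> real" where r: "\<rho> \<in> borel_measurable lborel" "\<And>x. 0 < \<rho> x" "\<And>x. \<rho> x \<le> 1" "integrable lborel \<rho>"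
    by (rule sigma_finite_measure.obtain_positive_integrable_function[OF sigma_finite_lborel]) (rule that)
  have "(\<lambda>x. complex_of_real (\<rho> x)) \<in> sqint"
  proof (rule sqintI)
    show "(\<lambda>x. complex_of_real (\<rho> x)) \<in> borel_measurable borel" using r(1) by simp
    show "integrable lborel (\<lambda>x. (cmod (complex_of_real (\<rho> x)))\<^sup>2)"
    proof (rule Bochner_Integration.integrable_bound[OF r(4)])
      show "AE x in lborel. norm ((cmod (complex_of_real (\<rho> x)))\<^sup>2) \<le> norm (\<rho> x)"
        using r(2,3) by (auto simp: power2_eq_square abs_mult mult_left_le less_imp_le)
    qed (use r(1) in simp)
  qed
  with r show thesis by (intro that[of \<rho>]) simp_all
qed

lemma weighted_L1_le:
  assumes [measurable]: "f \<in> sqint" and r: "(\<lambda>x. complex_of_real (\<rho> x)) \<in> sqint" "\<And>x. 0 \<le> \<rho> x"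
  shows "integrable lborel (\<lambda>x. \<rho> x * cmod (f x))"
    "(LINT x|lborel. \<rho> x * cmod (f x)) \<le> norm (cls (\<lambda>x. complex_of_real (\<rho> x))) * norm (cls f)"
proof -
  have f': "(\<lambda>x. complex_of_real (cmod (f x))) \<in> sqint"
    by (rule sqint_mono[OF assms(1), of _ 1]) (use sqint_measurable[OF assms(1)] in auto)
  show "integrable lborel (\<lambda>x. \<rho> x * cmod (f x))"
    using sqint_integrable_inner[OF r(1) f'] by (simp add: inner_complex_def)
  have "(LINT x|lborel. \<rho> x * cmod (f x)) = inner (cls (\<lambda>x. complex_of_real (\<rho> x))) (cls (\<lambda>x. complex_of_real (cmod (f x))))"
    by (simp add: inner_cls[OF r(1) f'] inner_complex_def)
  also have "\<dots> \<le> norm (cls (\<lambda>x. complex_of_real (\<rho> x))) * norm (cls (\<lambda>x. complex_of_real (cmod (f x))))"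
    by (rule norm_cauchy_schwarz)
  also have "norm (cls (\<lambda>x. complex_of_real (cmod (f x)))) = norm (cls f)"
  proof (rule power2_eq_imp_eq)
    show "(norm (cls (\<lambda>x. complex_of_real (cmod (f x)))))\<^sup>2 = (norm (cls f))\<^sup>2"
      by (simp add: norm_cls_sq f' assms(1))
  qed auto
  finally show "(LINT x|lborel. \<rho> x * cmod (f x)) \<le> norm (cls (\<lambda>x. complex_of_real (\<rho> x))) * norm (cls f)" .
qed

lemma Cauchy_l2_AE_subseq:
  fixes X :: "nat \<Rightarrow> 'a::euclidean_space l2"
  assumes "Cauchy X"
  obtains r where "strict_mono (r::nat\<Rightarrow>nat)" "AE x in lborel. Cauchy (\<lambda>i. rep (X (r i)) x)"
proof -
  obtain \<rho> :: "'a \<Rightarrow> real" where [measurable]: "\<rho> \<in> borel_measurable borel"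
    and r: "\<And>x. 0 < \<rho> x" "(\<lambda>x. complex_of_real (\<rho> x)) \<in> sqint"
    using obtain_l2_weight by metis
  define R where "R = norm (cls (\<lambda>x. complex_of_real (\<rho> x)))"
  define s where "s n x = \<rho> x *\<^sub>R rep (X n) x" for n x
  have int: "integrable lborel (s n)" for n
    by (rule Bochner_Integration.integrable_bound[OF weighted_L1_le(1)[OF rep_sqint[of "X n"] r(2)]])
      (auto simp: s_def[abs_def] r(1) less_imp_le)
  have bound: "(LINT x|lborel. norm (s i x - s j x)) \<le> R * norm (X i - X j)" for i j
  proof -
    have "norm (s i x - s j x) = \<rho> x * cmod (rep (X i) x - rep (X j) x)" for x
      unfolding s_def using r(1)[of x] by (simp flip: scaleR_diff_right)
    then show ?thesis
      using weighted_L1_le(2)[OF sqint_diff[OF rep_sqint[of "X i"] rep_sqint[of "X j"]] r(2) less_imp_le[OF r(1)]]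
      by (simp add: R_def cls_diff)
  qed
  have small: "\<exists>N. \<forall>i\<ge>N. \<forall>j\<ge>N. (LINT x|lborel. norm (s i x - s j x)) < e" if e: "e > 0" for e
  proof -
    have pos: "R + 1 > 0" by (simp add: R_def add_nonneg_pos)
    obtain N where N: "\<And>i j. i \<ge> N \<Longrightarrow> j \<ge> N \<Longrightarrow> norm (X i - X j) < e / (R + 1)"
      using CauchyD[OF assms, of "e / (R + 1)"] e pos by auto
    have "(LINT x|lborel. norm (s i x - s j x)) < e" if "i \<ge> N" "j \<ge> N" for i j
    proof -
      have "(LINT x|lborel. norm (s i x - s j x)) \<le> R * norm (X i - X j)" by (rule bound)
      also have "\<dots> \<le> (R + 1) * norm (X i - X j)" by (simp add: mult_right_mono)
      also have "\<dots> < e" using N[OF that] pos by (simp add: field_simps)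
      finally show ?thesis .
    qed
    then show ?thesis by blast
  qed
  from cauchy_L1_AE_cauchy_subseq[OF int small]
  obtain t where t: "strict_mono t" "AE x in lborel. Cauchy (\<lambda>i. s (t i) x)" by metis
  have "AE x in lborel. Cauchy (\<lambda>i. rep (X (t i)) x)"
    using t(2)
  proof eventually_elim
    case (elim x)
    have "Cauchy (\<lambda>i. inverse (\<rho> x) *\<^sub>R s (t i) x)"
      by (rule bounded_linear.Cauchy[OF bounded_linear_scaleR_right elim])
    then show ?case using r(1)[of x] by (simp add: s_def)
  qed
  with t(1) show thesis by (rule that)
qed

lemma nn_integral_liminf_le:
  assumes [measurable]: "\<And>i. g i \<in> borel_measurable M" "f \<in> borel_measurable M"
    and "AE x in M. (\<lambda>i. g i x) \<longlonglongrightarrow> f x" and bd: "\<And>i. i \<ge> N \<Longrightarrow> (\<integral>\<^sup>+x. ennreal (g i x) \<partial>M) \<le> B"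
  shows "(\<integral>\<^sup>+x. ennreal (f x) \<partial>M) \<le> B"
proof -
  have "(\<integral>\<^sup>+x. ennreal (f x) \<partial>M) = (\<integral>\<^sup>+x. liminf (\<lambda>i. ennreal (g i x)) \<partial>M)"
  proof (rule nn_integral_cong_AE)
    show "AE x in M. ennreal (f x) = liminf (\<lambda>i. ennreal (g i x))"
      using assms(3)
    proof eventually_elim
      case (elim x)
      then have "(\<lambda>i. ennreal (g i x)) \<longlonglongrightarrow> ennreal (f x)" by (rule tendsto_ennrealI)
      then show ?case by (rule lim_imp_Liminf[OF sequentially_bot, symmetric])
    qed
  qed
  also have "\<dots> \<le> liminf (\<lambda>i. \<integral>\<^sup>+x. ennreal (g i x) \<partial>M)"
    by (rule nn_integral_liminf) simp
  also have "\<dots> \<le> B"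
    by (rule Liminf_le[OF sequentially_bot eventually_sequentiallyI[of N]]) (simp add: bd)
  finally show ?thesis .
qed

text \<open>This is the theorem of Riesz and Fischer: the limit of an almost everywhere convergent
  subsequence is close to the members of the sequence by Fatou's lemma.\<close>

instance l2 :: (euclidean_space) complete_space
proof
  fix X :: "nat \<Rightarrow> 'a l2" assume X: "Cauchy X"
  obtain t where t: "strict_mono t" "AE x in lborel. Cauchy (\<lambda>i. rep (X (t i)) x)"
    using Cauchy_l2_AE_subseq[OF X] by metis
  define f where "f x = lim (\<lambda>i. rep (X (t i)) x)" for x
  have [measurable]: "f \<in> borel_measurable borel" unfolding f_def by measurable
  have lim: "AE x in lborel. (\<lambda>i. rep (X (t i)) x) \<longlonglongrightarrow> f x"
    using t(2) by eventually_elim (auto simp: f_def Cauchy_convergent_iff convergent_LIMSEQ_iff)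
  have close: "f \<in> sqint \<and> norm (cls f - X n) \<le> e"
    if e: "e > 0" and N: "\<And>m n. m \<ge> N \<Longrightarrow> n \<ge> N \<Longrightarrow> norm (X m - X n) < e" and n: "n \<ge> N" for e N n
  proof -
    let ?h = "\<lambda>x. f x - rep (X n) x"
    have "(\<integral>\<^sup>+x. ennreal ((cmod (?h x))\<^sup>2) \<partial>lborel) \<le> ennreal (e\<^sup>2)"
    proof (rule nn_integral_liminf_le[where g = "\<lambda>i x. (cmod (rep (X (t i)) x - rep (X n) x))\<^sup>2" and N = N])
      show "AE x in lborel. (\<lambda>i. (cmod (rep (X (t i)) x - rep (X n) x))\<^sup>2) \<longlonglongrightarrow> (cmod (?h x))\<^sup>2"
        using lim by eventually_elim (intro tendsto_intros)
      fix i assume "i \<ge> N"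
      then have "t i \<ge> N" using seq_suble[OF t(1), of i] by simp
      then have "norm (X (t i) - X n) \<le> e" using N[OF _ n] by (simp add: less_imp_le)
      then show "(\<integral>\<^sup>+x. ennreal ((cmod (rep (X (t i)) x - rep (X n) x))\<^sup>2) \<partial>lborel) \<le> ennreal (e\<^sup>2)"
        by (simp add: nn_integral_sqint sqint_diff cls_diff power_mono ennreal_leI)
    qed simp_all
    then have h: "?h \<in> sqint" "norm (cls ?h) \<le> e" using sqint_norm_le[of ?h e] e by simp_all
    from sqint_add[OF h(1) rep_sqint[of "X n"]] have f: "f \<in> sqint" by simp
    with h(2) show ?thesis by (simp add: cls_diff)
  qed
  have "X \<longlonglongrightarrow> cls f"
  proof (rule LIMSEQ_I)
    fix e :: real assume "e > 0"
    then have e2: "e / 2 > 0" by simp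
    obtain N where N: "\<And>m n. m \<ge> N \<Longrightarrow> n \<ge> N \<Longrightarrow> norm (X m - X n) < e / 2"
      using CauchyD[OF X e2] by auto
    have "norm (X n - cls f) < e" if "n \<ge> N" for n
      using close[OF e2 N that] e2 by (simp add: norm_minus_commute)
    then show "\<exists>N. \<forall>n\<ge>N. norm (X n - cls f) < e" by blast
  qed
  then show "convergent X" by (rule convergentI)
qed

section \<open>Translations\<close>

lemma lborel_translate_eq: "distr lborel borel (\<lambda>x::'a::euclidean_space. x + y) = lborel"
proof -
  have "(\<lambda>x. x + y) = (+) y" by (simp add: fun_eq_iff add.commute)
  then show ?thesis by (simp only: lborel_distr_plus)
qed

lemma AE_translate: "(AE x in lborel. P x) \<Longrightarrow> (AE x in lborel. P (x + y :: 'a::euclidean_space))"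
  by (rule AE_distrD[of "\<lambda>x. x + y" lborel borel P]) (simp, simp only: lborel_translate_eq)

lemma integral_translate:
  fixes f :: "'a::euclidean_space \<Rightarrow> 'b::{banach, second_countable_topology}"
  assumes "f \<in> borel_measurable borel"
  shows "(LINT x|lborel. f (x + y)) = (LINT x|lborel. f x)"
  using integral_distr[of "\<lambda>x. x + y" lborel borel f] assms by (simp add: lborel_translate_eq)

lemma integrable_translate:
  fixes f :: "'a::euclidean_space \<Rightarrow> 'b::{banach, second_countable_topology}"
  assumes "integrable lborel f"
  shows "integrable lborel (\<lambda>x. f (x + y))"
  using integrable_distr[of "\<lambda>x. x + y" lborel borel f] assms by (simp add: lborel_translate_eq)

lemma sqint_translate: "f \<in> sqint \<Longrightarrow> (\<lambda>x. f (x + y)) \<in> sqint"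
  using sqint_measurable[of f] integrable_translate[OF sqint_integrable, of f y]
  by (intro sqintI[OF measurable_compose[of "\<lambda>x. x + y" borel borel f]]) auto

definition shift :: "'a::euclidean_space \<Rightarrow> 'a l2 \<Rightarrow> 'a l2" where
  "shift y u = cls (\<lambda>x. rep u (x + y))"

lemma shift_cls: "f \<in> sqint \<Longrightarrow> shift y (cls f) = cls (\<lambda>x. f (x + y))"
  unfolding shift_def using AE_translate[OF AE_rep_cls] by (simp add: cls_eq_iff sqint_translate)

lemma AE_rep_shift: "AE x in lborel. rep (shift y u) x = rep u (x + y)"
  unfolding shift_def by (rule AE_rep_cls) (simp add: sqint_translate)

lemma shift_add: "shift y (u + v) = shift y u + shift y v"
proof -
  have "shift y (cls (\<lambda>x. rep u x + rep v x)) = shift y (cls (rep u)) + shift y (cls (rep v))"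
    unfolding shift_cls[OF rep_sqint] shift_cls[OF sqint_add[OF rep_sqint rep_sqint]]
    by (rule cls_add) (simp_all add: sqint_translate)
  then show ?thesis by (simp add: cls_add)
qed

lemma shift_scaleR: "shift y (r *\<^sub>R u) = r *\<^sub>R shift y u"
proof -
  have "shift y (cls (\<lambda>x. r *\<^sub>R rep u x)) = r *\<^sub>R shift y (cls (rep u))"
    unfolding shift_cls[OF rep_sqint] shift_cls[OF sqint_scaleR[OF rep_sqint]]
    by (rule cls_scaleR) (simp_all add: sqint_translate)
  then show ?thesis by (simp add: cls_scaleR)
qed

lemma inner_shift: "inner (shift y u) (shift y v) = inner u v"
proof -
  have "(\<lambda>x. rep u x \<bullet> rep v x) \<in> borel_measurable borel" by simp
  from integral_translate[OF this, of y] show ?thesis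
    unfolding shift_def inner_cls[OF sqint_translate[OF rep_sqint] sqint_translate[OF rep_sqint]]
    by (simp add: inner_l2_rep)
qed

lemma norm_shift [simp]: "norm (shift y u) = norm u"
  by (simp add: norm_eq_sqrt_inner inner_shift)

lemma bounded_linear_shift: "bounded_linear (shift y)"
  by (rule bounded_linear_intro[of _ 1]) (simp_all add: shift_add shift_scaleR)

lemmas shift_diff = linear_diff[OF bounded_linear.linear[OF bounded_linear_shift]]
lemmas shift_sum = linear_sum[OF bounded_linear.linear[OF bounded_linear_shift]]

lemma shift_shift: "shift y (shift z u) = shift (y + z) u"
  using shift_cls[OF sqint_translate[OF rep_sqint[of u], of z], of y]
  by (simp add: shift_def[of _ u] add.assoc)

lemma shift_0 [simp]: "shift 0 u = u"
  by (simp add: shift_def)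

lemma inner_shift_left: "inner (shift y u) v = inner u (shift (- y) v)"
  using inner_shift[of "-y" "shift y u" v] by (simp add: shift_shift)

section \<open>Test functions\<close>

lemma pderivs_append: "pderivs (as @ bs) f = pderivs as (pderivs bs f)"
  by (induct as) auto

lemma test_function_differentiable:
  "test_function \<phi> \<Longrightarrow> set bs \<subseteq> Basis \<Longrightarrow> pderivs bs \<phi> differentiable (at x)"
  by (simp add: test_function_def)

lemma frechet_derivative_cong_open:
  assumes "open U" "x \<in> U" "\<And>y. y \<in> U \<Longrightarrow> f y = g y"
  shows "frechet_derivative f (at x) = frechet_derivative g (at x)"
proof -
  have "(f has_derivative f') (at x) \<longleftrightarrow> (g has_derivative f') (at x)" for f'
    using has_derivative_transform_within_open[OF _ assms(1,2), of f f' UNIV g]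
      has_derivative_transform_within_open[OF _ assms(1,2), of g f' UNIV f] assms(3) by auto
  then show ?thesis unfolding frechet_derivative_def by simp
qed

lemma pderivs_zero_outside_support:
  assumes "x \<notin> closure {x. f x \<noteq> 0}"
  shows "pderivs bs f x = 0"
  using assms
proof (induct bs arbitrary: x)
  case Nil
  then show ?case using subsetD[OF closure_subset, of x "{x. f x \<noteq> 0}"] by auto
next
  case (Cons b bs)
  let ?U = "- closure {x. f x \<noteq> 0}"
  have "frechet_derivative (pderivs bs f) (at x) = frechet_derivative (\<lambda>x. 0) (at x)"
    by (rule frechet_derivative_cong_open[of ?U]) (use Cons in auto)
  then show ?case by simp
qed

lemma test_function_pderivs:
  assumes "test_function \<phi>" "set bs \<subseteq> Basis"
  shows "test_function (pderivs bs \<phi>)"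
  unfolding test_function_def
proof (intro conjI allI impI)
  fix as :: "'a list" and x assume "set as \<subseteq> Basis"
  then show "pderivs as (pderivs bs \<phi>) differentiable (at x)"
    using test_function_differentiable[OF assms(1), of "as @ bs" x] assms(2) by (simp add: pderivs_append)
next
  have "closure {x. pderivs bs \<phi> x \<noteq> 0} \<subseteq> closure {x. \<phi> x \<noteq> 0}"
    by (rule closure_minimal) (use pderivs_zero_outside_support in auto)
  then show "compact (closure {x. pderivs bs \<phi> x \<noteq> 0})"
    using assms(1) bounded_subset compact_imp_bounded bounded_closure closed_closure
    unfolding test_function_def compact_eq_bounded_closed by blast
qed

lemma test_function_has_derivative:
  assumes "test_function \<phi>"
  shows "(\<phi> has_derivative frechet_derivative \<phi> (at x)) (at x)"
  using test_function_differentiable[OF assms, of "[]" x] by (simp add: frechet_derivative_works)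

lemma test_function_continuous: "test_function \<phi> \<Longrightarrow> continuous_on UNIV \<phi>"
  using test_function_has_derivative has_derivative_continuous
  by (metis continuous_at_imp_continuous_on)

lemma test_function_bounded:
  assumes "test_function \<phi>"
  obtains B where "\<And>x. cmod (\<phi> x) \<le> B"
proof -
  let ?S = "closure {x. \<phi> x \<noteq> 0}"
  have "compact (\<phi> ` ?S)"
    using assms test_function_continuous[OF assms] unfolding test_function_def
    by (intro compact_continuous_image) (auto intro: continuous_on_subset)
  then obtain B where B: "\<And>z. z \<in> \<phi> ` ?S \<Longrightarrow> cmod z \<le> B"
    using compact_imp_bounded bounded_iff by metis
  have "cmod (\<phi> x) \<le> max B 0" for x
  proof (cases "\<phi> x = 0")
    case False
    then have "x \<in> ?S" using closure_subset[of "{x. \<phi> x \<noteq> 0}"] by auto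
    then show ?thesis using B[of "\<phi> x"] by auto
  qed auto
  then show thesis by (rule that)
qed

lemma bounded_compact_support_sqint:
  assumes [measurable]: "f \<in> borel_measurable borel" and "compact S" "\<And>x. x \<notin> S \<Longrightarrow> f x = 0"
    and "\<And>x. cmod (f x) \<le> B"
  shows "f \<in> sqint"
proof (rule sqintI)
  have S: "S \<in> sets lborel" "emeasure lborel S < \<infinity>"
    using emeasure_compact_finite[OF assms(2)] borel_closed[OF compact_imp_closed[OF assms(2)]] by auto
  show "integrable lborel (\<lambda>x. (cmod (f x))\<^sup>2)"
    by (rule integrableI_bounded_set[of S _ _ "B\<^sup>2"])
      (use S assms(3,4) in \<open>auto intro!: power_mono AE_I2\<close>)
qed simp

lemma test_function_sqint:
  assumes "test_function \<phi>" shows "\<phi> \<in> sqint"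
proof -
  obtain B where "\<And>x. cmod (\<phi> x) \<le> B" using test_function_bounded[OF assms] by metis
  then show ?thesis
    using assms closure_subset[of "{x. \<phi> x \<noteq> 0}"] test_function_continuous[OF assms]
    by (intro bounded_compact_support_sqint[of \<phi> "closure {x. \<phi> x \<noteq> 0}" B])
      (auto simp: test_function_def intro: borel_measurable_continuous_onI)
qed

lemma pderivs_bounded_linear:
  assumes "bounded_linear L" "test_function \<phi>" "set bs \<subseteq> Basis"
  shows "pderivs bs (\<lambda>x. L (\<phi> x)) = (\<lambda>x. L (pderivs bs \<phi> x))"
  using assms(3)
proof (induct bs)
  case (Cons b bs)
  have "((\<lambda>x. L (pderivs bs \<phi> x)) has_derivative (\<lambda>h. L (frechet_derivative (pderivs bs \<phi>) (at x) h))) (at x)" for x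
    using bounded_linear.has_derivative[OF assms(1) test_function_has_derivative[OF test_function_pderivs[OF assms(2), of bs]]] Cons by simp
  note eq = frechet_derivative_at[OF this]
  have "pderivs bs (\<lambda>x. L (\<phi> x)) = (\<lambda>x. L (pderivs bs \<phi> x))" using Cons by simp
  then show ?case by (simp only: pderivs.simps eq[symmetric])
qed simp

lemma test_function_bounded_linear:
  assumes "bounded_linear L" "test_function \<phi>"
  shows "test_function (\<lambda>x. L (\<phi> x))"
  unfolding test_function_def
proof (intro conjI allI impI)
  fix bs x assume bs: "set bs \<subseteq> (Basis :: 'a set)"
  show "pderivs bs (\<lambda>x. L (\<phi> x)) differentiable (at x)"
    unfolding pderivs_bounded_linear[OF assms bs] differentiable_def
    using bounded_linear.has_derivative[OF assms(1) test_function_has_derivative[OF test_function_pderivs[OF assms(2) bs]]] by blast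
next
  have "L 0 = 0" using linear_0[OF bounded_linear.linear[OF assms(1)]] .
  then have "closure {x. L (\<phi> x) \<noteq> 0} \<subseteq> closure {x. \<phi> x \<noteq> 0}"
    by (intro closure_mono) auto
  then show "compact (closure {x. L (\<phi> x) \<noteq> 0})"
    using assms(2) bounded_subset unfolding test_function_def compact_eq_bounded_closed by blast
qed

lemma pderivs_add:
  assumes "test_function \<phi>" "test_function \<psi>" "set bs \<subseteq> Basis"
  shows "pderivs bs (\<lambda>x. \<phi> x + \<psi> x) = (\<lambda>x. pderivs bs \<phi> x + pderivs bs \<psi> x)"
  using assms(3)
proof (induct bs)
  case (Cons b bs)
  have "((\<lambda>x. pderivs bs \<phi> x + pderivs bs \<psi> x) has_derivative
      (\<lambda>h. frechet_derivative (pderivs bs \<phi>) (at x) h + frechet_derivative (pderivs bs \<psi>) (at x) h)) (at x)" for x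
    by (intro has_derivative_add test_function_has_derivative test_function_pderivs assms) (use Cons in auto)
  note eq = frechet_derivative_at[OF this]
  have "pderivs bs (\<lambda>x. \<phi> x + \<psi> x) = (\<lambda>x. pderivs bs \<phi> x + pderivs bs \<psi> x)" using Cons by simp
  then show ?case by (simp only: pderivs.simps eq[symmetric])
qed simp

lemma test_function_add:
  assumes "test_function \<phi>" "test_function \<psi>"
  shows "test_function (\<lambda>x. \<phi> x + \<psi> x)"
  unfolding test_function_def
proof (intro conjI allI impI)
  fix bs x assume bs: "set bs \<subseteq> (Basis :: 'a set)"
  show "pderivs bs (\<lambda>x. \<phi> x + \<psi> x) differentiable (at x)"
    unfolding pderivs_add[OF assms bs]
    by (intro differentiable_add test_function_differentiable assms bs)
next
  have "{x. \<phi> x + \<psi> x \<noteq> 0} \<subseteq> {x. \<phi> x \<noteq> 0} \<union> {x. \<psi> x \<noteq> 0}" by auto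
  from closure_mono[OF this]
  have "closure {x. \<phi> x + \<psi> x \<noteq> 0} \<subseteq> closure {x. \<phi> x \<noteq> 0} \<union> closure {x. \<psi> x \<noteq> 0}"
    by (simp only: closure_Un)
  then show "compact (closure {x. \<phi> x + \<psi> x \<noteq> 0})"
    using assms bounded_subset[of "closure {x. \<phi> x \<noteq> 0} \<union> closure {x. \<psi> x \<noteq> 0}" "closure {x. \<phi> x + \<psi> x \<noteq> 0}"]
    unfolding test_function_def compact_eq_bounded_closed bounded_Un by simp
qed

lemma frechet_derivative_translate:
  "frechet_derivative (\<lambda>x. f (x + y)) (at x) = frechet_derivative f (at (x + y :: 'a::real_normed_vector))"
proof -
  have "((\<lambda>x. f (x + y)) has_derivative f') (at x) \<longleftrightarrow> (f has_derivative f') (at (x + y))" for f'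
  proof
    assume "(f has_derivative f') (at (x + y))"
    then show "((\<lambda>x. f (x + y)) has_derivative f') (at x)"
    proof -
      have "((\<lambda>x. x + y) has_derivative (\<lambda>h. h)) (at x)" by (auto intro!: derivative_eq_intros)
      from has_derivative_compose[OF this, of f f'] \<open>(f has_derivative f') (at (x + y))\<close>
      show ?thesis by simp
    qed
  next
    assume "((\<lambda>x. f (x + y)) has_derivative f') (at x)"
    then show "(f has_derivative f') (at (x + y))"
    proof -
      have "((\<lambda>x. x - y) has_derivative (\<lambda>h. h)) (at (x + y))" by (auto intro!: derivative_eq_intros)
      from has_derivative_compose[OF this, of "\<lambda>x. f (x + y)" f'] \<open>((\<lambda>x. f (x + y)) has_derivative f') (at x)\<close>
      show ?thesis by simp
    qed
  qed
  then show ?thesis unfolding frechet_derivative_def by simp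
qed

lemma pderivs_translate: "pderivs bs (\<lambda>x. f (x + y)) = (\<lambda>x. pderivs bs f (x + y))"
  by (induct bs) (simp_all add: frechet_derivative_translate)

lemma test_function_translate:
  assumes "test_function \<phi>"
  shows "test_function (\<lambda>x. \<phi> (x + y))"
  unfolding test_function_def
proof (intro conjI allI impI)
  fix bs x assume bs: "set bs \<subseteq> (Basis :: 'a set)"
  have "((\<lambda>x. x + y) has_derivative (\<lambda>h. h)) (at x)" by (auto intro!: derivative_eq_intros)
  from has_derivative_compose[OF this test_function_has_derivative[OF test_function_pderivs[OF assms bs]]]
  show "pderivs bs (\<lambda>x. \<phi> (x + y)) differentiable (at x)"
    unfolding pderivs_translate differentiable_def by blast
next
  have "{x. \<phi> (x + y) \<noteq> 0} = (\<lambda>x. x + (- y)) ` {x. \<phi> x \<noteq> 0}" by force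
  then have "closure {x. \<phi> (x + y) \<noteq> 0} = (\<lambda>x. - y + x) ` closure {x. \<phi> x \<noteq> 0}"
    using closure_translation[of "-y" "{x. \<phi> x \<noteq> 0}"] by (simp add: add.commute)
  then show "compact (closure {x. \<phi> (x + y) \<noteq> 0})"
    using assms compact_translation[of "closure {x. \<phi> x \<noteq> 0}" "-y"] unfolding test_function_def by metis
qed

section \<open>Bump functions and the fundamental lemma of the calculus of variations\<close>

text \<open>The classical function that is smooth and flat at \<open>0\<close>. The polynomial factor makes the family
  closed under differentiation.\<close>

definition flat_exp :: "real poly \<Rightarrow> real \<Rightarrow> real" where
  "flat_exp P s = (if s > 0 then poly P (1 / s) * exp (- (1 / s)) else 0)"

lemma poly_exp_tendsto_0: "((\<lambda>x. poly P x * exp (- x)) \<longlongrightarrow> (0::real)) at_top"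
proof -
  have "((\<lambda>x. \<Sum>i\<le>degree P. coeff P i * (x ^ i / exp x)) \<longlongrightarrow> (\<Sum>i\<le>degree P. coeff P i * 0)) at_top"
    by (intro tendsto_intros tendsto_power_div_exp_0)
  moreover have "(\<lambda>x. \<Sum>i\<le>degree P. coeff P i * (x ^ i / exp x)) = (\<lambda>x. poly P x * exp (- x))"
    by (simp add: poly_altdef sum_distrib_right sum_divide_distrib exp_minus divide_inverse mult.assoc fun_eq_iff)
  ultimately show ?thesis by simp
qed

lemma flat_exp_has_derivative:
  "(flat_exp P has_real_derivative flat_exp ([:0, 0, 1:] * (P - pderiv P)) s) (at s)"
proof -
  let ?Q = "[:0, 0, 1:] * (P - pderiv P)"
  consider "s > 0" | "s < 0" | "s = 0" by linarith
  then show ?thesis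
  proof cases
    case 1
    have "((\<lambda>s. poly P (1 / s) * exp (- (1 / s))) has_real_derivative
        poly ?Q (1 / s) * exp (- (1 / s))) (at s)"
      using 1 by (auto intro!: derivative_eq_intros simp: power2_eq_square field_simps)
    then have "(flat_exp P has_real_derivative poly ?Q (1 / s) * exp (- (1 / s))) (at s)"
      by (rule has_field_derivative_transform_within_open[of _ _ _ "{0<..}"])
        (use 1 in \<open>auto simp: flat_exp_def\<close>)
    then show ?thesis using 1 by (simp add: flat_exp_def)
  next
    case 2
    have "((\<lambda>s. 0) has_real_derivative 0) (at s)" by simp
    then have "(flat_exp P has_real_derivative 0) (at s)"
      by (rule has_field_derivative_transform_within_open[of _ _ _ "{..<0}"])
        (use 2 in \<open>auto simp: flat_exp_def\<close>)
    then show ?thesis using 2 by (simp add: flat_exp_def)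
  next
    case 3
    have "((\<lambda>h. poly ([:0, 1:] * P) (1 / h) * exp (- (1 / h))) \<longlongrightarrow> 0) (at_right 0)"
      using filterlim_compose[OF poly_exp_tendsto_0[of "[:0, 1:] * P"] filterlim_inverse_at_top_right]
      by (simp add: divide_inverse)
    then have "((\<lambda>h. (flat_exp P (0 + h) - flat_exp P 0) / h) \<longlongrightarrow> 0) (at_right 0)"
      by (rule Lim_transform_eventually)
        (auto simp: eventually_at_filter flat_exp_def)
    moreover have "((\<lambda>h. (flat_exp P (0 + h) - flat_exp P 0) / h) \<longlongrightarrow> 0) (at_left 0)"
      by (rule Lim_transform_eventually[OF tendsto_const])
        (auto simp: eventually_at_filter flat_exp_def)
    ultimately have "((\<lambda>h. (flat_exp P (0 + h) - flat_exp P 0) / h) \<longlongrightarrow> 0) (at 0)"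
      by (rule filterlim_split_at[rotated])
    then show ?thesis using 3 by (simp add: DERIV_def flat_exp_def)
  qed
qed

text \<open>The partial derivatives of the generators lie in the algebra they generate, hence so do the
  partial derivatives of all its members. Thus one derivative suffices to obtain them all.\<close>

inductive_set bumps :: "('a::euclidean_space \<Rightarrow> complex) set" where
  const: "(\<lambda>x. c) \<in> bumps"
| flat: "(\<lambda>x. complex_of_real (flat_exp P (\<alpha> * (x \<bullet> b) + \<beta>))) \<in> bumps"
| add: "f \<in> bumps \<Longrightarrow> g \<in> bumps \<Longrightarrow> (\<lambda>x. f x + g x) \<in> bumps"
| mult: "f \<in> bumps \<Longrightarrow> g \<in> bumps \<Longrightarrow> (\<lambda>x. f x * g x) \<in> bumps"

lemma bumps_derivative:
  assumes "f \<in> bumps"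
  shows "\<exists>D. (\<forall>x. (f has_derivative D x) (at x)) \<and> (\<forall>b. (\<lambda>x. D x b) \<in> bumps)"
  using assms
proof induct
  case (const c)
  show ?case by (rule exI[of _ "\<lambda>x h. 0"]) (auto intro: bumps.const)
next
  case (flat P \<alpha> b \<beta>)
  let ?Q = "[:0, 0, 1:] * (P - pderiv P)"
  let ?D = "\<lambda>x h. complex_of_real (flat_exp ?Q (\<alpha> * (x \<bullet> b) + \<beta>)) * complex_of_real (\<alpha> * (h \<bullet> b))"
  have "((\<lambda>x. complex_of_real (flat_exp P (\<alpha> * (x \<bullet> b) + \<beta>))) has_derivative ?D x) (at x)" for x
  proof -
    have "((\<lambda>x. \<alpha> * (x \<bullet> b) + \<beta>) has_derivative (\<lambda>h. \<alpha> * (h \<bullet> b))) (at x)"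
      by (auto intro!: derivative_eq_intros)
    from has_derivative_compose[OF this has_field_derivative_imp_has_derivative[OF flat_exp_has_derivative]]
    have "((\<lambda>x. flat_exp P (\<alpha> * (x \<bullet> b) + \<beta>)) has_derivative
       (\<lambda>h. flat_exp ?Q (\<alpha> * (x \<bullet> b) + \<beta>) * (\<alpha> * (h \<bullet> b)))) (at x)" .
    from has_derivative_of_real[OF this] show ?thesis by simp
  qed
  moreover have "(\<lambda>x. ?D x h) \<in> bumps" for h
    by (intro bumps.mult bumps.flat bumps.const)
  ultimately show ?case by (intro exI[of _ ?D]) blast
next
  case (add f g)
  then obtain D E where "\<And>x. (f has_derivative D x) (at x)" "\<And>b. (\<lambda>x. D x b) \<in> bumps"
     "\<And>x. (g has_derivative E x) (at x)" "\<And>b. (\<lambda>x. E x b) \<in> bumps" by metis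
  then show ?case
    by (intro exI[of _ "\<lambda>x h. D x h + E x h"]) (auto intro: bumps.add derivative_intros)
next
  case (mult f g)
  then obtain D E where "\<And>x. (f has_derivative D x) (at x)" "\<And>b. (\<lambda>x. D x b) \<in> bumps"
     "\<And>x. (g has_derivative E x) (at x)" "\<And>b. (\<lambda>x. E x b) \<in> bumps" by metis
  with mult(1,3) show ?case
    by (intro exI[of _ "\<lambda>x h. f x * E x h + D x h * g x"] conjI allI bumps.add bumps.mult derivative_intros) auto
qed

lemma bumps_pderivs: "f \<in> bumps \<Longrightarrow> pderivs bs f \<in> bumps"
proof (induct bs)
  case (Cons b bs)
  then obtain D where D: "\<And>x. (pderivs bs f has_derivative D x) (at x)" "\<And>b. (\<lambda>x. D x b) \<in> bumps"
    using bumps_derivative[of "pderivs bs f"] by auto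
  have "pderivs (b # bs) f = (\<lambda>x. D x b)"
    using frechet_derivative_at[OF D(1)] by (simp add: fun_eq_iff)
  with D(2) show ?case by simp
qed simp

lemma bumps_test_function:
  assumes "f \<in> bumps" "{x. f x \<noteq> 0} \<subseteq> S" "compact S"
  shows "test_function f"
  unfolding test_function_def
proof (intro conjI allI impI)
  fix bs x
  show "pderivs bs f differentiable (at x)"
    using bumps_derivative[OF bumps_pderivs[OF assms(1)], of bs] unfolding differentiable_def by blast
next
  show "compact (closure {x. f x \<noteq> 0})"
    using bounded_subset[OF compact_imp_bounded[OF assms(3)] assms(2)] by simp
qed

lemma bumps_prod:
  assumes "\<And>i. i \<in> I \<Longrightarrow> f i \<in> bumps"
  shows "(\<lambda>x. \<Prod>i\<in>I. f i x) \<in> bumps"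
  using assms
  by (induct I rule: infinite_finite_induct) (auto intro: bumps.const bumps.mult)

text \<open>These functions converge boundedly to the indicator of the open box as \<open>n\<close> tends to infinity.\<close>

definition box_bump :: "'a::euclidean_space \<Rightarrow> 'a \<Rightarrow> nat \<Rightarrow> 'a \<Rightarrow> real" where
  "box_bump a b n x = (\<Prod>i\<in>Basis. flat_exp 1 (real (Suc n) * (x \<bullet> i - a \<bullet> i)) *
     flat_exp 1 (real (Suc n) * (b \<bullet> i - x \<bullet> i)))"

lemma flat_exp_1_bounds: "0 \<le> flat_exp 1 s" "flat_exp 1 s \<le> 1"
  by (auto simp: flat_exp_def)

lemma flat_exp_1_limit: "(\<lambda>n. flat_exp 1 (real (Suc n) * s)) \<longlonglongrightarrow> (if s > 0 then 1 else 0)"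
proof (cases "s > 0")
  case True
  have "(\<lambda>n. exp (- (inverse (real (Suc n)) * (1 / s)))) \<longlonglongrightarrow> exp (- (0 * (1 / s)))"
    by (intro tendsto_intros LIMSEQ_inverse_real_of_nat)
  moreover have "exp (- (inverse (real (Suc n)) * (1 / s))) = flat_exp 1 (real (Suc n) * s)" for n
    using True by (simp add: flat_exp_def divide_inverse zero_less_mult_iff)
  ultimately show ?thesis using True by simp
next
  case False
  then have "flat_exp 1 (real (Suc n) * s) = 0" for n
    by (auto simp: flat_exp_def zero_less_mult_iff)
  then show ?thesis using False by simp
qed

lemma box_bump_bounds: "0 \<le> box_bump a b n x" "box_bump a b n x \<le> 1"
  unfolding box_bump_def
  by (auto intro!: prod_nonneg prod_le_1 mult_nonneg_nonneg mult_le_one flat_exp_1_bounds)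

lemma box_bump_zero: "x \<notin> box a b \<Longrightarrow> box_bump a b n x = 0"
  by (auto simp: box_bump_def mem_box flat_exp_def zero_less_mult_iff)

lemma box_bump_limit: "(\<lambda>n. box_bump a b n x) \<longlonglongrightarrow> indicator (box a b) x"
proof -
  have "(\<lambda>n. box_bump a b n x) \<longlonglongrightarrow>
     (\<Prod>i\<in>Basis. (if x \<bullet> i - a \<bullet> i > 0 then 1 else 0) * (if b \<bullet> i - x \<bullet> i > 0 then 1 else 0))"
    unfolding box_bump_def by (intro tendsto_prod tendsto_mult flat_exp_1_limit)
  also have "(\<Prod>i\<in>Basis. (if x \<bullet> i - a \<bullet> i > 0 then 1 else 0) * (if b \<bullet> i - x \<bullet> i > 0 then 1 else (0::real)))
     = indicator (box a b) x"
  proof (cases "x \<in> box a b")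
    case True
    then show ?thesis by (simp add: mem_box)
  next
    case False
    then obtain i where "i \<in> Basis" "\<not> (x \<bullet> i - a \<bullet> i > 0) \<or> \<not> (b \<bullet> i - x \<bullet> i > 0)"
      by (auto simp: mem_box)
    then have "(\<Prod>i\<in>Basis. (if x \<bullet> i - a \<bullet> i > 0 then 1 else 0) * (if b \<bullet> i - x \<bullet> i > 0 then 1 else (0::real))) = 0"
      by (intro prod_zero bexI[of _ i]) auto
    then show ?thesis using False by simp
  qed
  finally show ?thesis .
qed

lemma box_bump_test_function: "test_function (\<lambda>x. complex_of_real (box_bump a b n x))"
proof (rule bumps_test_function[where S = "cbox a b"])
  have "(\<lambda>x. complex_of_real (flat_exp 1 (real (Suc n) * (x \<bullet> i) + (- real (Suc n) * (a \<bullet> i)))) *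
      complex_of_real (flat_exp 1 (- real (Suc n) * (x \<bullet> i) + real (Suc n) * (b \<bullet> i)))) \<in> bumps" for i
    by (intro bumps.mult bumps.flat)
  then have "(\<lambda>x. \<Prod>i\<in>Basis. complex_of_real (flat_exp 1 (real (Suc n) * (x \<bullet> i) + (- real (Suc n) * (a \<bullet> i)))) *
      complex_of_real (flat_exp 1 (- real (Suc n) * (x \<bullet> i) + real (Suc n) * (b \<bullet> i)))) \<in> bumps"
    by (rule bumps_prod)
  moreover have "complex_of_real (box_bump a b n x) =
      (\<Prod>i\<in>Basis. complex_of_real (flat_exp 1 (real (Suc n) * (x \<bullet> i) + (- real (Suc n) * (a \<bullet> i)))) *
      complex_of_real (flat_exp 1 (- real (Suc n) * (x \<bullet> i) + real (Suc n) * (b \<bullet> i))))" for x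
    unfolding box_bump_def of_real_prod of_real_mult
    by (intro prod.cong refl arg_cong2[where f = "(*)"] arg_cong[where f = "\<lambda>s. complex_of_real (flat_exp 1 s)"])
      (simp_all add: algebra_simps)
  ultimately show "(\<lambda>x. complex_of_real (box_bump a b n x)) \<in> bumps" by simp
  show "{x. complex_of_real (box_bump a b n x) \<noteq> 0} \<subseteq> cbox a b"
    using box_bump_zero box_subset_cbox by force
qed simp

lemma AE_zero_if_box_integrals_zero:
  fixes f :: "'a::euclidean_space \<Rightarrow> complex"
  assumes f: "integrable lborel f" and box0: "\<And>a b. (LINT x:box a b|lborel. f x) = 0"
    and tot: "(LINT x|lborel. f x) = 0"
  shows "AE x in lborel. f x = 0"
proof (rule sigma_finite_measure.density_zero[OF sigma_finite_lborel f])
  have si: "set_integrable lborel A f" if "A \<in> sets borel" for A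
    using that f by (simp add: set_integrable_def integrable_mult_indicator)
  fix A :: "'a set" assume "A \<in> sets lborel"
  then have A: "A \<in> sigma_sets UNIV (range (\<lambda>(a, b). box a b))"
    by (simp add: borel_eq_box)
  have sig: "sigma_sets UNIV (range (\<lambda>(a, b). box a b)) = sets (borel :: 'a measure)"
    by (simp add: borel_eq_box)
  have stable: "Int_stable (range (\<lambda>(a, b). box a b :: 'a set))"
    by (auto simp: Int_stable_def box_Int_box)
  have "range (\<lambda>(a, b). box a b :: 'a set) \<subseteq> Pow UNIV" by simp
  from stable this A have "set_lebesgue_integral lborel A f = 0"
  proof (induct rule: sigma_sets_induct_disjoint)
    case (compl A)
    then have "A \<in> sets borel" by (simp add: sig)
    then have "set_lebesgue_integral lborel (A \<union> (UNIV - A)) f =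
        set_lebesgue_integral lborel A f + set_lebesgue_integral lborel (UNIV - A) f"
      by (intro set_integral_Un si) auto
    then show ?case using compl tot by (simp add: set_lebesgue_integral_def)
  next
    case (union A)
    have "set_lebesgue_integral lborel (\<Union>i. A i) f = (\<Sum>i. set_lebesgue_integral lborel (A i) f)"
      using union by (intro lebesgue_integral_countable_add si) (auto simp: sig disjoint_family_on_def)
    then show ?case using union by simp
  qed (use box0 in \<open>auto simp: set_lebesgue_integral_def\<close>)
  then show "set_lebesgue_integral lborel A f = 0" .
qed

text \<open>Testing with bump functions shows that \<open>w\<close> has integral zero over every box, and boxes form an
  intersection-stable generator of the Borel sets.\<close>

theorem fundamental_lemma:
  fixes w :: "'a::euclidean_space \<Rightarrow> complex"
  assumes [measurable]: "w \<in> borel_measurable borel"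
    and loc: "\<And>a b. integrable lborel (\<lambda>x. indicat_real (box a b) x *\<^sub>R w x)"
    and zero: "\<And>\<phi>. test_function \<phi> \<Longrightarrow> (LINT x|lborel. w x * \<phi> x) = 0"
  shows "AE x in lborel. w x = 0"
proof -
  have box0: "(LINT x|lborel. indicat_real (box a b) x *\<^sub>R w x) = 0" for a b
  proof -
    have "(\<lambda>n. LINT x|lborel. w x * complex_of_real (box_bump a b n x)) \<longlonglongrightarrow>
        (LINT x|lborel. indicat_real (box a b) x *\<^sub>R w x)"
    proof (rule integral_dominated_convergence[where w = "\<lambda>x. cmod (indicat_real (box a b) x *\<^sub>R w x)"])
      show "integrable lborel (\<lambda>x. cmod (indicat_real (box a b) x *\<^sub>R w x))"
        using loc by (rule integrable_norm)
      have m: "(\<lambda>x. complex_of_real (box_bump a b n x)) \<in> borel_measurable borel" for n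
        by (rule sqint_measurable[OF test_function_sqint[OF box_bump_test_function]])
      then show "(\<lambda>x. w x * complex_of_real (box_bump a b n x)) \<in> borel_measurable lborel" for n
        by simp
      show "AE x in lborel. (\<lambda>n. w x * complex_of_real (box_bump a b n x)) \<longlonglongrightarrow> indicat_real (box a b) x *\<^sub>R w x"
      proof (rule AE_I2)
        fix x
        have "(\<lambda>n. w x * complex_of_real (box_bump a b n x)) \<longlonglongrightarrow> w x * complex_of_real (indicat_real (box a b) x)"
          by (intro tendsto_intros box_bump_limit)
        then show "(\<lambda>n. w x * complex_of_real (box_bump a b n x)) \<longlonglongrightarrow> indicat_real (box a b) x *\<^sub>R w x"
          by (simp add: scaleR_conv_of_real mult.commute)
      qed
      show "AE x in lborel. cmod (w x * complex_of_real (box_bump a b n x)) \<le> cmod (indicat_real (box a b) x *\<^sub>R w x)" for n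
        using box_bump_bounds[of a b n] box_bump_zero[of _ a b n]
        by (intro AE_I2) (auto simp: indicator_def norm_mult mult_left_le)
    qed simp
    moreover have "(LINT x|lborel. w x * complex_of_real (box_bump a b n x)) = 0" for n
      by (rule zero[OF box_bump_test_function])
    ultimately show ?thesis by (simp add: LIMSEQ_const_iff)
  qed
  have cut: "AE x in lborel. indicat_real (box a b) x *\<^sub>R w x = 0" for a b
  proof (rule AE_zero_if_box_integrals_zero[OF loc _ box0])
    fix c d :: 'a
    obtain e f :: 'a where ef: "box a b \<inter> box c d = box e f" by (rule that) (rule box_Int_box)
    have "indicat_real (box c d) x *\<^sub>R indicat_real (box a b) x *\<^sub>R w x = indicat_real (box e f) x *\<^sub>R w x" for x
      by (simp add: indicator_inter_arith mult.commute flip: ef)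
    then show "(LINT x:box c d|lborel. indicat_real (box a b) x *\<^sub>R w x) = 0"
      unfolding set_lebesgue_integral_def by (simp only: box0)
  qed
  have "AE x in lborel. \<forall>n. indicat_real (box (- (real n *\<^sub>R One)) (real n *\<^sub>R One)) x *\<^sub>R w x = 0"
    unfolding AE_all_countable using cut by blast
  then show ?thesis
  proof eventually_elim
    case (elim x)
    have "x \<in> (\<Union>n. box (- (real n *\<^sub>R One)) (real n *\<^sub>R One))"
      by (simp only: UN_box_eq_UNIV UNIV_I)
    then obtain n where "x \<in> box (- (real n *\<^sub>R One)) (real n *\<^sub>R One)" by blast
    then show ?case using elim[rule_format, of n] by simp
  qed
qed

section \<open>Density of test functions\<close>

definition test_classes :: "'a::euclidean_space l2 set" where
  "test_classes = {cls \<phi> | \<phi>. test_function \<phi>}"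

lemma test_function_zero: "test_function (\<lambda>x. 0)"
  by (rule bumps_test_function[where S = "{}"]) (auto intro: bumps.const)

lemma subspace_test_classes: "subspace test_classes"
proof (rule subspaceI)
  show "0 \<in> test_classes"
    unfolding test_classes_def using test_function_zero cls_zero by force
  show "u + v \<in> test_classes" if uv: "u \<in> test_classes" "v \<in> test_classes" for u v :: "'a l2"
  proof -
    obtain \<phi> \<psi> where "u = cls \<phi>" "test_function \<phi>" "v = cls \<psi>" "test_function \<psi>"
      using uv unfolding test_classes_def by blast
    then show ?thesis unfolding test_classes_def
      using cls_add[OF test_function_sqint test_function_sqint, of \<phi> \<psi>] test_function_add[of \<phi> \<psi>] by force
  qed
  show "r *\<^sub>R u \<in> test_classes" if u: "u \<in> test_classes" for r and u :: "'a l2"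
  proof -
    obtain \<phi> where "u = cls \<phi>" "test_function \<phi>" using u unfolding test_classes_def by blast
    then show ?thesis unfolding test_classes_def
      using cls_scaleR[OF test_function_sqint, of \<phi> r]
        test_function_bounded_linear[OF bounded_linear_scaleR_right, of \<phi> r] by force
  qed
qed

text \<open>Weak derivatives are defined by the bilinear pairing without conjugation; its real and imaginary
  parts are real inner products with the conjugates of \<open>g\<close> and of \<open>\<i> * g\<close>.\<close>

lemma inner_cls_cnj:
  assumes "f \<in> sqint" "g \<in> sqint"
  shows "inner (cls f) (cls (\<lambda>x. cnj (g x))) = Re (LINT x|lborel. f x * g x)"
    "inner (cls f) (cls (\<lambda>x. cnj (\<i> * g x))) = - Im (LINT x|lborel. f x * g x)"
proof -
  note int = sqint_integrable_complex_mult[OF assms]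
  have "inner (cls f) (cls (\<lambda>x. cnj (g x))) = (LINT x|lborel. Re (f x * g x))"
    unfolding inner_cls[OF assms(1) sqint_cnj[OF assms(2)]] by (simp add: inner_complex_def)
  then show "inner (cls f) (cls (\<lambda>x. cnj (g x))) = Re (LINT x|lborel. f x * g x)"
    using integral_bounded_linear[OF bounded_linear_Re int] by simp
  have "f x \<bullet> cnj (\<i> * g x) = - Im (f x * g x)" for x
    by (simp add: inner_complex_def)
  then have "inner (cls f) (cls (\<lambda>x. cnj (\<i> * g x))) = (LINT x|lborel. - Im (f x * g x))"
    unfolding inner_cls[OF assms(1) sqint_cnj[OF sqint_mult_i[OF assms(2)]]] by (simp only:)
  also have "\<dots> = - (LINT x|lborel. Im (f x * g x))" by (rule integral_minus)
  finally show "inner (cls f) (cls (\<lambda>x. cnj (\<i> * g x))) = - Im (LINT x|lborel. f x * g x)"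
    using integral_bounded_linear[OF bounded_linear_Im int] by simp
qed

lemma test_function_cnj: "test_function \<phi> \<Longrightarrow> test_function (\<lambda>x. cnj (\<phi> x))"
  by (rule test_function_bounded_linear[OF bounded_linear_cnj])

lemma test_function_mult_i: "test_function \<phi> \<Longrightarrow> test_function (\<lambda>x. \<i> * \<phi> x)"
  by (rule test_function_bounded_linear[OF bounded_linear_mult_right])

lemma sqint_box_integrable:
  assumes "f \<in> sqint" shows "integrable lborel (\<lambda>x. indicat_real (box a b) x *\<^sub>R f x)"
proof -
  have "(\<lambda>x. complex_of_real (indicat_real (box a b) x)) \<in> sqint"
    by (rule bounded_compact_support_sqint[of _ "cbox a b" 1])
      (use box_subset_cbox in \<open>auto simp: indicator_def\<close>)
  from sqint_integrable_complex_mult[OF this assms] show ?thesis by (simp add: scaleR_conv_of_real)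
qed

lemma test_classes_orthogonal:
  assumes "\<And>\<phi>. test_function \<phi> \<Longrightarrow> inner w (cls \<phi>) = 0"
  shows "w = 0"
proof -
  have "AE x in lborel. rep w x = 0"
  proof (rule fundamental_lemma)
    show "integrable lborel (\<lambda>x. indicat_real (box a b) x *\<^sub>R rep w x)" for a b
      by (rule sqint_box_integrable) simp
    fix \<phi> :: "'a \<Rightarrow> complex" assume \<phi>: "test_function \<phi>"
    note eqs = inner_cls_cnj[OF rep_sqint test_function_sqint[OF \<phi>], of w, unfolded cls_rep]
    show "(LINT x|lborel. rep w x * \<phi> x) = 0"
      using eqs assms[OF test_function_cnj[OF \<phi>]] assms[OF test_function_cnj[OF test_function_mult_i[OF \<phi>]]]
      by (simp add: complex_eq_iff)
  qed simp
  then have "cls (rep w) = cls (\<lambda>x. 0)" by (subst cls_eq_iff) (auto simp: sqint_zero)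
  then show ?thesis by (simp add: cls_zero)
qed

lemma test_classes_dense: "closure test_classes = (UNIV :: 'a::euclidean_space l2 set)"
proof (rule subspace_dense_if_trivial_orthogonal[OF subspace_test_classes])
  show "w = 0" if "\<And>s. s \<in> test_classes \<Longrightarrow> inner w s = 0" for w :: "'a l2"
    by (rule test_classes_orthogonal) (use that in \<open>auto simp: test_classes_def\<close>)
qed

lemma norm_le_by_duality:
  assumes "0 \<le> C" "\<And>\<phi>. test_function \<phi> \<Longrightarrow> inner w (cls \<phi>) \<le> C * norm (cls \<phi>)"
  shows "norm w \<le> C"
proof -
  have "closed {v. inner w v \<le> C * norm v}"
    by (intro closed_Collect_le continuous_intros)
  moreover have "test_classes \<subseteq> {v. inner w v \<le> C * norm v}"
    using assms(2) by (auto simp: test_classes_def)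
  ultimately have "closure test_classes \<subseteq> {v. inner w v \<le> C * norm v}" by (rule closure_minimal[rotated])
  then have "inner w w \<le> C * norm w" using test_classes_dense by blast
  then have "norm w * norm w \<le> C * norm w" by (simp add: power2_norm_eq_inner[symmetric] power2_eq_square)
  then show ?thesis using assms(1) by (cases "norm w = 0") auto
qed

section \<open>Weak derivatives of square integrable classes\<close>

definition wders :: "'a::euclidean_space list \<Rightarrow> 'a l2 \<Rightarrow> 'a l2 \<Rightarrow> bool" where
  "wders bs u g \<longleftrightarrow> (\<forall>\<phi>. test_function \<phi> \<longrightarrow>
     inner u (cls (pderivs bs \<phi>)) = (-1) ^ length bs * inner g (cls \<phi>))"

lemma wdersD: "wders bs u g \<Longrightarrow> test_function \<phi> \<Longrightarrow>
    inner u (cls (pderivs bs \<phi>)) = (-1) ^ length bs * inner g (cls \<phi>)"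
  by (simp add: wders_def)

lemma wders_unique:
  assumes "wders bs u g" "wders bs u g'" shows "g = g'"
proof -
  have "g - g' = 0"
  proof (rule test_classes_orthogonal)
    fix \<phi> :: "'a \<Rightarrow> complex" assume "test_function \<phi>"
    from wdersD[OF assms(1) this] wdersD[OF assms(2) this]
    have "(-1) ^ length bs * inner g (cls \<phi>) = (-1) ^ length bs * inner g' (cls \<phi>)" by simp
    then show "inner (g - g') (cls \<phi>) = 0" by (simp add: inner_diff_left)
  qed
  then show ?thesis by simp
qed

lemma wders_Nil: "wders [] u u"
  by (simp add: wders_def)

lemma wders_diff: "wders bs u g \<Longrightarrow> wders bs v h \<Longrightarrow> wders bs (u - v) (g - h)"
  by (simp add: wders_def inner_diff_left right_diff_distrib)

lemma wders_scaleR: "wders bs u g \<Longrightarrow> wders bs (r *\<^sub>R u) (r *\<^sub>R g)"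
  by (simp add: wders_def)

lemma wders_shift:
  assumes "wders bs u g" "set bs \<subseteq> Basis" shows "wders bs (shift y u) (shift y g)"
  unfolding wders_def
proof (intro allI impI)
  fix \<phi> :: "'a \<Rightarrow> complex" assume \<phi>: "test_function \<phi>"
  note \<phi>' = test_function_translate[OF \<phi>, of "-y"]
  have "inner (shift y u) (cls (pderivs bs \<phi>)) = inner u (cls (pderivs bs (\<lambda>x. \<phi> (x + (- y)))))"
    unfolding inner_shift_left pderivs_translate
    by (simp only: shift_cls[OF test_function_sqint[OF test_function_pderivs[OF \<phi> assms(2)]]])
  also have "\<dots> = (-1) ^ length bs * inner g (cls (\<lambda>x. \<phi> (x + (- y))))"
    by (rule wdersD[OF assms(1) \<phi>'])
  also have "\<dots> = (-1) ^ length bs * inner (shift y g) (cls \<phi>)"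
    by (simp only: inner_shift_left shift_cls[OF test_function_sqint[OF \<phi>]])
  finally show "inner (shift y u) (cls (pderivs bs \<phi>)) = (-1) ^ length bs * inner (shift y g) (cls \<phi>)" .
qed

text \<open>In \<^term>\<open>pderivs [a, b]\<close> the derivative in direction \<open>b\<close> is taken first, so that in the weak
  derivative along \<^term>\<open>[a, b]\<close> it comes last.\<close>

lemma wders_second:
  assumes "wders [a] u ua" "wders [a, b] u g" "b \<in> Basis"
  shows "wders [b] ua g"
  unfolding wders_def
proof (intro allI impI)
  fix \<phi> :: "'a \<Rightarrow> complex" assume \<phi>: "test_function \<phi>"
  have "test_function (pderivs [b] \<phi>)" by (rule test_function_pderivs[OF \<phi>]) (use assms(3) in simp)
  from wdersD[OF assms(1) this] wdersD[OF assms(2) \<phi>]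
  show "inner ua (cls (pderivs [b] \<phi>)) = (- 1) ^ length [b] * inner g (cls \<phi>)" by simp
qed

lemma wders_weak_limit:
  assumes "\<And>n. wders bs (u n) (g n)"
    and "\<And>\<psi>. (\<lambda>n. inner (u n) \<psi>) \<longlonglongrightarrow> inner w \<psi>" "\<And>\<psi>. (\<lambda>n. inner (g n) \<psi>) \<longlonglongrightarrow> inner h \<psi>"
  shows "wders bs w h"
  unfolding wders_def
proof (intro allI impI)
  fix \<phi> :: "'a \<Rightarrow> complex" assume \<phi>: "test_function \<phi>"
  have "(\<lambda>n. (-1) ^ length bs * inner (g n) (cls \<phi>)) \<longlonglongrightarrow> (-1) ^ length bs * inner h (cls \<phi>)"
    by (intro tendsto_mult_left assms(3))
  moreover have "(\<lambda>n. inner (u n) (cls (pderivs bs \<phi>))) = (\<lambda>n. (-1) ^ length bs * inner (g n) (cls \<phi>))"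
    using wdersD[OF assms(1) \<phi>] by simp
  ultimately show "inner w (cls (pderivs bs \<phi>)) = (-1) ^ length bs * inner h (cls \<phi>)"
    using assms(2)[of "cls (pderivs bs \<phi>)"] LIMSEQ_unique by metis
qed

lemma norm_cls_le_bound:
  assumes "f \<in> borel_measurable borel" "compact S" "\<And>x. x \<notin> S \<Longrightarrow> f x = 0"
    and "\<And>x. cmod (f x) \<le> B"
  shows "norm (cls f) \<le> B * sqrt (measure lborel S)"
proof (rule power2_le_imp_le)
  have B: "0 \<le> B" using assms(4)[of 0] norm_ge_zero order_trans by blast
  have S: "S \<in> sets lborel" "emeasure lborel S < \<infinity>"
    using emeasure_compact_finite[OF assms(2)] borel_closed[OF compact_imp_closed[OF assms(2)]] by auto
  have f: "f \<in> sqint" by (rule bounded_compact_support_sqint[OF assms])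
  have "(norm (cls f))\<^sup>2 = (LINT x|lborel. (cmod (f x))\<^sup>2)" by (rule norm_cls_sq[OF f])
  also have "\<dots> \<le> (LINT x|lborel. B\<^sup>2 * indicat_real S x)"
  proof (rule integral_mono)
    show "integrable lborel (\<lambda>x. B\<^sup>2 * indicat_real S x)" using S by simp
    show "(cmod (f x))\<^sup>2 \<le> B\<^sup>2 * indicat_real S x" for x
      using assms(3,4)[of x] by (auto simp: indicator_def intro: power_mono)
  qed (rule sqint_integrable[OF f])
  also have "\<dots> = (B * sqrt (measure lborel S))\<^sup>2" by (simp add: power_mult_distrib)
  finally show "(norm (cls f))\<^sup>2 \<le> (B * sqrt (measure lborel S))\<^sup>2" .
  show "0 \<le> B * sqrt (measure lborel S)" using B by simp
qed

lemma vector_derivative_bound: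
  fixes f :: "real \<Rightarrow> complex"
  assumes "\<And>s. \<bar>s\<bar> \<le> r \<Longrightarrow> (f has_vector_derivative f' s) (at s)" "\<And>s. \<bar>s\<bar> \<le> r \<Longrightarrow> cmod (f' s) \<le> B" "\<bar>h\<bar> \<le> r"
  shows "cmod (f h - f 0) \<le> B * \<bar>h\<bar>"
proof -
  have "norm (f h - f 0) \<le> B * norm (h - 0)"
  proof (rule differentiable_bound[where S = "{-r..r}" and f' = "\<lambda>s t. t *\<^sub>R f' s"])
    show "(f has_derivative (\<lambda>t. t *\<^sub>R f' s)) (at s within {-r..r})" if "s \<in> {-r..r}" for s
      using assms(1)[of s] that by (auto simp: has_vector_derivative_def intro: has_derivative_at_withinI)
    show "onorm (\<lambda>t. t *\<^sub>R f' s) \<le> B" if "s \<in> {-r..r}" for s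
    proof (rule onorm_bound)
      have f: "cmod (f' s) \<le> B" using assms(2)[of s] that by auto
      then show "0 \<le> B" using norm_ge_zero order_trans by blast
      show "norm (t *\<^sub>R f' s) \<le> B * norm t" for t
        using mult_left_mono[OF f, of "\<bar>t\<bar>"] by (simp add: mult.commute)
    qed
  qed (use assms(3) in auto)
  then show ?thesis by simp
qed

lemma test_function_line_derivative:
  assumes "test_function \<phi>"
  shows "((\<lambda>s. \<phi> (x + s *\<^sub>R b)) has_vector_derivative pderivs [b] \<phi> (x + s *\<^sub>R b)) (at s)"
proof -
  have "((\<lambda>s. x + s *\<^sub>R b) has_derivative (\<lambda>t. t *\<^sub>R b)) (at s)"
    by (auto intro!: derivative_eq_intros)
  from has_derivative_compose[OF this test_function_has_derivative[OF assms]]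
  have "((\<lambda>s. \<phi> (x + s *\<^sub>R b)) has_derivative (\<lambda>t. frechet_derivative \<phi> (at (x + s *\<^sub>R b)) (t *\<^sub>R b))) (at s)" .
  moreover have "frechet_derivative \<phi> (at (x + s *\<^sub>R b)) (t *\<^sub>R b) = t *\<^sub>R pderivs [b] \<phi> (x + s *\<^sub>R b)" for t
    using linear_frechet_derivative[OF test_function_differentiable[OF assms, of "[]"]]
    by (simp add: linear_scale)
  ultimately show ?thesis by (simp add: has_vector_derivative_def)
qed

text \<open>The Taylor remainder is at most \<open>h\<^sup>2\<close> times a bound of the second derivative, and for \<open>\<bar>h\<bar> \<le> 1\<close> it
  vanishes outside one compact set.\<close>

lemma shift_test_taylor:
  assumes \<phi>: "test_function \<phi>" and b: "b \<in> Basis"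
  obtains C where "\<And>h. \<bar>h\<bar> \<le> 1 \<Longrightarrow>
    norm (shift (h *\<^sub>R b) (cls \<phi>) - cls \<phi> - h *\<^sub>R cls (pderivs [b] \<phi>)) \<le> C * h\<^sup>2"
proof -
  have \<phi>1: "test_function (pderivs [b] \<phi>)" and \<phi>2: "test_function (pderivs [b, b] \<phi>)"
    by (rule test_function_pderivs[OF \<phi>], use b in simp)+
  obtain B where B: "\<And>x. cmod (pderivs [b, b] \<phi> x) \<le> B" using test_function_bounded[OF \<phi>2] by metis
  define S0 where "S0 = closure {x. \<phi> x \<noteq> 0}"
  have S0: "compact S0" using \<phi> by (simp add: S0_def test_function_def)
  define S where "S = (\<lambda>(x, t). x + t *\<^sub>R b) ` (S0 \<times> {-1..1})"
  have S: "compact S" unfolding S_def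
    by (intro compact_continuous_image compact_Times S0 compact_Icc)
      (auto simp: case_prod_unfold intro!: continuous_intros)
  have out: "x + t *\<^sub>R b \<notin> S0" if "x \<notin> S" "\<bar>t\<bar> \<le> 1" for x t
  proof
    assume "x + t *\<^sub>R b \<in> S0"
    then have "(x + t *\<^sub>R b) + (- t) *\<^sub>R b \<in> S" unfolding S_def
      by (intro image_eqI[of _ _ "(x + t *\<^sub>R b, - t)"]) (use that(2) in auto)
    then show False using that(1) by simp
  qed
  have "norm (shift (h *\<^sub>R b) (cls \<phi>) - cls \<phi> - h *\<^sub>R cls (pderivs [b] \<phi>)) \<le> (B * sqrt (measure lborel S)) * h\<^sup>2"
    if h: "\<bar>h\<bar> \<le> 1" for h
  proof -
    let ?r = "\<lambda>x. \<phi> (x + h *\<^sub>R b) - \<phi> x - h *\<^sub>R pderivs [b] \<phi> x"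
    note sq = test_function_sqint[OF \<phi>] sqint_translate[OF test_function_sqint[OF \<phi>], of "h *\<^sub>R b"]
      test_function_sqint[OF \<phi>1]
    have r: "?r \<in> sqint" by (intro sqint_diff sqint_scaleR sq)
    have "cls ?r = shift (h *\<^sub>R b) (cls \<phi>) - cls \<phi> - h *\<^sub>R cls (pderivs [b] \<phi>)"
      unfolding cls_diff[OF sqint_diff[OF sq(2,1)] sqint_scaleR[OF sq(3)]] cls_diff[OF sq(2,1)]
        cls_scaleR[OF sq(3)] shift_cls[OF sq(1)] ..
    moreover have "norm (cls ?r) \<le> (B * \<bar>h\<bar> * \<bar>h\<bar>) * sqrt (measure lborel S)"
    proof (rule norm_cls_le_bound[OF sqint_measurable[OF r] S])
      fix x
      show "?r x = 0" if "x \<notin> S"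
      proof -
        have o: "y \<notin> S0 \<Longrightarrow> pderivs bs \<phi> y = 0" for bs y
          unfolding S0_def by (rule pderivs_zero_outside_support)
        have "x \<notin> S0" using out[OF that, of 0] by simp
        then show ?thesis using o[of "x + h *\<^sub>R b" "[]"] o[of x "[]"] o[of x "[b]"] out[OF that h] by simp
      qed
      have d1: "cmod (pderivs [b] \<phi> (x + s *\<^sub>R b) - pderivs [b] \<phi> x) \<le> B * \<bar>s\<bar>" for s
        using vector_derivative_bound[where f = "\<lambda>s. pderivs [b] \<phi> (x + s *\<^sub>R b)" and B = B and r = "\<bar>s\<bar>" and h = s,
            OF test_function_line_derivative[OF \<phi>1]] B
        by (simp add: pderivs_append[of "[b]" "[b]", simplified])
      have "cmod ((\<phi> (x + h *\<^sub>R b) - h *\<^sub>R pderivs [b] \<phi> x) - (\<phi> (x + 0 *\<^sub>R b) - 0 *\<^sub>R pderivs [b] \<phi> x))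
         \<le> (B * \<bar>h\<bar>) * \<bar>h\<bar>"
      proof (rule vector_derivative_bound[where r = "\<bar>h\<bar>"
            and f' = "\<lambda>s. pderivs [b] \<phi> (x + s *\<^sub>R b) - pderivs [b] \<phi> x"])
        show "((\<lambda>s. \<phi> (x + s *\<^sub>R b) - s *\<^sub>R pderivs [b] \<phi> x) has_vector_derivative
            pderivs [b] \<phi> (x + s *\<^sub>R b) - pderivs [b] \<phi> x) (at s)" for s
          by (intro has_vector_derivative_diff test_function_line_derivative[OF \<phi>])
            (auto intro!: derivative_eq_intros simp: has_vector_derivative_def)
        have "0 \<le> B" using B[of 0] norm_ge_zero order_trans by blast
        then show "cmod (pderivs [b] \<phi> (x + s *\<^sub>R b) - pderivs [b] \<phi> x) \<le> B * \<bar>h\<bar>" if "\<bar>s\<bar> \<le> \<bar>h\<bar>" for s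
          using d1[of s] mult_left_mono[OF that, of B] by linarith
      qed simp
      then show "cmod (?r x) \<le> B * \<bar>h\<bar> * \<bar>h\<bar>" by (simp add: algebra_simps)
    qed
    moreover have "(B * \<bar>h\<bar> * \<bar>h\<bar>) * sqrt (measure lborel S) = (B * sqrt (measure lborel S)) * h\<^sup>2"
      by (simp add: power2_eq_square)
    ultimately show ?thesis by (simp only:)
  qed
  then show thesis by (rule that)
qed

lemma shift_test_has_derivative_0:
  assumes "test_function \<phi>" "b \<in> Basis"
  shows "((\<lambda>s. inner u (shift (s *\<^sub>R b) (cls \<phi>))) has_real_derivative inner u (cls (pderivs [b] \<phi>))) (at 0)"
proof -
  obtain C where C: "\<And>h. \<bar>h\<bar> \<le> 1 \<Longrightarrow>
    norm (shift (h *\<^sub>R b) (cls \<phi>) - cls \<phi> - h *\<^sub>R cls (pderivs [b] \<phi>)) \<le> C * h\<^sup>2"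
    by (rule shift_test_taylor[OF assms]) (rule that)
  let ?q = "\<lambda>h. (inner u (shift ((0 + h) *\<^sub>R b) (cls \<phi>)) - inner u (shift (0 *\<^sub>R b) (cls \<phi>))) / h"
  have "((\<lambda>h. ?q h - inner u (cls (pderivs [b] \<phi>))) \<longlongrightarrow> 0) (at 0)"
  proof (rule tendsto_rabs_zero_cancel, rule tendsto_sandwich[of "\<lambda>_. 0" _ _ "\<lambda>h. norm u * C * \<bar>h\<bar>"])
    show "((\<lambda>h. norm u * C * \<bar>h\<bar>) \<longlongrightarrow> 0) (at 0)" by (auto intro!: tendsto_eq_intros)
    have "\<bar>?q h - inner u (cls (pderivs [b] \<phi>))\<bar> \<le> norm u * C * \<bar>h\<bar>" if "h \<noteq> 0" "\<bar>h\<bar> < 1" for h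
    proof -
      have "?q h - inner u (cls (pderivs [b] \<phi>)) =
          inner u (shift (h *\<^sub>R b) (cls \<phi>) - cls \<phi> - h *\<^sub>R cls (pderivs [b] \<phi>)) / h"
        using that(1) by (simp add: inner_diff_right diff_divide_distrib)
      also have "\<bar>\<dots>\<bar> \<le> norm u * (C * h\<^sup>2) / \<bar>h\<bar>"
        unfolding abs_divide using Cauchy_Schwarz_ineq2 C[of h] that(2)
        by (intro divide_right_mono order_trans[OF Cauchy_Schwarz_ineq2] mult_left_mono) auto
      also have "\<dots> = norm u * C * \<bar>h\<bar>"
        using that(1) by (simp add: power2_eq_square abs_if)
      finally show ?thesis .
    qed
    then show "\<forall>\<^sub>F h in at 0. \<bar>?q h - inner u (cls (pderivs [b] \<phi>))\<bar> \<le> norm u * C * \<bar>h\<bar>"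
      unfolding eventually_at by (intro exI[of _ 1]) (auto simp: dist_real_def)
  qed simp_all
  then show ?thesis unfolding DERIV_def by (simp add: LIM_zero_iff)
qed

text \<open>Tested against a smooth function, a translated class is differentiable in the translation
  parameter: the translation can be moved to the test function.\<close>

lemma shift_weak_has_derivative:
  assumes "wders [b] u g" "b \<in> Basis" "test_function \<phi>"
  shows "((\<lambda>s. inner (shift (s *\<^sub>R b) u) (cls \<phi>)) has_real_derivative inner (shift (s *\<^sub>R b) g) (cls \<phi>)) (at s)"
proof -
  let ?\<psi> = "\<lambda>x. \<phi> (x + (- (s *\<^sub>R b)))"
  have \<psi>: "test_function ?\<psi>" by (rule test_function_translate[OF assms(3)])
  have cl: "cls ?\<psi> = shift (- (s *\<^sub>R b)) (cls \<phi>)"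
    by (rule shift_cls[OF test_function_sqint[OF assms(3)], symmetric])
  have "((\<lambda>t. inner u (shift (t *\<^sub>R b) (cls ?\<psi>))) has_real_derivative inner u (cls (pderivs [b] ?\<psi>))) (at (s - s))"
    using shift_test_has_derivative_0[OF \<psi> assms(2), of u] by simp
  moreover have "((\<lambda>t. s - t) has_real_derivative -1) (at s)"
    by (auto intro!: derivative_eq_intros)
  ultimately have "((\<lambda>t. inner u (shift ((s - t) *\<^sub>R b) (cls ?\<psi>))) has_real_derivative
      inner u (cls (pderivs [b] ?\<psi>)) * -1) (at s)"
    by (rule DERIV_chain2)
  moreover have "inner u (shift ((s - t) *\<^sub>R b) (cls ?\<psi>)) = inner (shift (t *\<^sub>R b) u) (cls \<phi>)" for t
    unfolding cl shift_shift inner_shift_left by (simp add: algebra_simps)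
  moreover have "inner u (cls (pderivs [b] ?\<psi>)) * -1 = inner (shift (s *\<^sub>R b) g) (cls \<phi>)"
    using wdersD[OF assms(1) \<psi>] unfolding cl inner_shift_left by simp
  ultimately show ?thesis by (simp only:)
qed

lemma shift_weak_mean_value:
  assumes "wders [b] u g" "b \<in> Basis" "test_function \<phi>"
  obtains t where "\<bar>t\<bar> \<le> \<bar>h\<bar>" "inner (shift (h *\<^sub>R b) u - u) (cls \<phi>) = h * inner (shift (t *\<^sub>R b) g) (cls \<phi>)"
proof -
  note d = shift_weak_has_derivative[OF assms]
  consider "h = 0" | "h > 0" | "h < 0" by linarith
  then show thesis
  proof cases
    case 1
    then show thesis using that[of 0] by simp
  next
    case 2
    from MVT2[OF 2 d] obtain z where "0 < z" "z < h"
      "inner (shift (h *\<^sub>R b) u) (cls \<phi>) - inner (shift (0 *\<^sub>R b) u) (cls \<phi>) = (h - 0) * inner (shift (z *\<^sub>R b) g) (cls \<phi>)"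
      by blast
    then show thesis using that[of z] by (simp add: inner_diff_left)
  next
    case 3
    from MVT2[OF 3 d] obtain z where "h < z" "z < 0"
      "inner (shift (0 *\<^sub>R b) u) (cls \<phi>) - inner (shift (h *\<^sub>R b) u) (cls \<phi>) = (0 - h) * inner (shift (z *\<^sub>R b) g) (cls \<phi>)"
      by blast
    then show thesis using that[of z] by (simp add: inner_diff_left)
  qed
qed

lemma norm_shift_diff_le:
  assumes "wders [b] u g" "b \<in> Basis"
  shows "norm (shift (h *\<^sub>R b) u - u) \<le> \<bar>h\<bar> * norm g"
proof (rule norm_le_by_duality)
  show "0 \<le> \<bar>h\<bar> * norm g" by simp
  fix \<phi> :: "'a \<Rightarrow> complex" assume \<phi>: "test_function \<phi>"
  obtain t where "inner (shift (h *\<^sub>R b) u - u) (cls \<phi>) = h * inner (shift (t *\<^sub>R b) g) (cls \<phi>)"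
    by (rule shift_weak_mean_value[OF assms \<phi>, of h]) (rule that)
  also have "\<dots> \<le> \<bar>h\<bar> * \<bar>inner (shift (t *\<^sub>R b) g) (cls \<phi>)\<bar>" by (metis abs_ge_self abs_mult)
  also have "\<dots> \<le> \<bar>h\<bar> * (norm (shift (t *\<^sub>R b) g) * norm (cls \<phi>))"
    by (intro mult_left_mono Cauchy_Schwarz_ineq2) simp
  finally show "inner (shift (h *\<^sub>R b) u - u) (cls \<phi>) \<le> \<bar>h\<bar> * norm g * norm (cls \<phi>)" by simp
qed

lemma shift_continuous:
  assumes b: "b \<in> Basis"
  shows "((\<lambda>h. shift (h *\<^sub>R b) u) \<longlongrightarrow> u) (at 0)"
proof (rule tendstoI)
  fix e :: real assume e: "e > 0"
  have "u \<in> closure test_classes" by (simp add: test_classes_dense)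
  then obtain v where "v \<in> test_classes" "dist v u < e / 3"
    using e unfolding closure_approachable by (meson divide_pos_pos zero_less_numeral)
  then obtain \<phi> where \<phi>: "test_function \<phi>" "norm (cls \<phi> - u) < e / 3"
    unfolding test_classes_def dist_norm by blast
  obtain C where C: "\<And>h. \<bar>h\<bar> \<le> 1 \<Longrightarrow>
    norm (shift (h *\<^sub>R b) (cls \<phi>) - cls \<phi> - h *\<^sub>R cls (pderivs [b] \<phi>)) \<le> C * h\<^sup>2"
    by (rule shift_test_taylor[OF \<phi>(1) b]) (rule that)
  have "((\<lambda>h. C * h\<^sup>2 + \<bar>h\<bar> * norm (cls (pderivs [b] \<phi>))) \<longlongrightarrow> 0) (at 0)"
    by (auto intro!: tendsto_eq_intros)
  then have "\<forall>\<^sub>F h in at 0. C * h\<^sup>2 + \<bar>h\<bar> * norm (cls (pderivs [b] \<phi>)) < e / 3"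
    using e by (intro order_tendstoD) auto
  moreover have "\<forall>\<^sub>F h in at (0::real). \<bar>h\<bar> \<le> 1"
    unfolding eventually_at by (intro exI[of _ 1]) (auto simp: dist_real_def)
  ultimately show "\<forall>\<^sub>F h in at 0. dist (shift (h *\<^sub>R b) u) u < e"
  proof eventually_elim
    case (elim h)
    let ?r = "shift (h *\<^sub>R b) (cls \<phi>) - cls \<phi> - h *\<^sub>R cls (pderivs [b] \<phi>)"
    have "shift (h *\<^sub>R b) u - u = shift (h *\<^sub>R b) (u - cls \<phi>) + (?r + h *\<^sub>R cls (pderivs [b] \<phi>)) + (cls \<phi> - u)"
      by (simp add: shift_diff)
    then have "norm (shift (h *\<^sub>R b) u - u) \<le> norm (shift (h *\<^sub>R b) (u - cls \<phi>)) +
        (norm ?r + norm (h *\<^sub>R cls (pderivs [b] \<phi>))) + norm (cls \<phi> - u)"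
      by (metis add_mono norm_triangle_ineq norm_triangle_le order_refl)
    also have "\<dots> < e / 3 + e / 3 + e / 3"
      using C[of h] elim \<phi>(2) by (simp add: norm_minus_commute)
    finally show ?case by (simp add: dist_norm)
  qed
qed

definition diffquot :: "'a::euclidean_space \<Rightarrow> real \<Rightarrow> 'a l2 \<Rightarrow> 'a l2" where
  "diffquot b h u = (1 / h) *\<^sub>R (shift (h *\<^sub>R b) u - u)"

lemma norm_diffquot_le:
  assumes "wders [b] u g" "b \<in> Basis" shows "norm (diffquot b h u) \<le> norm g"
proof (cases "h = 0")
  case False
  then show ?thesis
    using norm_shift_diff_le[OF assms, of h] by (simp add: diffquot_def divide_simps mult.commute)
qed (simp add: diffquot_def)

text \<open>By the mean value theorem, the difference quotient tested against \<open>\<phi>\<close> equals a nearby translate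
  of \<open>g\<close> tested against \<open>\<phi>\<close>. Its distance to \<open>g\<close> is thus bounded by the modulus of continuity of
  translations of \<open>g\<close>.\<close>

lemma diffquot_tendsto:
  assumes "wders [b] u g" "b \<in> Basis"
  shows "((\<lambda>h. diffquot b h u) \<longlongrightarrow> g) (at 0)"
proof (rule tendstoI)
  fix e :: real assume e: "e > 0"
  have "\<forall>\<^sub>F t in at 0. dist (shift (t *\<^sub>R b) g) g < e / 2"
    using shift_continuous[OF assms(2), of g] e by (intro tendstoD) auto
  then obtain d where d: "d > 0" "\<And>t. t \<noteq> 0 \<Longrightarrow> \<bar>t\<bar> < d \<Longrightarrow> norm (shift (t *\<^sub>R b) g - g) < e / 2"
    unfolding eventually_at dist_norm by auto
  have "norm (diffquot b h u - g) \<le> e / 2" if h: "h \<noteq> 0" "\<bar>h\<bar> < d" for h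
  proof (rule norm_le_by_duality)
    show "0 \<le> e / 2" using e by simp
    fix \<phi> :: "'a \<Rightarrow> complex" assume \<phi>: "test_function \<phi>"
    obtain t where t: "\<bar>t\<bar> \<le> \<bar>h\<bar>" "inner (shift (h *\<^sub>R b) u - u) (cls \<phi>) = h * inner (shift (t *\<^sub>R b) g) (cls \<phi>)"
      by (rule shift_weak_mean_value[OF assms \<phi>, of h]) (rule that)
    have "inner (diffquot b h u - g) (cls \<phi>) = inner (shift (t *\<^sub>R b) g - g) (cls \<phi>)"
      using t(2) h(1) by (simp add: diffquot_def inner_diff_left)
    also have "\<dots> \<le> norm (shift (t *\<^sub>R b) g - g) * norm (cls \<phi>)" by (rule norm_cauchy_schwarz)
    also have "norm (shift (t *\<^sub>R b) g - g) \<le> e / 2"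
      using d(2)[of t] t(1) h(2) e by (cases "t = 0") auto
    finally show "inner (diffquot b h u - g) (cls \<phi>) \<le> e / 2 * norm (cls \<phi>)"
      by (simp add: mult_right_mono)
  qed
  then show "\<forall>\<^sub>F h in at 0. dist (diffquot b h u) g < e"
    unfolding eventually_at using d(1) e by (intro exI[of _ d]) (force simp: dist_norm)
qed

lemma filterlim_uminus_at_0: "filterlim uminus (at 0) (at (0::real))"
  unfolding filterlim_at by (auto intro!: tendsto_eq_intros simp: eventually_at_filter)

lemma diffquot_tendsto_minus:
  assumes "wders [b] u g" "b \<in> Basis"
  shows "((\<lambda>h. diffquot b (- h) u) \<longlongrightarrow> g) (at 0)"
  using filterlim_compose[OF diffquot_tendsto[OF assms] filterlim_uminus_at_0] .

lemma inner_diffquot: "inner (diffquot b h f) g = - inner f (diffquot b (- h) g)"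
  by (simp add: diffquot_def inner_diff_left inner_diff_right inner_shift_left algebra_simps)

text \<open>Summation by parts is exact for difference quotients, because translations are isometries.\<close>

lemma integration_by_parts:
  assumes "wders [b] f f'" "wders [b] g g'" "b \<in> Basis"
  shows "inner f' g = - inner f g'"
proof -
  have "((\<lambda>h. inner (diffquot b h f) g) \<longlongrightarrow> inner f' g) (at 0)"
    by (intro tendsto_intros diffquot_tendsto assms)
  moreover have "((\<lambda>h. - inner f (diffquot b (- h) g)) \<longlongrightarrow> - inner f g') (at 0)"
    by (intro tendsto_intros diffquot_tendsto_minus assms)
  ultimately show ?thesis unfolding inner_diffquot by (rule tendsto_unique[rotated]) simp
qed

lemma wders_diffquot:
  assumes "wders bs u g" "set bs \<subseteq> Basis" shows "wders bs (diffquot b h u) (diffquot b h g)"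
  unfolding diffquot_def by (intro wders_scaleR wders_diff wders_shift assms)

lemma diffquot_diff: "diffquot b h (u - v) = diffquot b h u - diffquot b h v"
  by (simp add: diffquot_def shift_diff algebra_simps)

text \<open>Formally one integrates by parts once in each direction, which would involve third derivatives.
  Instead the derivative in direction \<open>b\<close> is replaced by a difference quotient, which maps weakly
  differentiable classes to weakly differentiable classes, and integration by parts is applied in
  direction \<open>a\<close> only.\<close>

lemma mixed_derivative_energy:
  assumes a: "a \<in> Basis" and b: "b \<in> Basis"
    and "wders [a] u ua" "wders [b] u ub" "wders [a, a] u uaa" "wders [b, b] u ubb" "wders [a, b] u uab"
  shows "(norm uab)\<^sup>2 = inner uaa ubb"
proof -
  have ua_a: "wders [a] ua uaa" and ua_b: "wders [b] ua uab" and ub_b: "wders [b] ub ubb"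
    using assms wders_second by blast+
  have eq: "inner (diffquot b h ua) (diffquot b h ua) = inner (diffquot b (- h) (diffquot b h u)) uaa" for h
  proof -
    have "inner (diffquot b h ua) (diffquot b h ua) = - inner (diffquot b h u) (diffquot b h uaa)"
      by (rule integration_by_parts[OF wders_diffquot wders_diffquot a]) (use assms ua_a in auto)
    then show ?thesis by (simp add: inner_commute[of "diffquot b h u"] inner_diffquot[of b h uaa] inner_commute[of uaa])
  qed
  have "((\<lambda>h. diffquot b h ub - ubb) \<longlongrightarrow> ubb - ubb) (at 0)"
    by (intro tendsto_intros diffquot_tendsto ub_b b)
  then have z: "((\<lambda>h. norm (diffquot b h ub - ubb)) \<longlongrightarrow> 0) (at 0)"
    using tendsto_norm_zero_iff by fastforce
  have "((\<lambda>h. diffquot b (- h) (diffquot b h u - ub)) \<longlongrightarrow> 0) (at 0)"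
  proof (rule Lim_null_comparison[OF _ z], rule always_eventually, rule allI)
    show "norm (diffquot b (- h) (diffquot b h u - ub)) \<le> norm (diffquot b h ub - ubb)" for h
      by (rule norm_diffquot_le[OF wders_diff[OF wders_diffquot ub_b] b]) (use assms ub_b in auto)
  qed
  then have "((\<lambda>h. diffquot b (- h) (diffquot b h u - ub) + diffquot b (- h) ub) \<longlongrightarrow> 0 + ubb) (at 0)"
    by (intro tendsto_add diffquot_tendsto_minus ub_b b)
  then have "((\<lambda>h. diffquot b (- h) (diffquot b h u)) \<longlongrightarrow> ubb) (at 0)"
    by (simp add: diffquot_diff)
  then have "((\<lambda>h. inner (diffquot b (- h) (diffquot b h u)) uaa) \<longlongrightarrow> inner ubb uaa) (at 0)"
    by (intro tendsto_intros)
  moreover have "((\<lambda>h. inner (diffquot b h ua) (diffquot b h ua)) \<longlongrightarrow> inner uab uab) (at 0)"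
    by (intro tendsto_intros diffquot_tendsto ua_b b)
  ultimately have "inner uab uab = inner ubb uaa"
    unfolding eq by (intro tendsto_unique[of "at (0::real)"]) auto
  then show ?thesis by (simp add: power2_norm_eq_inner inner_commute)
qed

text \<open>Walk from \<open>0\<close> to \<open>y\<close> along the coordinate directions.\<close>

lemma norm_shift_diff_le_general:
  assumes "\<And>b. b \<in> Basis \<Longrightarrow> wders [b] w (G b)"
  shows "norm (shift y w - w) \<le> (\<Sum>b\<in>Basis. \<bar>y \<bullet> b\<bar> * norm (G b))"
proof -
  have "norm (shift (\<Sum>b\<in>F. (y \<bullet> b) *\<^sub>R b) w - w) \<le> (\<Sum>b\<in>F. \<bar>y \<bullet> b\<bar> * norm (G b))"
    if "finite F" "F \<subseteq> Basis" for F
    using that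
  proof (induct F rule: finite_induct)
    case (insert b F)
    let ?z = "\<Sum>b\<in>F. (y \<bullet> b) *\<^sub>R b"
    have "shift (\<Sum>b\<in>insert b F. (y \<bullet> b) *\<^sub>R b) w - w =
        shift ?z (shift ((y \<bullet> b) *\<^sub>R b) w - w) + (shift ?z w - w)"
      using insert by (simp add: shift_diff shift_shift add.commute)
    then have "norm (shift (\<Sum>b\<in>insert b F. (y \<bullet> b) *\<^sub>R b) w - w) \<le>
        norm (shift ((y \<bullet> b) *\<^sub>R b) w - w) + norm (shift ?z w - w)"
      using norm_triangle_ineq[of "shift ?z (shift ((y \<bullet> b) *\<^sub>R b) w - w)" "shift ?z w - w"]
      by (simp only: norm_shift)
    also have "\<dots> \<le> \<bar>y \<bullet> b\<bar> * norm (G b) + (\<Sum>b\<in>F. \<bar>y \<bullet> b\<bar> * norm (G b))"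
      using insert by (intro add_mono norm_shift_diff_le assms) auto
    finally show ?case using insert by simp
  qed simp
  from this[of Basis] show ?thesis by (simp add: euclidean_representation)
qed

section \<open>The space of classes with two weak derivatives\<close>

definition H2cls :: "'a::euclidean_space l2 set" where
  "H2cls = {u. \<forall>bs\<in>directions2. \<exists>g. wders bs u g}"

definition wd :: "'a::euclidean_space list \<Rightarrow> 'a l2 \<Rightarrow> 'a l2" where
  "wd bs u = (SOME g. wders bs u g)"

definition lap :: "'a::euclidean_space l2 \<Rightarrow> 'a l2" where
  "lap u = (\<Sum>b\<in>Basis. wd [b, b] u)"

lemma wders_wd: "u \<in> H2cls \<Longrightarrow> bs \<in> directions2 \<Longrightarrow> wders bs u (wd bs u)"
  unfolding H2cls_def wd_def by (auto intro: someI_ex)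

lemma wd_eqI: "wders bs u g \<Longrightarrow> wd bs u = g"
  unfolding wd_def using wders_unique by (metis someI)

lemma wd_Nil [simp]: "wd [] u = u"
  by (rule wd_eqI[OF wders_Nil])

lemma directions2_simps [simp]:
  "[] \<in> directions2" "[b] \<in> directions2 \<longleftrightarrow> b \<in> Basis"
  "[a, b] \<in> directions2 \<longleftrightarrow> a \<in> Basis \<and> b \<in> Basis"
  by (auto simp: directions2_def)

lemma directions2_eq:
  "directions2 = insert [] ((\<lambda>b. [b]) ` Basis \<union> (\<lambda>(a, b). [a, b]) ` (Basis \<times> Basis))"
proof (intro set_eqI iffI)
  fix bs :: "'a list" assume "bs \<in> directions2"
  then have bs: "set bs \<subseteq> Basis" "length bs \<le> 2" by (auto simp: directions2_def)
  show "bs \<in> insert [] ((\<lambda>b. [b]) ` Basis \<union> (\<lambda>(a, b). [a, b]) ` (Basis \<times> Basis))"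
  proof (cases bs)
    case (Cons a as)
    then show ?thesis using bs by (cases as) auto
  qed simp
qed (auto simp: directions2_def)

lemma finite_directions2: "finite directions2"
  unfolding directions2_eq by simp

lemma sum_directions2:
  fixes f :: "'a::euclidean_space list \<Rightarrow> real"
  shows "sum f directions2 = f [] + (\<Sum>b\<in>Basis. f [b]) + (\<Sum>a\<in>Basis. \<Sum>b\<in>Basis. f [a, b])"
proof -
  have "sum f directions2 = f [] + (sum f ((\<lambda>b. [b]) ` Basis) + sum f ((\<lambda>(a, b). [a, b]) ` (Basis \<times> Basis)))"
    unfolding directions2_eq by (subst sum.insert, simp, force, subst sum.union_disjoint) auto
  also have "sum f ((\<lambda>b. [b]) ` Basis) = (\<Sum>b\<in>Basis. f [b])"
    by (subst sum.reindex) (auto simp: inj_on_def)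
  also have "sum f ((\<lambda>(a, b). [a, b]) ` (Basis \<times> Basis)) = (\<Sum>a\<in>Basis. \<Sum>b\<in>Basis. f [a, b])"
    by (subst sum.reindex) (auto simp: inj_on_def sum.cartesian_product case_prod_unfold)
  finally show ?thesis by simp
qed

lemma H2cls_diff:
  assumes "u \<in> H2cls" "v \<in> H2cls"
  shows "u - v \<in> H2cls" "bs \<in> directions2 \<Longrightarrow> wd bs (u - v) = wd bs u - wd bs v" "lap (u - v) = lap u - lap v"
proof -
  have d: "wders bs (u - v) (wd bs u - wd bs v)" if "bs \<in> directions2" for bs
    by (intro wders_diff wders_wd assms that)
  then show "u - v \<in> H2cls" unfolding H2cls_def by blast
  show w: "wd bs (u - v) = wd bs u - wd bs v" if "bs \<in> directions2" for bs by (rule wd_eqI[OF d[OF that]])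
  show "lap (u - v) = lap u - lap v"
    unfolding lap_def sum_subtractf[symmetric] by (intro sum.cong refl w) simp
qed

lemma H2cls_scaleR:
  assumes "u \<in> H2cls"
  shows "r *\<^sub>R u \<in> H2cls" "bs \<in> directions2 \<Longrightarrow> wd bs (r *\<^sub>R u) = r *\<^sub>R wd bs u" "lap (r *\<^sub>R u) = r *\<^sub>R lap u"
proof -
  have d: "wders bs (r *\<^sub>R u) (r *\<^sub>R wd bs u)" if "bs \<in> directions2" for bs
    by (intro wders_scaleR wders_wd assms that)
  then show "r *\<^sub>R u \<in> H2cls" unfolding H2cls_def by blast
  show w: "wd bs (r *\<^sub>R u) = r *\<^sub>R wd bs u" if "bs \<in> directions2" for bs by (rule wd_eqI[OF d[OF that]])
  show "lap (r *\<^sub>R u) = r *\<^sub>R lap u"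
    unfolding lap_def scaleR_sum_right by (intro sum.cong refl w) simp
qed

lemma H2cls_shift:
  assumes "u \<in> H2cls"
  shows "shift y u \<in> H2cls" "bs \<in> directions2 \<Longrightarrow> wd bs (shift y u) = shift y (wd bs u)" "lap (shift y u) = shift y (lap u)"
proof -
  have d: "wders bs (shift y u) (shift y (wd bs u))" if "bs \<in> directions2" for bs
    by (intro wders_shift wders_wd assms that) (use that in \<open>auto simp: directions2_def\<close>)
  then show "shift y u \<in> H2cls" unfolding H2cls_def by blast
  show w: "wd bs (shift y u) = shift y (wd bs u)" if "bs \<in> directions2" for bs by (rule wd_eqI[OF d[OF that]])
  show "lap (shift y u) = shift y (lap u)"
    unfolding lap_def shift_sum by (intro sum.cong refl w) simp
qed

text \<open>The Laplacian alone controls the full Hessian; this makes \<open>energy\<close> below equivalent to the square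
  of the \<open>H\<^sup>2\<close> norm.\<close>

lemma hessian_energy:
  assumes "u \<in> H2cls"
  shows "(\<Sum>a\<in>Basis. \<Sum>b\<in>Basis. (norm (wd [a, b] u))\<^sup>2) = (norm (lap u))\<^sup>2"
proof -
  have "(norm (wd [a, b] u))\<^sup>2 = inner (wd [b, b] u) (wd [a, a] u)" if "a \<in> Basis" "b \<in> Basis" for a b
    unfolding inner_commute[of "wd [b, b] u"]
    by (rule mixed_derivative_energy[of a b u "wd [a] u" "wd [b] u"])
      (use that in \<open>auto intro!: wders_wd assms\<close>)
  then show ?thesis
    by (simp add: lap_def power2_norm_eq_inner[of "\<Sum>b\<in>Basis. wd [b, b] u"] inner_sum_left inner_sum_right cong: sum.cong)
qed

lemma gradient_energy:
  assumes "u \<in> H2cls"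
  shows "(\<Sum>b\<in>Basis. (norm (wd [b] u))\<^sup>2) = - inner u (lap u)"
proof -
  have "(norm (wd [b] u))\<^sup>2 = - inner u (wd [b, b] u)" if b: "b \<in> Basis" for b
    unfolding power2_norm_eq_inner
    by (rule integration_by_parts[OF _ wders_second b]) (use b in \<open>auto intro!: wders_wd assms\<close>)
  then show ?thesis by (simp add: lap_def inner_sum_right sum_negf)
qed

definition energy :: "'a::euclidean_space l2 \<Rightarrow> real" where
  "energy u = (norm (lap u))\<^sup>2 + (norm u)\<^sup>2"

lemma energy_nonneg: "0 \<le> energy u"
  by (simp add: energy_def)

lemma gradient_le_energy:
  assumes "u \<in> H2cls"
  shows "(\<Sum>b\<in>Basis. (norm (wd [b] u))\<^sup>2) \<le> energy u / 2"
proof -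
  have "- inner u (lap u) \<le> norm u * norm (lap u)"
    using Cauchy_Schwarz_ineq2[of u "lap u"] by linarith
  also have "\<dots> \<le> energy u / 2"
    unfolding energy_def using sum_squares_bound[of "norm u" "norm (lap u)"] by simp
  finally show ?thesis using gradient_energy[OF assms] by simp
qed

lemma sum_derivatives_le_energy:
  assumes "u \<in> H2cls"
  shows "(\<Sum>bs\<in>directions2. (norm (wd bs u))\<^sup>2) \<le> 3 / 2 * energy u"
  using gradient_le_energy[OF assms] hessian_energy[OF assms] by (simp add: sum_directions2 energy_def)

lemma wd_le_energy:
  assumes "u \<in> H2cls" "bs \<in> directions2"
  shows "norm (wd bs u) \<le> sqrt (3 / 2 * energy u)"
proof (rule real_le_rsqrt)
  have "(norm (wd bs u))\<^sup>2 \<le> (\<Sum>bs\<in>directions2. (norm (wd bs u))\<^sup>2)"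
    by (rule member_le_sum[OF assms(2)]) (auto simp: finite_directions2)
  also note sum_derivatives_le_energy[OF assms(1)]
  finally show "(norm (wd bs u))\<^sup>2 \<le> 3 / 2 * energy u" .
qed

text \<open>The second difference is, up to a translation, the first difference of a first difference.\<close>

lemma second_difference_le:
  assumes u: "u \<in> H2cls"
  shows "norm (2 *\<^sub>R u - shift y u - shift (- y) u) \<le> (norm y)\<^sup>2 * (\<Sum>a\<in>Basis. \<Sum>b\<in>Basis. norm (wd [a, b] u))"
proof -
  let ?D = "shift y u - u"
  have yb: "\<bar>y \<bullet> b\<bar> \<le> norm y" if "b \<in> Basis" for b using Basis_le_norm[OF that] .
  have w1: "wders [a] u (wd [a] u)" if "a \<in> Basis" for a using wders_wd[OF u] that by simp
  have w2: "wders [b] (wd [a] u) (wd [a, b] u)" if "a \<in> Basis" "b \<in> Basis" for a b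
    by (rule wders_second[OF w1]) (use wders_wd[OF u] that in auto)
  have w1D: "wders [a] ?D (shift y (wd [a] u) - wd [a] u)" if a: "a \<in> Basis" for a
    by (intro wders_diff wders_shift w1 a) (simp add: a)
  have step: "norm (shift y (wd [a] u) - wd [a] u) \<le> norm y * (\<Sum>b\<in>Basis. norm (wd [a, b] u))"
    if a: "a \<in> Basis" for a
  proof -
    have "norm (shift y (wd [a] u) - wd [a] u) \<le> (\<Sum>b\<in>Basis. \<bar>y \<bullet> b\<bar> * norm (wd [a, b] u))"
      by (rule norm_shift_diff_le_general) (rule w2[OF a])
    also have "\<dots> \<le> (\<Sum>b\<in>Basis. norm y * norm (wd [a, b] u))"
      by (intro sum_mono mult_right_mono yb) auto
    finally show ?thesis by (simp add: sum_distrib_left)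
  qed
  have "2 *\<^sub>R u - shift y u - shift (- y) u = - shift (- y) (shift y ?D - ?D)"
    by (simp add: shift_diff shift_shift scaleR_2)
  then have "norm (2 *\<^sub>R u - shift y u - shift (- y) u) = norm (shift y ?D - ?D)" by simp
  also have "\<dots> \<le> (\<Sum>a\<in>Basis. \<bar>y \<bullet> a\<bar> * norm (shift y (wd [a] u) - wd [a] u))"
    by (rule norm_shift_diff_le_general) (rule w1D)
  also have "\<dots> \<le> (\<Sum>a\<in>Basis. norm y * (norm y * (\<Sum>b\<in>Basis. norm (wd [a, b] u))))"
    by (intro sum_mono mult_mono yb step) auto
  also have "\<dots> = (norm y)\<^sup>2 * (\<Sum>a\<in>Basis. \<Sum>b\<in>Basis. norm (wd [a, b] u))"
    by (simp add: sum_distrib_left power2_eq_square mult.assoc)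
  finally show ?thesis .
qed

section \<open>Averages over balls\<close>

definition avg :: "real \<Rightarrow> ('a::euclidean_space \<Rightarrow> complex) \<Rightarrow> 'a \<Rightarrow> complex" where
  "avg h f x = (1 / measure lborel (cball (0::'a) h)) *\<^sub>R
     (LINT y|lborel. indicat_real (cball 0 h) y *\<^sub>R f (x + y))"

lemma ball_indicator_sqint:
  "(\<lambda>y. complex_of_real (indicat_real (cball (0::'a::euclidean_space) h) y)) \<in> sqint"
  by (rule bounded_compact_support_sqint[of _ "cball 0 h" 1]) (auto simp: indicator_def)

lemma norm_ball_indicator:
  "norm (cls (\<lambda>y. complex_of_real (indicat_real (cball (0::'a::euclidean_space) h) y))) = sqrt (measure lborel (cball (0::'a) h))"
proof -
  let ?f = "\<lambda>y. complex_of_real (indicat_real (cball (0::'a) h) y)"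
  have "(norm (cls ?f))\<^sup>2 = (LINT y|lborel. indicat_real (cball (0::'a) h) y)"
    unfolding norm_cls_sq[OF ball_indicator_sqint]
    by (intro Bochner_Integration.integral_cong) (auto simp: indicator_def)
  also have "\<dots> = measure lborel (cball (0::'a) h)"
    using emeasure_lborel_cball_finite[of "0::'a" h] by simp
  finally show ?thesis by (simp add: real_sqrt_unique)
qed

lemma ball_indicator_mult_sqint:
  "f \<in> sqint \<Longrightarrow> (\<lambda>y. indicat_real (cball (0::'a::euclidean_space) h) y *\<^sub>R f y) \<in> sqint"
  by (rule sqint_mono[of f _ 1]) (auto simp: indicator_def dest: sqint_measurable)

lemma ball_integrable:
  fixes g :: "'a::euclidean_space \<Rightarrow> complex"
  assumes "(\<lambda>y. indicat_real (cball 0 h) y *\<^sub>R g y) \<in> sqint"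
  shows "integrable lborel (\<lambda>y. indicat_real (cball 0 h) y *\<^sub>R g y)"
proof -
  have eq: "complex_of_real (indicat_real (cball 0 h) y) * (indicat_real (cball 0 h) y *\<^sub>R g y) = indicat_real (cball 0 h) y *\<^sub>R g y" for y
    by (simp add: indicator_def)
  show ?thesis
    using sqint_integrable_complex_mult[OF ball_indicator_sqint[of h] assms] unfolding eq .
qed

lemma ball_integral_le:
  fixes g :: "'a::euclidean_space \<Rightarrow> complex"
  assumes "(\<lambda>y. indicat_real (cball 0 h) y *\<^sub>R g y) \<in> sqint"
  shows "cmod (LINT y|lborel. indicat_real (cball 0 h) y *\<^sub>R g y)
    \<le> sqrt (measure lborel (cball (0::'a) h)) * norm (cls (\<lambda>y. indicat_real (cball 0 h) y *\<^sub>R g y))"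
proof -
  have "cmod (LINT y|lborel. indicat_real (cball 0 h) y *\<^sub>R g y) \<le> (LINT y|lborel. cmod (indicat_real (cball 0 h) y *\<^sub>R g y))"
    by (rule integral_norm_bound)
  also have "(\<lambda>y. cmod (indicat_real (cball 0 h) y *\<^sub>R g y)) =
      (\<lambda>y. indicat_real (cball 0 h) y * cmod (indicat_real (cball 0 h) y *\<^sub>R g y))"
    by (auto simp: indicator_def)
  also have "(LINT y|lborel. indicat_real (cball 0 h) y * cmod (indicat_real (cball 0 h) y *\<^sub>R g y)) \<le>
      norm (cls (\<lambda>y. complex_of_real (indicat_real (cball (0::'a) h) y))) * norm (cls (\<lambda>y. indicat_real (cball 0 h) y *\<^sub>R g y))"
    by (rule weighted_L1_le(2)[OF assms ball_indicator_sqint]) simp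
  finally show ?thesis unfolding norm_ball_indicator .
qed

lemma sqint_translate': "f \<in> sqint \<Longrightarrow> (\<lambda>y. f (x + y)) \<in> sqint"
  using sqint_translate[of f x] by (simp add: add.commute)

lemma norm_cls_translate: "f \<in> sqint \<Longrightarrow> norm (cls (\<lambda>y. f (x + y))) = norm (cls f)"
proof -
  assume f: "f \<in> sqint"
  have "(\<lambda>y. f (x + y)) = (\<lambda>y. f (y + x))" by (simp add: add.commute)
  then show ?thesis using shift_cls[OF f, of x] norm_shift[of x "cls f"] by simp
qed

lemma norm_cls_mono:
  assumes "f \<in> sqint" "g \<in> sqint" "\<And>x. cmod (f x) \<le> cmod (g x)"
  shows "norm (cls f) \<le> norm (cls g)"
proof (rule power2_le_imp_le)
  show "(norm (cls f))\<^sup>2 \<le> (norm (cls g))\<^sup>2"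
    unfolding norm_cls_sq[OF assms(1)] norm_cls_sq[OF assms(2)]
    by (intro integral_mono sqint_integrable assms power_mono) simp
qed simp

lemma avg_sup_le:
  fixes f :: "'a::euclidean_space \<Rightarrow> complex"
  assumes f: "f \<in> sqint" and h: "h > 0"
  shows "cmod (avg h f x) \<le> norm (cls f) / sqrt (measure lborel (cball (0::'a) h))"
proof -
  let ?V = "measure lborel (cball (0::'a) h)"
  have V: "?V > 0" using h by simp
  note fx = sqint_translate'[OF f, of x]
  have "cmod (avg h f x) = cmod (LINT y|lborel. indicat_real (cball 0 h) y *\<^sub>R f (x + y)) / ?V"
    using V by (simp add: avg_def)
  also have "\<dots> \<le> (sqrt ?V * norm (cls f)) / ?V"
  proof (rule divide_right_mono)
    have "norm (cls (\<lambda>y. indicat_real (cball 0 h) y *\<^sub>R f (x + y))) \<le> norm (cls (\<lambda>y. f (x + y)))"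
      by (rule norm_cls_mono[OF ball_indicator_mult_sqint[OF fx] fx]) (auto simp: indicator_def)
    then show "cmod (LINT y|lborel. indicat_real (cball 0 h) y *\<^sub>R f (x + y)) \<le> sqrt ?V * norm (cls f)"
      using ball_integral_le[OF ball_indicator_mult_sqint[OF fx], of h]
      unfolding norm_cls_translate[OF f]
      by (meson mult_left_mono order_trans real_sqrt_ge_zero measure_nonneg)
  qed simp
  also have "\<dots> = norm (cls f) / sqrt ?V"
    using V by (simp add: field_simps real_sqrt_mult_self)
  finally show ?thesis .
qed

lemma avg_diff:
  fixes f g :: "'a::euclidean_space \<Rightarrow> complex"
  assumes "f \<in> sqint" "g \<in> sqint"
  shows "avg h (\<lambda>x. f x - g x) x = avg h f x - avg h g x"
proof -
  note int = ball_integrable[OF ball_indicator_mult_sqint[OF sqint_translate']]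
  show ?thesis
    unfolding avg_def scaleR_diff_right Bochner_Integration.integral_diff[OF int[OF assms(1)] int[OF assms(2)]] ..
qed

lemma avg_scaleR: "avg h (\<lambda>x. r *\<^sub>R f x) x = r *\<^sub>R avg h f x"
proof -
  have "(\<lambda>y. indicat_real (cball 0 h) y *\<^sub>R (r *\<^sub>R f (x + y))) = (\<lambda>y. r *\<^sub>R (indicat_real (cball 0 h) y *\<^sub>R f (x + y)))"
    by (simp add: mult.commute)
  then show ?thesis unfolding avg_def by (simp only: integral_scaleR_right) (simp add: mult.commute)
qed

lemma avg_translate: "avg h (\<lambda>x. f (x + z)) x = avg h f (x + z)"
  by (simp add: avg_def algebra_simps)

lemma measurable_pair_lborel:
  "f \<in> borel_measurable (borel \<Otimes>\<^sub>M borel) \<Longrightarrow> f \<in> borel_measurable (borel \<Otimes>\<^sub>M lborel)"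
  "f \<in> borel_measurable (borel \<Otimes>\<^sub>M borel) \<Longrightarrow> f \<in> borel_measurable (lborel \<Otimes>\<^sub>M lborel)"
  by (simp_all cong: measurable_cong_sets sets_pair_measure_cong)

lemma ball_pair_measurable:
  "(\<lambda>z. indicat_real (cball 0 h) (snd z)) \<in> borel_measurable (borel \<Otimes>\<^sub>M borel)"
  by (rule measurable_compose[OF measurable_snd]) (simp add: borel_measurable_indicator)

lemma avg_measurable [measurable (raw)]:
  assumes [measurable]: "f \<in> borel_measurable borel"
  shows "avg h f \<in> borel_measurable borel"
proof -
  note ball_pair_measurable[measurable]
  have "(\<lambda>z. indicat_real (cball 0 h) (snd z) *\<^sub>R f (fst z + snd z)) \<in> borel_measurable (borel \<Otimes>\<^sub>M borel)"
    by measurable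
  from measurable_pair_lborel(1)[OF this]
  have "(\<lambda>x. LINT y|lborel. indicat_real (cball 0 h) y *\<^sub>R f (x + y)) \<in> borel_measurable borel"
    by (intro lborel.borel_measurable_lebesgue_integral) (simp add: case_prod_unfold)
  then show ?thesis unfolding avg_def[abs_def] by simp
qed

text \<open>An average of functions is bounded in \<open>L\<^sup>2\<close> by the largest of their norms: use the
  Cauchy-Schwarz inequality in \<open>y\<close> and then exchange the integrals.\<close>

lemma ball_average_L2_le:
  fixes G :: "'a::euclidean_space \<Rightarrow> 'a \<Rightarrow> complex"
  assumes [measurable]: "case_prod G \<in> borel_measurable (borel \<Otimes>\<^sub>M borel)"
    and sq: "\<And>x. (\<lambda>y. indicat_real (cball 0 h) y *\<^sub>R G x y) \<in> sqint"
    and h: "h > 0" and E: "0 \<le> E"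
    and bd: "\<And>y. norm y \<le> h \<Longrightarrow> (\<integral>\<^sup>+x. ennreal ((cmod (G x y))\<^sup>2) \<partial>lborel) \<le> ennreal (E\<^sup>2)"
  shows "(\<integral>\<^sup>+x. ennreal ((cmod ((1 / measure lborel (cball (0::'a) h)) *\<^sub>R
      (LINT y|lborel. indicat_real (cball 0 h) y *\<^sub>R G x y)))\<^sup>2) \<partial>lborel) \<le> ennreal (E\<^sup>2)"
proof -
  let ?V = "measure lborel (cball (0::'a) h)"
  let ?I = "indicator (cball (0::'a) h) :: 'a \<Rightarrow> ennreal"
  have "(\<lambda>z. ?I (snd z)) \<in> borel_measurable (borel \<Otimes>\<^sub>M borel)"
    by (rule measurable_compose[OF measurable_snd]) (simp add: borel_measurable_indicator)
  then have "(\<lambda>z. ennreal ((cmod (G (fst z) (snd z)))\<^sup>2) * ?I (snd z)) \<in> borel_measurable (borel \<Otimes>\<^sub>M borel)"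
    using assms(1) by (intro borel_measurable_times_ennreal) (simp_all add: case_prod_unfold)
  note meas = this measurable_pair_lborel[OF this]
  have V: "?V > 0" using h by simp
  have eV: "emeasure lborel (cball (0::'a) h) = ennreal ?V"
    using emeasure_lborel_cball_finite[of "0::'a" h] by (simp add: emeasure_eq_ennreal_measure)
  have pt: "ennreal ((cmod ((1 / ?V) *\<^sub>R (LINT y|lborel. indicat_real (cball 0 h) y *\<^sub>R G x y)))\<^sup>2)
      \<le> ennreal (1 / ?V) * (\<integral>\<^sup>+y. ennreal ((cmod (G x y))\<^sup>2) * ?I y \<partial>lborel)" for x
  proof -
    let ?g = "\<lambda>y. indicat_real (cball 0 h) y *\<^sub>R G x y"
    have "(cmod ((1 / ?V) *\<^sub>R (LINT y|lborel. ?g y)))\<^sup>2 = (1 / ?V)\<^sup>2 * (cmod (LINT y|lborel. ?g y))\<^sup>2"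
      by (simp add: power_mult_distrib power_divide)
    also have "\<dots> \<le> (1 / ?V)\<^sup>2 * (sqrt ?V * norm (cls ?g))\<^sup>2"
      by (intro mult_left_mono power_mono ball_integral_le sq) auto
    also have "\<dots> = 1 / ?V * (norm (cls ?g))\<^sup>2"
      using V by (simp add: power_mult_distrib power2_eq_square field_simps)
    finally have "ennreal ((cmod ((1 / ?V) *\<^sub>R (LINT y|lborel. ?g y)))\<^sup>2) \<le> ennreal (1 / ?V) * ennreal ((norm (cls ?g))\<^sup>2)"
      using V by (simp add: ennreal_mult[symmetric] ennreal_leI)
    also have "ennreal ((norm (cls ?g))\<^sup>2) = (\<integral>\<^sup>+y. ennreal ((cmod (?g y))\<^sup>2) \<partial>lborel)"
      by (rule nn_integral_sqint[OF sq, symmetric])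
    also have "\<dots> = (\<integral>\<^sup>+y. ennreal ((cmod (G x y))\<^sup>2) * ?I y \<partial>lborel)"
      by (intro nn_integral_cong) (auto simp: indicator_def)
    finally show ?thesis .
  qed
  have "(\<integral>\<^sup>+x. ennreal ((cmod ((1 / ?V) *\<^sub>R (LINT y|lborel. indicat_real (cball 0 h) y *\<^sub>R G x y)))\<^sup>2) \<partial>lborel)
      \<le> (\<integral>\<^sup>+x. ennreal (1 / ?V) * (\<integral>\<^sup>+y. ennreal ((cmod (G x y))\<^sup>2) * ?I y \<partial>lborel) \<partial>lborel)"
    by (intro nn_integral_mono pt)
  also have "\<dots> = ennreal (1 / ?V) * (\<integral>\<^sup>+x. \<integral>\<^sup>+y. ennreal ((cmod (G x y))\<^sup>2) * ?I y \<partial>lborel \<partial>lborel)"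
    using lborel.borel_measurable_nn_integral_fst[OF meas(2)] by (intro nn_integral_cmult) simp
  also have "(\<integral>\<^sup>+x. \<integral>\<^sup>+y. ennreal ((cmod (G x y))\<^sup>2) * ?I y \<partial>lborel \<partial>lborel) =
      (\<integral>\<^sup>+y. \<integral>\<^sup>+x. ennreal ((cmod (G x y))\<^sup>2) * ?I y \<partial>lborel \<partial>lborel)"
    using meas(3) by (intro lborel_pair.Fubini'[symmetric]) (simp add: case_prod_unfold)
  also have "\<dots> \<le> (\<integral>\<^sup>+y. ennreal (E\<^sup>2) * ?I y \<partial>lborel)"
  proof (intro nn_integral_mono)
    fix y :: 'a
    have "(\<integral>\<^sup>+x. ennreal ((cmod (G x y))\<^sup>2) * ?I y \<partial>lborel) = (\<integral>\<^sup>+x. ennreal ((cmod (G x y))\<^sup>2) \<partial>lborel) * ?I y"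
      using measurable_compose[OF measurable_Pair1'[of y borel borel] assms(1)] by (intro nn_integral_multc) simp
    also have "\<dots> \<le> ennreal (E\<^sup>2) * ?I y"
      using bd[of y] by (auto simp: indicator_def dist_norm)
    finally show "(\<integral>\<^sup>+x. ennreal ((cmod (G x y))\<^sup>2) * ?I y \<partial>lborel) \<le> ennreal (E\<^sup>2) * ?I y" .
  qed
  also have "\<dots> = ennreal (E\<^sup>2) * ennreal ?V"
    by (simp add: nn_integral_cmult_indicator eV)
  finally have "(\<integral>\<^sup>+x. ennreal ((cmod ((1 / ?V) *\<^sub>R (LINT y|lborel. indicat_real (cball 0 h) y *\<^sub>R G x y)))\<^sup>2) \<partial>lborel)
      \<le> ennreal (1 / ?V) * (ennreal (E\<^sup>2) * ennreal ?V)"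
    by (simp add: mult_left_mono)
  also have "\<dots> = ennreal (E\<^sup>2)"
    using V by (simp add: ennreal_mult[symmetric])
  finally show ?thesis .
qed

lemma avg_sqint:
  fixes f :: "'a::euclidean_space \<Rightarrow> complex"
  assumes f: "f \<in> sqint" and h: "h > 0"
  shows "avg h f \<in> sqint"
proof -
  have [measurable]: "f \<in> borel_measurable borel" by (rule sqint_measurable[OF f])
  have "(\<integral>\<^sup>+x. ennreal ((cmod (avg h f x))\<^sup>2) \<partial>lborel) \<le> ennreal ((norm (cls f))\<^sup>2)"
    unfolding avg_def
  proof (rule ball_average_L2_le[OF _ _ h])
    show "(\<lambda>y. indicat_real (cball 0 h) y *\<^sub>R f (x + y)) \<in> sqint" for x
      by (rule ball_indicator_mult_sqint[OF sqint_translate'[OF f]])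
    show "(\<integral>\<^sup>+x. ennreal ((cmod (f (x + y)))\<^sup>2) \<partial>lborel) \<le> ennreal ((norm (cls f))\<^sup>2)" for y
      using nn_integral_sqint[OF sqint_translate[OF f, of y]] shift_cls[OF f, of y] norm_shift[of y "cls f"] by simp
  qed simp_all
  from sqint_norm_le(1)[OF _ this] show ?thesis by simp
qed

lemma integral_uminus:
  fixes g :: "'a::euclidean_space \<Rightarrow> complex"
  assumes "g \<in> borel_measurable borel"
  shows "(LINT y|lborel. g (- y)) = (LINT y|lborel. g y)"
proof -
  have "lborel = density (distr lborel borel (\<lambda>x::'a. 0 + (-1) *\<^sub>R x)) (\<lambda>_. \<bar>- 1::real\<bar> ^ DIM('a))"
    by (rule lborel_affine) simp
  then have "distr lborel borel (\<lambda>x::'a. - x) = lborel" by (simp add: density_1)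
  then show ?thesis using integral_distr[of uminus lborel borel g] assms by simp
qed

text \<open>Averaging over a symmetric set cancels first differences, so that only second ones remain.\<close>

definition second_diff :: "('a::euclidean_space \<Rightarrow> complex) \<Rightarrow> 'a \<Rightarrow> 'a \<Rightarrow> complex" where
  "second_diff f y x = 2 *\<^sub>R f x - f (x + y) - f (x - y)"

lemma diff_avg_eq:
  fixes f :: "'a::euclidean_space \<Rightarrow> complex"
  assumes f: "f \<in> sqint" and h: "h > 0"
  shows "f x - avg h f x = (1 / measure lborel (cball (0::'a) h)) *\<^sub>R
     (LINT y|lborel. indicat_real (cball 0 h) y *\<^sub>R ((1/2) *\<^sub>R second_diff f y x))"
    "(\<lambda>y. indicat_real (cball 0 h) y *\<^sub>R ((1/2) *\<^sub>R second_diff f y x)) \<in> sqint"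
proof -
  let ?V = "measure lborel (cball (0::'a) h)"
  let ?i = "indicat_real (cball (0::'a) h)"
  have V: "?V > 0" using h by simp
  have [measurable]: "f \<in> borel_measurable borel" by (rule sqint_measurable[OF f])
  have s1: "(\<lambda>y. ?i y *\<^sub>R f x) \<in> sqint"
    by (rule bounded_compact_support_sqint[of _ "cball 0 h" "cmod (f x)"]) (auto simp: indicator_def)
  have s2: "(\<lambda>y. ?i y *\<^sub>R f (x + y)) \<in> sqint"
    by (rule ball_indicator_mult_sqint[OF sqint_translate'[OF f]])
  have refl: "(\<lambda>y. f (x - y)) \<in> sqint"
  proof (rule sqint_norm_le(1))
    let ?g = "\<lambda>y. ennreal ((cmod (f (x + y)))\<^sup>2)"
    have "lborel = density (distr lborel borel (\<lambda>x::'a. 0 + (-1) *\<^sub>R x)) (\<lambda>_. \<bar>- 1::real\<bar> ^ DIM('a))"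
      by (rule lborel_affine) simp
    then have "distr lborel borel (\<lambda>x::'a. - x) = lborel" by (simp add: density_1)
    then have "(\<integral>\<^sup>+y. ennreal ((cmod (f (x - y)))\<^sup>2) \<partial>lborel) = (\<integral>\<^sup>+y. ?g y \<partial>lborel)"
      using nn_integral_distr[of "uminus" lborel borel ?g] by simp
    also have "\<dots> = ennreal ((norm (cls (\<lambda>y. f (x + y))))\<^sup>2)"
      by (rule nn_integral_sqint[OF sqint_translate'[OF f]])
    finally show "(\<integral>\<^sup>+y. ennreal ((cmod (f (x - y)))\<^sup>2) \<partial>lborel) \<le> ennreal ((norm (cls (\<lambda>y. f (x + y))))\<^sup>2)"
      by simp
  qed simp_all
  have s3: "(\<lambda>y. ?i y *\<^sub>R f (x - y)) \<in> sqint" by (rule ball_indicator_mult_sqint[OF refl])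
  have eq: "?i y *\<^sub>R ((1/2) *\<^sub>R second_diff f y x) =
      ?i y *\<^sub>R f x - (1/2) *\<^sub>R (?i y *\<^sub>R f (x + y)) - (1/2) *\<^sub>R (?i y *\<^sub>R f (x - y))" for y
    by (simp add: second_diff_def algebra_simps)
  show "(\<lambda>y. ?i y *\<^sub>R ((1/2) *\<^sub>R second_diff f y x)) \<in> sqint"
    unfolding eq by (intro sqint_diff sqint_scaleR s1 s2 s3)
  have "(LINT y|lborel. ?i y *\<^sub>R f (x - y)) = (LINT y|lborel. ?i y *\<^sub>R f (x + y))"
    using integral_uminus[of "\<lambda>y. ?i y *\<^sub>R f (x + y)"] by (simp add: indicator_def)
  moreover have "(LINT y|lborel. ?i y *\<^sub>R ((1/2) *\<^sub>R second_diff f y x)) =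
      (LINT y|lborel. ?i y *\<^sub>R f x) - (1/2) *\<^sub>R (LINT y|lborel. ?i y *\<^sub>R f (x + y))
        - (1/2) *\<^sub>R (LINT y|lborel. ?i y *\<^sub>R f (x - y))"
  proof -
    note i = ball_integrable[OF s1] integrable_scaleR_right[OF ball_integrable[OF s2], of "1/2"]
      integrable_scaleR_right[OF ball_integrable[OF s3], of "1/2"]
    show ?thesis
      unfolding eq Bochner_Integration.integral_diff[OF Bochner_Integration.integrable_diff[OF i(1,2)] i(3)]
        Bochner_Integration.integral_diff[OF i(1,2)] integral_scaleR_right ..
  qed
  ultimately have "(LINT y|lborel. ?i y *\<^sub>R ((1/2) *\<^sub>R second_diff f y x)) =
      (LINT y|lborel. ?i y *\<^sub>R f x) - (LINT y|lborel. ?i y *\<^sub>R f (x + y))"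
    by (simp only: diff_diff_eq) (simp flip: scaleR_add_left)
  moreover have "(LINT y|lborel. ?i y *\<^sub>R f x) = ?V *\<^sub>R f x"
    using emeasure_lborel_cball_finite[of "0::'a" h] by (subst integral_scaleR_left) auto
  ultimately have int: "(LINT y|lborel. ?i y *\<^sub>R ((1/2) *\<^sub>R second_diff f y x)) =
      ?V *\<^sub>R f x - (LINT y|lborel. ?i y *\<^sub>R f (x + y))" by simp
  show "f x - avg h f x = (1 / ?V) *\<^sub>R (LINT y|lborel. ?i y *\<^sub>R ((1/2) *\<^sub>R second_diff f y x))"
    unfolding int avg_def scaleR_diff_right using V by simp
qed

definition second_diff_bound :: "('a::euclidean_space \<Rightarrow> complex) \<Rightarrow> real \<Rightarrow> bool" where
  "second_diff_bound f M \<longleftrightarrow> f \<in> sqint \<and> 0 \<le> M \<and> (\<forall>y. norm (cls (second_diff f y)) \<le> 2 * M * (norm y)\<^sup>2)"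

lemma second_diff_sqint: "f \<in> sqint \<Longrightarrow> second_diff f y \<in> sqint"
  unfolding second_diff_def[abs_def]
  using sqint_translate[of f y] sqint_translate[of f "-y"] by (auto intro!: sqint_diff sqint_scaleR)

lemma cls_second_diff:
  assumes f: "f \<in> sqint"
  shows "cls (second_diff f y) = 2 *\<^sub>R cls f - shift y (cls f) - shift (- y) (cls f)"
proof -
  note s = sqint_scaleR[OF f, of 2] sqint_translate[OF f, of y] sqint_translate[OF f, of "-y"]
  have "second_diff f y = (\<lambda>x. 2 *\<^sub>R f x - f (x + y) - f (x + (- y)))"
    by (simp add: second_diff_def fun_eq_iff)
  then show ?thesis
    by (simp only: cls_diff[OF sqint_diff[OF s(1,2)] s(3)] cls_diff[OF s(1,2)] cls_scaleR[OF f] shift_cls[OF f])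
qed

lemma norm_diff_avg_le:
  assumes "second_diff_bound f M" and h: "h > 0"
  shows "norm (cls (\<lambda>x. f x - avg h f x)) \<le> M * h\<^sup>2"
proof -
  have f: "f \<in> sqint" and M: "0 \<le> M" and bd: "\<And>y. norm (cls (second_diff f y)) \<le> 2 * M * (norm y)\<^sup>2"
    using assms(1) by (auto simp: second_diff_bound_def)
  have [measurable]: "f \<in> borel_measurable borel" by (rule sqint_measurable[OF f])
  have "(\<integral>\<^sup>+x. ennreal ((cmod (f x - avg h f x))\<^sup>2) \<partial>lborel) \<le> ennreal ((M * h\<^sup>2)\<^sup>2)"
    unfolding diff_avg_eq(1)[OF f h]
  proof (rule ball_average_L2_le[OF _ _ h])
    show "(\<lambda>(x, y). (1 / 2) *\<^sub>R second_diff f y x) \<in> borel_measurable (borel \<Otimes>\<^sub>M borel)"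
      unfolding second_diff_def by measurable
    show "(\<lambda>y. indicat_real (cball 0 h) y *\<^sub>R (1 / 2) *\<^sub>R second_diff f y x) \<in> sqint" for x
      by (rule diff_avg_eq(2)[OF f h])
    show "0 \<le> M * h\<^sup>2" using M by simp
    fix y :: 'a assume y: "norm y \<le> h"
    have "norm (cls (\<lambda>x. (1/2) *\<^sub>R second_diff f y x)) \<le> M * (norm y)\<^sup>2"
      using bd[of y] by (simp add: cls_scaleR second_diff_sqint[OF f])
    also have "\<dots> \<le> M * h\<^sup>2" by (intro mult_left_mono power_mono y M) simp
    finally have "(norm (cls (\<lambda>x. (1/2) *\<^sub>R second_diff f y x)))\<^sup>2 \<le> (M * h\<^sup>2)\<^sup>2"
      by (rule power_mono) simp
    then show "(\<integral>\<^sup>+x. ennreal ((cmod ((1 / 2) *\<^sub>R second_diff f y x))\<^sup>2) \<partial>lborel) \<le> ennreal ((M * h\<^sup>2)\<^sup>2)"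
      unfolding nn_integral_sqint[OF sqint_scaleR[OF second_diff_sqint[OF f]]] by (rule ennreal_leI)
  qed
  from sqint_norm_le(2)[OF _ this] M show ?thesis by simp
qed

lemma second_diff_avg:
  assumes f: "f \<in> sqint" shows "second_diff (avg h f) y x = avg h (second_diff f y) x"
proof -
  note s = sqint_scaleR[OF f, of 2] sqint_translate[OF f, of y] sqint_translate[OF f, of "-y"]
  have eq: "second_diff f y = (\<lambda>x. 2 *\<^sub>R f x - f (x + y) - f (x + (- y)))"
    by (simp add: second_diff_def fun_eq_iff)
  show ?thesis
    unfolding eq avg_diff[OF sqint_diff[OF s(1,2)] s(3)] avg_diff[OF s(1,2)] avg_scaleR
    by (simp add: avg_translate[of h f y] avg_translate[of h f "-y", simplified] second_diff_def)
qed

lemma ball_average_sup_le: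
  fixes g :: "'a::euclidean_space \<Rightarrow> complex"
  assumes sq: "(\<lambda>y. indicat_real (cball 0 h) y *\<^sub>R g y) \<in> sqint" and h: "h > 0"
    and bd: "\<And>y. norm y \<le> h \<Longrightarrow> cmod (g y) \<le> B"
  shows "cmod ((1 / measure lborel (cball (0::'a) h)) *\<^sub>R (LINT y|lborel. indicat_real (cball 0 h) y *\<^sub>R g y)) \<le> B"
proof -
  let ?V = "measure lborel (cball (0::'a) h)"
  have V: "?V > 0" using h by simp
  have fin: "integrable lborel (\<lambda>y. indicat_real (cball (0::'a) h) y)"
    using emeasure_lborel_cball_finite[of "0::'a" h] by simp
  have "cmod (LINT y|lborel. indicat_real (cball 0 h) y *\<^sub>R g y) \<le> (LINT y|lborel. B * indicat_real (cball (0::'a) h) y)"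
    by (rule Bochner_Integration.integral_norm_bound_integral[OF ball_integrable[OF sq] integrable_mult_right[OF fin]])
      (use bd in \<open>auto simp: indicator_def\<close>)
  also have "\<dots> = B * ?V" using fin by simp
  finally show ?thesis using V by (simp add: field_simps)
qed

text \<open>A difference of averages is small of second order, and at the same time it is bounded pointwise,
  because each of the two terms into which it is split contains an average, which maps \<open>L\<^sup>2\<close> to bounded
  functions. The average gains the inverse square root of the volume of its ball, and the difference
  gains the square of the radius that belongs to it.\<close>

lemma avg_diff_sup_le:
  fixes f :: "'a::euclidean_space \<Rightarrow> complex"
  assumes "second_diff_bound f M" and h: "h > 0" and k: "k > 0"
  shows "cmod (avg h f x - avg k f x) \<le>
    M * k\<^sup>2 / sqrt (measure lborel (cball (0::'a) h)) + M * h\<^sup>2 / sqrt (measure lborel (cball (0::'a) k))"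
proof -
  let ?V = "\<lambda>h. measure lborel (cball (0::'a) h)"
  have f: "f \<in> sqint" and M: "0 \<le> M" and bd: "\<And>y. norm (cls (second_diff f y)) \<le> 2 * M * (norm y)\<^sup>2"
    using assms(1) by (auto simp: second_diff_bound_def)
  note ah = avg_sqint[OF f h]
  \<comment> \<open>The first term has the second difference of an average, the second one the average of a
    difference.\<close>
  have split: "avg h f x - avg k f x = (avg h f x - avg k (avg h f) x) - avg k (\<lambda>x. f x - avg h f x) x"
    by (simp add: avg_diff[OF f ah])
  have "cmod (avg h f x - avg k (avg h f) x) \<le> M * k\<^sup>2 / sqrt (?V h)"
    unfolding diff_avg_eq(1)[OF ah k]
  proof (rule ball_average_sup_le[OF diff_avg_eq(2)[OF ah k] k])
    fix y :: 'a assume y: "norm y \<le> k"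
    have "cmod (second_diff (avg h f) y x) \<le> norm (cls (second_diff f y)) / sqrt (?V h)"
      unfolding second_diff_avg[OF f] by (rule avg_sup_le[OF second_diff_sqint[OF f] h])
    moreover have "norm (cls (second_diff f y)) / sqrt (?V h) \<le> 2 * M * k\<^sup>2 / sqrt (?V h)"
    proof (rule divide_right_mono)
      have "M * (norm y)\<^sup>2 \<le> M * k\<^sup>2" by (intro mult_left_mono power_mono y M) simp
      then show "norm (cls (second_diff f y)) \<le> 2 * M * k\<^sup>2" using bd[of y] by linarith
    qed simp
    ultimately have "cmod (second_diff (avg h f) y x) \<le> 2 * M * k\<^sup>2 / sqrt (?V h)" by linarith
    moreover have "cmod ((1 / 2) *\<^sub>R second_diff (avg h f) y x) = cmod (second_diff (avg h f) y x) / 2" by simp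
    moreover have "(2 * M * k\<^sup>2 / sqrt (?V h)) / 2 = M * k\<^sup>2 / sqrt (?V h)" by simp
    ultimately show "cmod ((1 / 2) *\<^sub>R second_diff (avg h f) y x) \<le> M * k\<^sup>2 / sqrt (?V h)" by linarith
  qed
  moreover have "cmod (avg k (\<lambda>x. f x - avg h f x) x) \<le> M * h\<^sup>2 / sqrt (?V k)"
    using avg_sup_le[OF sqint_diff[OF f ah] k, of x] norm_diff_avg_le[OF assms(1) h]
    by (meson divide_right_mono order_trans real_sqrt_ge_zero measure_nonneg)
  ultimately show ?thesis unfolding split using norm_triangle_ineq4 by (meson add_mono order_trans)
qed

lemma norm_avg_diff_le:
  assumes "second_diff_bound f M" and h: "h > 0" and k: "k > 0"
  shows "norm (cls (\<lambda>x. avg h f x - avg k f x)) \<le> M * k\<^sup>2 + M * h\<^sup>2"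
proof -
  have f: "f \<in> sqint" using assms(1) by (auto simp: second_diff_bound_def)
  have "cls (\<lambda>x. avg h f x - avg k f x) = cls (\<lambda>x. f x - avg k f x) - cls (\<lambda>x. f x - avg h f x)"
    by (simp add: cls_diff f avg_sqint h k)
  then show ?thesis
    using norm_triangle_ineq4[of "cls (\<lambda>x. f x - avg k f x)" "cls (\<lambda>x. f x - avg h f x)"]
      norm_diff_avg_le[OF assms(1) h] norm_diff_avg_le[OF assms(1) k] by simp
qed

section \<open>Subcritical Sobolev estimate\<close>

text \<open>Interpolation between the supremum norm and the \<open>L\<^sup>2\<close> norm.\<close>

lemma nn_integral_powr_le:
  fixes f :: "'a::euclidean_space \<Rightarrow> complex"
  assumes f: "f \<in> sqint" and S: "\<And>x. cmod (f x) \<le> S" and p: "p > 2"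
  shows "(\<integral>\<^sup>+x. ennreal (cmod (f x) powr p) \<partial>lborel) \<le> ennreal (S powr (p - 2) * (norm (cls f))\<^sup>2)"
proof -
  have [measurable]: "f \<in> borel_measurable borel" by (rule sqint_measurable[OF f])
  have "cmod (f x) powr p \<le> S powr (p - 2) * (cmod (f x))\<^sup>2" for x
  proof -
    have "cmod (f x) powr p = cmod (f x) powr (p - 2) * cmod (f x) powr 2"
      unfolding powr_add[symmetric] by simp
    also have "\<dots> \<le> S powr (p - 2) * cmod (f x) powr 2"
      using S[of x] p by (intro mult_right_mono powr_mono2) auto
    finally show ?thesis using powr_realpow'[of "cmod (f x)" 2] by simp
  qed
  then have "(\<integral>\<^sup>+x. ennreal (cmod (f x) powr p) \<partial>lborel) \<le> (\<integral>\<^sup>+x. ennreal (S powr (p - 2)) * ennreal ((cmod (f x))\<^sup>2) \<partial>lborel)"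
    by (intro nn_integral_mono) (simp add: ennreal_mult[symmetric] ennreal_leI)
  also have "\<dots> = ennreal (S powr (p - 2)) * (\<integral>\<^sup>+x. ennreal ((cmod (f x))\<^sup>2) \<partial>lborel)"
    by (rule nn_integral_cmult) simp
  also have "\<dots> = ennreal (S powr (p - 2) * (norm (cls f))\<^sup>2)"
    by (simp add: nn_integral_sqint[OF f] ennreal_mult)
  finally show ?thesis .
qed

text \<open>This takes the place of Minkowski's inequality in \<open>L\<^sup>p\<close> for summands that decay geometrically: the
  weights \<open>\<theta> powr (- p * j)\<close> cost a part of the decay. With \<open>B\<close> the \<open>p\<close>-th root of the sum on the
  right, each \<open>b j\<close> is at most \<open>\<theta> ^ j * B\<close>.\<close>

lemma sum_powr_le:
  fixes b :: "nat \<Rightarrow> real"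
  assumes b: "\<And>j. 0 \<le> b j" and \<theta>: "0 < \<theta>" "\<theta> < 1" and p: "p > 0"
  shows "(\<Sum>j<m. b j) powr p \<le> (1 / (1 - \<theta>)) powr p * (\<Sum>j<m. \<theta> powr (- p * j) * b j powr p)"
proof -
  define S where "S = (\<Sum>j<m. \<theta> powr (- p * j) * b j powr p)"
  have S: "0 \<le> S" unfolding S_def by (intro sum_nonneg) auto
  have "b j \<le> \<theta> ^ j * S powr (1 / p)" if "j < m" for j
  proof -
    have "\<theta> powr (- p * j) * b j powr p \<le> S"
      unfolding S_def by (rule member_le_sum) (use that in auto)
    then have "(\<theta> powr (- real j) * b j) powr p \<le> S"
      using b[of j] by (simp add: powr_mult powr_powr mult.commute)
    then have "((\<theta> powr (- real j) * b j) powr p) powr (1 / p) \<le> S powr (1 / p)"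
      using p by (intro powr_mono2) auto
    then have "\<theta> powr (- real j) * b j \<le> S powr (1 / p)"
      using p b[of j] by (simp add: powr_powr)
    then have "\<theta> ^ j * (\<theta> powr (- real j) * b j) \<le> \<theta> ^ j * S powr (1 / p)"
      using \<theta> by (intro mult_left_mono) auto
    moreover have "\<theta> ^ j * (\<theta> powr (- real j) * b j) = b j"
      using \<theta> by (simp add: powr_minus powr_realpow)
    ultimately show ?thesis by simp
  qed
  then have "(\<Sum>j<m. b j) \<le> (\<Sum>j<m. \<theta> ^ j) * S powr (1 / p)"
    unfolding sum_distrib_right by (intro sum_mono) auto
  also have "\<dots> \<le> (1 / (1 - \<theta>)) * S powr (1 / p)"
  proof (rule mult_right_mono)
    have "(\<Sum>j<m. \<theta> ^ j) \<le> (\<Sum>j. \<theta> ^ j)"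
      using \<theta> by (intro sum_le_suminf summable_geometric) auto
    then show "(\<Sum>j<m. \<theta> ^ j) \<le> 1 / (1 - \<theta>)" using \<theta> suminf_geometric[of \<theta>] by simp
  qed simp
  finally have "(\<Sum>j<m. b j) powr p \<le> ((1 / (1 - \<theta>)) * S powr (1 / p)) powr p"
    using p b by (intro powr_mono2 sum_nonneg) auto
  also have "\<dots> = (1 / (1 - \<theta>)) powr p * S"
  proof -
    have "((1 / (1 - \<theta>)) * S powr (1 / p)) powr p = (1 / (1 - \<theta>)) powr p * (S powr (1 / p)) powr p"
      by (rule powr_mult)
    then show ?thesis using p S by (simp add: powr_powr)
  qed
  finally show ?thesis unfolding S_def .
qed

lemma L2_null_AE_subseq:
  fixes f :: "nat \<Rightarrow> 'a::euclidean_space \<Rightarrow> complex"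
  assumes f: "\<And>n. f n \<in> sqint" and lim: "(\<lambda>n. norm (cls (f n))) \<longlonglongrightarrow> 0"
  obtains r where "strict_mono (r::nat\<Rightarrow>nat)" "AE x in lborel. (\<lambda>n. f (r n) x) \<longlonglongrightarrow> 0"
proof -
  obtain \<rho> :: "'a \<Rightarrow> real" where \<rho>: "\<rho> \<in> borel_measurable borel" "\<And>x. 0 < \<rho> x" "(\<lambda>x. complex_of_real (\<rho> x)) \<in> sqint"
    by (rule obtain_l2_weight) (rule that)
  note w = weighted_L1_le[OF f \<rho>(3) less_imp_le[OF \<rho>(2)]]
  let ?R = "norm (cls (\<lambda>x. complex_of_real (\<rho> x)))"
  have "(\<lambda>n. LINT x|lborel. norm (\<rho> x * cmod (f n x))) \<longlonglongrightarrow> 0"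
  proof (rule tendsto_sandwich[of "\<lambda>_. 0" _ _ "\<lambda>n. ?R * norm (cls (f n))"])
    show "(\<lambda>n. ?R * norm (cls (f n))) \<longlonglongrightarrow> 0" using tendsto_mult_left[OF lim, of ?R] by simp
    have "norm (\<rho> x * cmod (f n x)) = \<rho> x * cmod (f n x)" for n x using \<rho>(2)[of x] by simp
    then show "\<forall>\<^sub>F n in sequentially. (LINT x|lborel. norm (\<rho> x * cmod (f n x))) \<le> ?R * norm (cls (f n))"
      using w(2) by simp
  qed simp_all
  from tendsto_L1_AE_subseq[OF w(1) this] obtain r where r: "strict_mono (r::nat\<Rightarrow>nat)"
    "AE x in lborel. (\<lambda>n. \<rho> x * cmod (f (r n) x)) \<longlonglongrightarrow> 0" by blast
  have "AE x in lborel. (\<lambda>n. f (r n) x) \<longlonglongrightarrow> 0"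
    using r(2)
  proof eventually_elim
    case (elim x)
    from tendsto_mult_left[OF elim, of "inverse (\<rho> x)"] have "(\<lambda>n. cmod (f (r n) x)) \<longlonglongrightarrow> 0"
      using \<rho>(2)[of x] by (simp add: mult.assoc[symmetric])
    then show ?case by (rule tendsto_norm_zero_cancel)
  qed
  with r(1) show thesis by (rule that)
qed

lemma sqrt_ball_volume:
  assumes "h > 0"
  shows "1 / sqrt (measure lborel (cball (0::'a::euclidean_space) h)) =
    (1 / sqrt (unit_ball_vol DIM('a))) * h powr (- (DIM('a) / 2))"
proof -
  have "sqrt (h ^ DIM('a)) = h powr (DIM('a) / 2)"
  proof -
    have "sqrt (h ^ DIM('a)) = (h powr real DIM('a)) powr (1/2)"
      using assms by (simp add: powr_half_sqrt powr_realpow)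
    then show ?thesis by (simp only: powr_powr) simp
  qed
  moreover have "measure lborel (cball (0::'a) h) = unit_ball_vol DIM('a) * h ^ DIM('a)"
    using assms by (intro content_cball) simp
  ultimately show ?thesis
    unfolding powr_minus_divide by (simp only: real_sqrt_mult times_divide_times_eq mult_1)
qed

definition dyadic_avg :: "nat \<Rightarrow> ('a::euclidean_space \<Rightarrow> complex) \<Rightarrow> 'a \<Rightarrow> complex" where
  "dyadic_avg j = avg ((1/2) ^ j)"

text \<open>From scale \<open>2\<^sup>-\<^sup>j\<close> to the next, the supremum norm of the increment is of order
  \<open>2 powr (j * (N / 2 - 2))\<close> and its \<open>L\<^sup>2\<close> norm is of order \<open>2 powr (- 2 * j)\<close>. The exponent of \<open>2\<close> in
  the conclusion is what interpolation makes of them.\<close>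

lemma dyadic_step_powr:
  fixes p :: real
  assumes p: "p > 2"
  obtains K where "K \<ge> 0" "\<And>(f :: 'a::euclidean_space \<Rightarrow> complex) M j. second_diff_bound f M \<Longrightarrow>
    (\<integral>\<^sup>+x. ennreal (cmod (dyadic_avg (Suc j) f x - dyadic_avg j f x) powr p) \<partial>lborel)
      \<le> ennreal (K * M powr p * (2 powr ((DIM('a) / 2 - 2) * (p - 2) - 4)) ^ j)"
proof -
  define N where "N = real DIM('a)"
  define c where "c = 1 / sqrt (unit_ball_vol N)"
  define C where "C = c * (2 powr (N / 2) + 1)"
  have "c \<ge> 0" by (simp add: c_def N_def)
  then have C: "C \<ge> 0" by (simp add: C_def)
  define K where "K = C powr (p - 2) * 4"
  have "(\<integral>\<^sup>+x. ennreal (cmod (dyadic_avg (Suc j) f x - dyadic_avg j f x) powr p) \<partial>lborel)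
      \<le> ennreal (K * M powr p * (2 powr ((DIM('a) / 2 - 2) * (p - 2) - 4)) ^ j)"
    if fM: "second_diff_bound f M" for f :: "'a \<Rightarrow> complex" and M j
  proof -
    have f: "f \<in> sqint" and M: "0 \<le> M" using fM by (auto simp: second_diff_bound_def)
    define h k where "h = (1/2::real) ^ Suc j" and "k = (1/2::real) ^ j"
    have hk: "h > 0" "k > 0" "h = k / 2" by (simp_all add: h_def k_def)
    have kp: "k = 2 powr (- real j)"
      unfolding k_def powr_minus_divide by (simp add: powr_realpow power_one_over)
    have sup: "cmod (avg h f x - avg k f x) \<le> C * M * 2 powr (j * (N / 2 - 2))" for x
    proof -
      have vk: "1 / sqrt (measure lborel (cball (0::'a) k)) = c * 2 powr (j * (N / 2))"
        unfolding sqrt_ball_volume[OF hk(2)] unfolding kp powr_powr by (simp add: c_def N_def)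
      have vh: "1 / sqrt (measure lborel (cball (0::'a) h)) = c * (2 powr (N / 2) * 2 powr (j * (N / 2)))"
      proof -
        have "h = 2 powr (- (real j + 1))" using hk(3) by (simp add: kp powr_diff)
        then show ?thesis
        proof -
          have "(- (real j + 1)) * (- (DIM('a) / 2)) = N / 2 + j * (N / 2)"
            by (simp add: N_def field_simps)
          then show ?thesis
            unfolding sqrt_ball_volume[OF hk(1)] unfolding \<open>h = 2 powr (- (real j + 1))\<close> powr_powr
            by (simp add: c_def N_def powr_add)
        qed
      qed
      have k2: "k\<^sup>2 = 2 powr (- 2 * real j)"
        using powr_realpow[OF hk(2), of 2] unfolding kp powr_powr by (simp add: mult.commute)
      have "cmod (avg h f x - avg k f x) \<le> M * k\<^sup>2 * (1 / sqrt (measure lborel (cball (0::'a) h)))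
           + M * h\<^sup>2 * (1 / sqrt (measure lborel (cball (0::'a) k)))"
        using avg_diff_sup_le[OF fM hk(1,2), of x] by simp
      also have "\<dots> \<le> M * k\<^sup>2 * (1 / sqrt (measure lborel (cball (0::'a) h)))
           + M * k\<^sup>2 * (1 / sqrt (measure lborel (cball (0::'a) k)))"
        using M hk by (intro add_left_mono mult_right_mono mult_left_mono power_mono) auto
      also have "\<dots> = C * M * (k\<^sup>2 * 2 powr (j * (N / 2)))"
        unfolding vk vh C_def by (simp add: algebra_simps)
      also have "k\<^sup>2 * 2 powr (j * (N / 2)) = 2 powr (j * (N / 2 - 2))"
        by (simp add: k2 powr_add[symmetric] algebra_simps)
      finally show ?thesis .
    qed
    have l2: "(norm (cls (\<lambda>x. avg h f x - avg k f x)))\<^sup>2 \<le> (2 * M * k\<^sup>2)\<^sup>2"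
    proof (rule power_mono)
      have "M * h\<^sup>2 \<le> M * k\<^sup>2" using M hk by (intro mult_left_mono power_mono) auto
      then show "norm (cls (\<lambda>x. avg h f x - avg k f x)) \<le> 2 * M * k\<^sup>2"
        using norm_avg_diff_le[OF fM hk(1,2)] by linarith
    qed simp
    have "(\<integral>\<^sup>+x. ennreal (cmod (avg h f x - avg k f x) powr p) \<partial>lborel) \<le>
        ennreal ((C * M * 2 powr (j * (N / 2 - 2))) powr (p - 2) * (norm (cls (\<lambda>x. avg h f x - avg k f x)))\<^sup>2)"
      by (rule nn_integral_powr_le[OF sqint_diff[OF avg_sqint[OF f hk(1)] avg_sqint[OF f hk(2)]] sup p])
    also have "\<dots> \<le> ennreal ((C * M * 2 powr (j * (N / 2 - 2))) powr (p - 2) * (2 * M * k\<^sup>2)\<^sup>2)"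
      by (intro ennreal_leI mult_left_mono l2) simp
    also have "(C * M * 2 powr (j * (N / 2 - 2))) powr (p - 2) * (2 * M * k\<^sup>2)\<^sup>2 =
        K * M powr p * (2 powr ((N / 2 - 2) * (p - 2) - 4)) ^ j"
    proof -
      have M2: "M powr (p - 2) * M\<^sup>2 = M powr p"
      proof (cases "M = 0")
        case False
        then have "M\<^sup>2 = M powr 2" using M powr_realpow[of M 2] by simp
        then show ?thesis by (simp only: powr_add[symmetric]) simp
      qed (use p in simp)
      have k4: "(k\<^sup>2)\<^sup>2 = 2 powr (- 4 * real j)"
        using powr_realpow[OF hk(2), of 4] unfolding kp powr_powr by (simp add: mult.commute flip: power_mult)
      have "(C * M * 2 powr (j * (N / 2 - 2))) powr (p - 2) * (2 * M * k\<^sup>2)\<^sup>2 =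
         (C powr (p - 2) * 4) * (M powr (p - 2) * M\<^sup>2) * (2 powr (j * (N / 2 - 2) * (p - 2)) * (k\<^sup>2)\<^sup>2)"
        using C M by (simp add: powr_mult powr_powr power_mult_distrib)
      also have "2 powr (j * (N / 2 - 2) * (p - 2)) * (k\<^sup>2)\<^sup>2 = (2 powr ((N / 2 - 2) * (p - 2) - 4)) ^ j"
      proof -
        have "(2 powr ((N / 2 - 2) * (p - 2) - 4)) ^ j = (2 powr ((N / 2 - 2) * (p - 2) - 4)) powr real j"
          by (rule powr_realpow[symmetric]) simp
        then show ?thesis unfolding k4 powr_powr powr_add[symmetric] by (simp add: algebra_simps)
      qed
      finally show ?thesis by (simp add: M2 K_def)
    qed
    finally show ?thesis by (simp add: dyadic_avg_def h_def k_def N_def)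
  qed
  moreover have "K \<ge> 0" by (simp add: K_def)
  ultimately show thesis by (rule that[rotated])
qed

lemma dyadic_avg_sqint: "f \<in> sqint \<Longrightarrow> dyadic_avg j f \<in> sqint"
  by (simp add: dyadic_avg_def avg_sqint)

text \<open>Subcriticality says precisely that the increments decay geometrically in \<open>L\<^sup>p\<close>. The bound carries the
  factor \<open>s ^ J\<close>: functions with bounded second differences are uniformly close in \<open>L\<^sup>p\<close> to
  their averages, which gives the Sobolev embedding and also the nonvanishing of minimizing
  sequences.\<close>

theorem dyadic_sobolev:
  fixes p :: real
  assumes p: "p > 2" and sub: "(real DIM('a::euclidean_space) - 4) * (p - 2) < 8"
  obtains C s where "0 \<le> C" "0 < s" "s < 1"
    "\<And>(f :: 'a \<Rightarrow> complex) M J. second_diff_bound f M \<Longrightarrow>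
      (\<integral>\<^sup>+x. ennreal (cmod (f x - dyadic_avg J f x) powr p) \<partial>lborel) \<le> ennreal (C * M powr p * s ^ J)"
proof -
  obtain K where K: "K \<ge> 0" "\<And>(f :: 'a \<Rightarrow> complex) M j. second_diff_bound f M \<Longrightarrow>
    (\<integral>\<^sup>+x. ennreal (cmod (dyadic_avg (Suc j) f x - dyadic_avg j f x) powr p) \<partial>lborel)
      \<le> ennreal (K * M powr p * (2 powr ((DIM('a) / 2 - 2) * (p - 2) - 4)) ^ j)"
    by (rule dyadic_step_powr[OF p, where 'a = 'a]) (rule that)
  define q where "q = 2 powr ((DIM('a) / 2 - 2) * (p - 2) - 4)"
  have "(DIM('a) / 2 - 2) * (p - 2) - 4 < 0" using sub by (simp add: algebra_simps)
  then have q: "0 < q" "q < 1" using powr_less_mono[of "(DIM('a) / 2 - 2) * (p - 2) - 4" 0 2] by (auto simp: q_def)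
  \<comment> \<open>Half of the geometric decay pays for the summation of the increments.\<close>
  define s where "s = sqrt q"
  define \<theta> where "\<theta> = q powr (1 / (2 * p))"
  have s: "0 < s" "s < 1" using q by (auto simp: s_def)
  have \<theta>: "0 < \<theta>" "\<theta> < 1"
    using q p powr_less_mono2[of "1 / (2 * p)" q 1] by (auto simp: \<theta>_def)
  have \<theta>p: "\<theta> powr (- p * j) * q ^ j = s ^ j" for j :: nat
  proof -
    have "\<theta> powr (- p * j) * q ^ j = q powr (- (j / 2)) * q powr j"
      using q p by (simp add: \<theta>_def powr_powr powr_realpow)
    also have "\<dots> = q powr (j / 2)" by (simp flip: powr_add)
    also have "\<dots> = s ^ j" using q by (simp add: s_def powr_half_sqrt_powr powr_realpow real_sqrt_power)
    finally show ?thesis .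
  qed
  define C where "C = (1 / (1 - \<theta>)) powr p * K * (1 / (1 - s))"
  have C: "C \<ge> 0" using K(1) s by (simp add: C_def)
  have "(\<integral>\<^sup>+x. ennreal (cmod (f x - dyadic_avg J f x) powr p) \<partial>lborel) \<le> ennreal (C * M powr p * s ^ J)"
    if fM: "second_diff_bound f M" for f :: "'a \<Rightarrow> complex" and M J
  proof -
    have f: "f \<in> sqint" and M: "0 \<le> M" using fM by (auto simp: second_diff_bound_def)
    define g where "g j x = dyadic_avg (Suc j) f x - dyadic_avg j f x" for j x
    have gs: "g j \<in> sqint" for j unfolding g_def[abs_def] by (intro sqint_diff dyadic_avg_sqint f)
    have [measurable]: "g j \<in> borel_measurable borel" "f \<in> borel_measurable borel"
      "dyadic_avg j f \<in> borel_measurable borel" for j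
      using gs f dyadic_avg_sqint[OF f] sqint_measurable by auto
    have partial: "(\<integral>\<^sup>+x. ennreal (cmod (dyadic_avg (J + m) f x - dyadic_avg J f x) powr p) \<partial>lborel)
        \<le> ennreal (C * M powr p * s ^ J)" for m
    proof -
      have tele: "dyadic_avg (J + m) f x - dyadic_avg J f x = (\<Sum>j<m. g (J + j) x)" for x
        using sum_lessThan_telescope[of "\<lambda>j. dyadic_avg (J + j) f x" m] by (simp add: g_def)
      have pt: "cmod (dyadic_avg (J + m) f x - dyadic_avg J f x) powr p \<le>
          (1 / (1 - \<theta>)) powr p * (\<Sum>j<m. \<theta> powr (- p * j) * cmod (g (J + j) x) powr p)" for x
      proof -
        have "cmod (dyadic_avg (J + m) f x - dyadic_avg J f x) powr p \<le> (\<Sum>j<m. cmod (g (J + j) x)) powr p"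
          unfolding tele using p by (intro powr_mono2 norm_sum) auto
        also have "\<dots> \<le> (1 / (1 - \<theta>)) powr p * (\<Sum>j<m. \<theta> powr (- p * j) * cmod (g (J + j) x) powr p)"
          by (rule sum_powr_le) (use \<theta> p in auto)
        finally show ?thesis .
      qed
      have "(\<integral>\<^sup>+x. ennreal (cmod (dyadic_avg (J + m) f x - dyadic_avg J f x) powr p) \<partial>lborel) \<le>
          (\<integral>\<^sup>+x. ennreal ((1 / (1 - \<theta>)) powr p) * (\<Sum>j<m. ennreal (\<theta> powr (- p * j)) * ennreal (cmod (g (J + j) x) powr p)) \<partial>lborel)"
      proof (intro nn_integral_mono)
        fix x :: 'a
        have "(\<Sum>j<m. ennreal (\<theta> powr (- p * j)) * ennreal (cmod (g (J + j) x) powr p)) =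
            (\<Sum>j<m. ennreal (\<theta> powr (- p * j) * cmod (g (J + j) x) powr p))"
          by (intro sum.cong refl) (simp add: ennreal_mult)
        also have "\<dots> = ennreal (\<Sum>j<m. \<theta> powr (- p * j) * cmod (g (J + j) x) powr p)"
          by (rule sum_ennreal) simp
        finally show "ennreal (cmod (dyadic_avg (J + m) f x - dyadic_avg J f x) powr p) \<le>
            ennreal ((1 / (1 - \<theta>)) powr p) * (\<Sum>j<m. ennreal (\<theta> powr (- p * j)) * ennreal (cmod (g (J + j) x) powr p))"
          using ennreal_leI[OF pt[of x]]
          by (simp only: ennreal_mult[OF powr_ge_zero sum_nonneg[OF mult_nonneg_nonneg[OF powr_ge_zero powr_ge_zero]]])
      qed
      also have "\<dots> = ennreal ((1 / (1 - \<theta>)) powr p) *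
          (\<Sum>j<m. ennreal (\<theta> powr (- p * j)) * (\<integral>\<^sup>+x. ennreal (cmod (g (J + j) x) powr p) \<partial>lborel))"
        by (subst nn_integral_cmult, simp, subst nn_integral_sum, simp, subst nn_integral_cmult, simp_all)
      also have "\<dots> \<le> ennreal ((1 / (1 - \<theta>)) powr p) *
          (\<Sum>j<m. ennreal (\<theta> powr (- p * j)) * ennreal (K * M powr p * q ^ (J + j)))"
        unfolding g_def q_def by (intro mult_left_mono sum_mono K(2)[OF fM]) auto
      also have "\<dots> = ennreal ((1 / (1 - \<theta>)) powr p * (\<Sum>j<m. \<theta> powr (- p * j) * (K * M powr p * q ^ (J + j))))"
      proof -
        have nn: "0 \<le> K * M powr p * q ^ (J + j)" for j using K(1) q by simp
        have "(\<Sum>j<m. ennreal (\<theta> powr (- p * j)) * ennreal (K * M powr p * q ^ (J + j))) =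
            (\<Sum>j<m. ennreal (\<theta> powr (- p * j) * (K * M powr p * q ^ (J + j))))"
          by (intro sum.cong refl ennreal_mult[symmetric] nn) simp
        also have "\<dots> = ennreal (\<Sum>j<m. \<theta> powr (- p * j) * (K * M powr p * q ^ (J + j)))"
          by (intro sum_ennreal mult_nonneg_nonneg powr_ge_zero nn)
        finally show ?thesis
          by (simp only: ennreal_mult[OF powr_ge_zero sum_nonneg[OF mult_nonneg_nonneg[OF powr_ge_zero nn]]])
      qed
      also have "\<dots> \<le> ennreal (C * M powr p * s ^ J)"
      proof (rule ennreal_leI)
        have "(\<Sum>j<m. \<theta> powr (- p * j) * (K * M powr p * q ^ (J + j))) = K * M powr p * q ^ J * (\<Sum>j<m. s ^ j)"
          unfolding sum_distrib_left \<theta>p[symmetric] by (simp add: power_add algebra_simps)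
        also have "\<dots> \<le> K * M powr p * s ^ J * (1 / (1 - s))"
        proof (rule mult_mono)
          have "q \<le> s" using q unfolding s_def by (intro real_le_rsqrt) (simp add: power2_eq_square)
          then show "K * M powr p * q ^ J \<le> K * M powr p * s ^ J"
            using q K(1) by (intro mult_left_mono power_mono) auto
          have "(\<Sum>j<m. s ^ j) \<le> (\<Sum>j. s ^ j)"
            using s by (intro sum_le_suminf summable_geometric) auto
          then show "(\<Sum>j<m. s ^ j) \<le> 1 / (1 - s)" using s suminf_geometric[of s] by simp
        qed (use K(1) s in \<open>auto intro: sum_nonneg\<close>)
        finally have "(1 / (1 - \<theta>)) powr p * (\<Sum>j<m. \<theta> powr (- p * j) * (K * M powr p * q ^ (J + j)))
            \<le> (1 / (1 - \<theta>)) powr p * (K * M powr p * s ^ J * (1 / (1 - s)))"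
          by (rule mult_left_mono) simp
        also have "\<dots> = C * M powr p * s ^ J" by (simp add: C_def)
        finally show "(1 / (1 - \<theta>)) powr p * (\<Sum>j<m. \<theta> powr (- p * j) * (K * M powr p * q ^ (J + j))) \<le> C * M powr p * s ^ J" .
      qed
      finally show ?thesis .
    qed
    have "(\<lambda>m. norm (cls (\<lambda>x. f x - dyadic_avg (J + m) f x))) \<longlonglongrightarrow> 0"
    proof (rule tendsto_sandwich[of "\<lambda>_. 0" _ _ "\<lambda>m. M * ((1/2) ^ (J + m))\<^sup>2"])
      show "(\<lambda>m. M * ((1/2) ^ (J + m))\<^sup>2) \<longlonglongrightarrow> 0"
      proof -
        have "(\<lambda>m. M * ((1/2) ^ J)\<^sup>2 * (1/4 :: real) ^ m) \<longlonglongrightarrow> M * ((1/2) ^ J)\<^sup>2 * 0"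
          by (intro tendsto_mult_left LIMSEQ_power_zero) simp
        moreover have "((1/2 :: real) ^ m)\<^sup>2 = (1/4) ^ m" for m
          by (simp add: power2_eq_square flip: power_mult_distrib)
        ultimately show ?thesis by (simp add: power_add power_mult_distrib mult.assoc)
      qed
      show "\<forall>\<^sub>F m in sequentially. norm (cls (\<lambda>x. f x - dyadic_avg (J + m) f x)) \<le> M * ((1/2) ^ (J + m))\<^sup>2"
        unfolding dyadic_avg_def by (intro always_eventually allI norm_diff_avg_le[OF fM]) simp
    qed simp_all
    then obtain r where r: "strict_mono (r::nat\<Rightarrow>nat)" "AE x in lborel. (\<lambda>m. f x - dyadic_avg (J + r m) f x) \<longlonglongrightarrow> 0"
      by (rule L2_null_AE_subseq[rotated]) (auto intro: sqint_diff dyadic_avg_sqint f)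
    show ?thesis
    proof (rule nn_integral_liminf_le[where g = "\<lambda>m x. cmod (dyadic_avg (J + r m) f x - dyadic_avg J f x) powr p" and N = 0])
      show "AE x in lborel. (\<lambda>m. cmod (dyadic_avg (J + r m) f x - dyadic_avg J f x) powr p) \<longlonglongrightarrow> cmod (f x - dyadic_avg J f x) powr p"
        using r(2)
      proof eventually_elim
        case (elim x)
        from tendsto_diff[OF tendsto_const[of "f x"] elim]
        have "(\<lambda>m. dyadic_avg (J + r m) f x) \<longlonglongrightarrow> f x" by simp
        then show ?case using p by (intro tendsto_powr' tendsto_intros) auto
      qed
    qed (use partial in auto)
  qed
  with C s show thesis by (rule that)
qed

section \<open>Sobolev embedding for classes with two weak derivatives\<close>

definition powr_int :: "real \<Rightarrow> 'a::euclidean_space l2 \<Rightarrow> real" where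
  "powr_int p u = (LINT x|lborel. cmod (rep u x) powr p)"

lemma powr_add_le:
  fixes a b p :: real
  assumes "0 \<le> a" "0 \<le> b" "0 \<le> p"
  shows "(a + b) powr p \<le> 2 powr p * (a powr p + b powr p)"
proof -
  have "(a + b) powr p \<le> (2 * max a b) powr p" using assms by (intro powr_mono2) auto
  also have "\<dots> = 2 powr p * max a b powr p" by (rule powr_mult)
  also have "\<dots> \<le> 2 powr p * (a powr p + b powr p)"
    by (intro mult_left_mono) (auto simp: max_def)
  finally show ?thesis .
qed

definition hess_const :: "'a::euclidean_space itself \<Rightarrow> real" where
  "hess_const _ = real DIM('a) * real DIM('a) * sqrt (3 / 2) / 2"

lemma second_diff_bound_energy:
  fixes u :: "'a::euclidean_space l2"
  assumes u: "u \<in> H2cls"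
  shows "second_diff_bound (rep u) (hess_const TYPE('a) * sqrt (energy u))"
  unfolding second_diff_bound_def
proof (intro conjI allI)
  show "0 \<le> hess_const TYPE('a) * sqrt (energy u)" by (simp add: hess_const_def energy_nonneg)
  fix y :: 'a
  have "norm (cls (second_diff (rep u) y)) \<le> (norm y)\<^sup>2 * (\<Sum>a\<in>Basis. \<Sum>b\<in>Basis. norm (wd [a, b] u))"
    using second_difference_le[OF u, of y] by (simp add: cls_second_diff)
  also have "\<dots> \<le> (norm y)\<^sup>2 * (\<Sum>a\<in>(Basis::'a set). \<Sum>b\<in>(Basis::'a set). sqrt (3 / 2 * energy u))"
    by (intro mult_left_mono sum_mono wd_le_energy u) auto
  also have "\<dots> = 2 * (hess_const TYPE('a) * sqrt (energy u)) * (norm y)\<^sup>2"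
    by (simp add: hess_const_def real_sqrt_mult[of "3 / 2", simplified])
  finally show "norm (cls (second_diff (rep u) y)) \<le> 2 * (hess_const TYPE('a) * sqrt (energy u)) * (norm y)\<^sup>2" .
qed simp

lemma norm_le_energy: "norm u \<le> sqrt (energy u)"
  by (rule real_le_rsqrt) (simp add: energy_def)

lemma norm_dyadic_avg_le:
  fixes u :: "'a::euclidean_space l2"
  assumes u: "u \<in> H2cls"
  shows "norm (cls (dyadic_avg J (rep u))) \<le> (1 + hess_const TYPE('a)) * sqrt (energy u)"
proof -
  let ?M = "hess_const TYPE('a) * sqrt (energy u)"
  have M: "?M \<ge> 0" by (simp add: hess_const_def energy_nonneg)
  have "norm (cls (\<lambda>x. rep u x - dyadic_avg J (rep u) x)) \<le> ?M * ((1/2) ^ J)\<^sup>2"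
    unfolding dyadic_avg_def by (rule norm_diff_avg_le[OF second_diff_bound_energy[OF u]]) simp
  also have "\<dots> \<le> ?M * 1" by (intro mult_left_mono M) (simp add: power_le_one)
  finally have "norm (u - cls (dyadic_avg J (rep u))) \<le> ?M"
    by (simp add: cls_diff dyadic_avg_sqint)
  then show ?thesis
    using norm_le_energy[of u] norm_triangle_ineq2[of "cls (dyadic_avg J (rep u))" u]
    by (simp add: norm_minus_commute algebra_simps)
qed

lemma nn_integral_powr_le_split:
  fixes f g :: "'a::euclidean_space \<Rightarrow> complex"
  assumes [measurable]: "f \<in> borel_measurable borel" "g \<in> borel_measurable borel" and p: "p > 0"
  shows "(\<integral>\<^sup>+x. ennreal (cmod (f x) powr p) \<partial>lborel) \<le>
    ennreal (2 powr p) * ((\<integral>\<^sup>+x. ennreal (cmod (f x - g x) powr p) \<partial>lborel) + (\<integral>\<^sup>+x. ennreal (cmod (g x) powr p) \<partial>lborel))"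
proof -
  have "ennreal (cmod (f x) powr p) \<le> ennreal (2 powr p) * (ennreal (cmod (f x - g x) powr p) + ennreal (cmod (g x) powr p))" for x
  proof -
    have "cmod (f x) powr p \<le> (cmod (f x - g x) + cmod (g x)) powr p"
      using p norm_triangle_ineq[of "f x - g x" "g x"] by (intro powr_mono2) auto
    also have "\<dots> \<le> 2 powr p * (cmod (f x - g x) powr p + cmod (g x) powr p)"
      using p by (intro powr_add_le) auto
    finally have "ennreal (cmod (f x) powr p) \<le> ennreal (2 powr p * (cmod (f x - g x) powr p + cmod (g x) powr p))"
      by (rule ennreal_leI)
    then show ?thesis by (simp add: ennreal_mult)
  qed
  then have "(\<integral>\<^sup>+x. ennreal (cmod (f x) powr p) \<partial>lborel) \<le>
      (\<integral>\<^sup>+x. ennreal (2 powr p) * (ennreal (cmod (f x - g x) powr p) + ennreal (cmod (g x) powr p)) \<partial>lborel)"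
    by (rule nn_integral_mono)
  also have "\<dots> = ennreal (2 powr p) * ((\<integral>\<^sup>+x. ennreal (cmod (f x - g x) powr p) \<partial>lborel) + (\<integral>\<^sup>+x. ennreal (cmod (g x) powr p) \<partial>lborel))"
    by (subst nn_integral_cmult, simp, subst nn_integral_add, simp_all)
  finally show ?thesis .
qed

text \<open>For \<open>p = 2 * \<sigma> + 2\<close> and dimension \<open>N\<close> this reads \<open>\<sigma> > 0\<close> and \<open>(N - 4) * \<sigma> < 4\<close>.\<close>

definition subcritical :: "'a::euclidean_space itself \<Rightarrow> real \<Rightarrow> bool" where
  "subcritical _ p \<longleftrightarrow> p > 2 \<and> (real DIM('a) - 4) * (p - 2) < 8"

lemma obtain_sobolev:
  fixes p :: real
  assumes p: "subcritical TYPE('a::euclidean_space) p"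
  obtains C s where "0 \<le> C" "0 < s" "s < 1"
    "\<And>(u :: 'a l2) J. u \<in> H2cls \<Longrightarrow>
      (\<integral>\<^sup>+x. ennreal (cmod (rep u x - dyadic_avg J (rep u) x) powr p) \<partial>lborel) \<le> ennreal (C * energy u powr (p / 2) * s ^ J)"
proof -
  obtain C s where C: "0 \<le> C" "0 < s" "s < 1"
    "\<And>(f :: 'a \<Rightarrow> complex) M J. second_diff_bound f M \<Longrightarrow>
      (\<integral>\<^sup>+x. ennreal (cmod (f x - dyadic_avg J f x) powr p) \<partial>lborel) \<le> ennreal (C * M powr p * s ^ J)"
    by (rule dyadic_sobolev[where p = p and 'a = 'a]) (use p in \<open>auto simp: subcritical_def intro: that\<close>)
  let ?C = "C * hess_const TYPE('a) powr p"
  have "(\<integral>\<^sup>+x. ennreal (cmod (rep u x - dyadic_avg J (rep u) x) powr p) \<partial>lborel) \<le> ennreal (?C * energy u powr (p / 2) * s ^ J)"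
    if u: "u \<in> H2cls" for u :: "'a l2" and J
  proof -
    have "(hess_const TYPE('a) * sqrt (energy u)) powr p = hess_const TYPE('a) powr p * energy u powr (p / 2)"
      by (simp add: powr_mult powr_half_sqrt[symmetric] powr_powr energy_nonneg)
    then show ?thesis using C(4)[OF second_diff_bound_energy[OF u], of J] by (simp add: mult.assoc)
  qed
  moreover have "0 \<le> ?C" using C(1) by simp
  ultimately show thesis using that[of ?C s] C(2,3) by blast
qed

lemma nn_integral_dyadic_avg_powr_le:
  fixes u :: "'a::euclidean_space l2"
  assumes u: "u \<in> H2cls" and p: "p > 2" and S: "\<And>x. cmod (dyadic_avg J (rep u) x) \<le> S"
  shows "(\<integral>\<^sup>+x. ennreal (cmod (dyadic_avg J (rep u) x) powr p) \<partial>lborel) \<le>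
    ennreal (S powr (p - 2) * ((1 + hess_const TYPE('a))\<^sup>2 * energy u))"
proof -
  have "(norm (cls (dyadic_avg J (rep u))))\<^sup>2 \<le> ((1 + hess_const TYPE('a)) * sqrt (energy u))\<^sup>2"
    by (intro power_mono norm_dyadic_avg_le u) simp
  also have "\<dots> = (1 + hess_const TYPE('a))\<^sup>2 * energy u"
    by (simp add: power_mult_distrib energy_nonneg)
  finally have "S powr (p - 2) * (norm (cls (dyadic_avg J (rep u))))\<^sup>2 \<le> S powr (p - 2) * ((1 + hess_const TYPE('a))\<^sup>2 * energy u)"
    by (intro mult_left_mono) auto
  then show ?thesis
    using nn_integral_powr_le[OF dyadic_avg_sqint[OF rep_sqint] S p] by (meson ennreal_leI order_trans)
qed

lemma dyadic_avg_measurable [measurable]: "dyadic_avg J (rep u) \<in> borel_measurable borel"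
  by (rule sqint_measurable[OF dyadic_avg_sqint[OF rep_sqint]])

lemma sobolev_embedding:
  fixes p :: real
  assumes p: "subcritical TYPE('a::euclidean_space) p"
  obtains C where "0 \<le> C"
    "\<And>u :: 'a l2. u \<in> H2cls \<Longrightarrow> (\<integral>\<^sup>+x. ennreal (cmod (rep u x) powr p) \<partial>lborel) \<le> ennreal (C * energy u powr (p / 2))"
proof -
  obtain C s where C: "0 \<le> C" "0 < s" "s < 1"
    "\<And>(u :: 'a l2) J. u \<in> H2cls \<Longrightarrow>
      (\<integral>\<^sup>+x. ennreal (cmod (rep u x - dyadic_avg J (rep u) x) powr p) \<partial>lborel) \<le> ennreal (C * energy u powr (p / 2) * s ^ J)"
    by (rule obtain_sobolev[OF p]) (rule that)
  have p2: "p > 2" using p by (simp add: subcritical_def)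
  define \<kappa> where "\<kappa> = hess_const TYPE('a)"
  define c where "c = 1 / sqrt (measure lborel (cball (0::'a) 1))"
  define D where "D = c powr (p - 2) * (1 + \<kappa>)\<^sup>2"
  define C' where "C' = 2 powr p * (C + D)"
  have D: "D \<ge> 0" by (simp add: D_def)
  have "(\<integral>\<^sup>+x. ennreal (cmod (rep u x) powr p) \<partial>lborel) \<le> ennreal (C' * energy u powr (p / 2))"
    if u: "u \<in> H2cls" for u :: "'a l2"
  proof -
    let ?E = "energy u"
    have sup: "cmod (dyadic_avg 0 (rep u) x) \<le> c * sqrt ?E" for x
    proof -
      have "cmod (dyadic_avg 0 (rep u) x) \<le> norm u * c"
        using avg_sup_le[OF rep_sqint[of u], of 1 x] by (simp add: dyadic_avg_def c_def)
      also have "\<dots> \<le> sqrt ?E * c" by (intro mult_right_mono norm_le_energy) (simp add: c_def)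
      finally show ?thesis by (simp add: mult.commute)
    qed
    have pw: "(c * sqrt ?E) powr (p - 2) * ((1 + \<kappa>)\<^sup>2 * ?E) = D * ?E powr (p / 2)"
    proof -
      have "(c * sqrt ?E) powr (p - 2) = c powr (p - 2) * ?E powr ((p - 2) / 2)"
        by (simp add: powr_mult powr_half_sqrt[symmetric] powr_powr energy_nonneg)
      moreover have "?E powr ((p - 2) / 2) * ?E = ?E powr (p / 2)"
      proof (cases "?E = 0")
        case False
        then have "?E = ?E powr 1" using energy_nonneg[of u] by simp
        then have "?E powr ((p - 2) / 2) * ?E = ?E powr ((p - 2) / 2) * ?E powr 1" by simp
        also have "\<dots> = ?E powr ((p - 2) / 2 + 1)" by (rule powr_add[symmetric])
        also have "(p - 2) / 2 + 1 = p / 2" by (simp add: field_simps)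
        finally show ?thesis .
      qed (use p2 in simp)
      ultimately show ?thesis by (simp add: D_def mult.assoc mult.left_commute)
    qed
    have "(\<integral>\<^sup>+x. ennreal (cmod (rep u x) powr p) \<partial>lborel) \<le>
      ennreal (2 powr p) * ((\<integral>\<^sup>+x. ennreal (cmod (rep u x - dyadic_avg 0 (rep u) x) powr p) \<partial>lborel)
        + (\<integral>\<^sup>+x. ennreal (cmod (dyadic_avg 0 (rep u) x) powr p) \<partial>lborel))"
      by (rule nn_integral_powr_le_split) (use p2 in auto)
    also have "\<dots> \<le> ennreal (2 powr p) * (ennreal (C * ?E powr (p / 2)) + ennreal (D * ?E powr (p / 2)))"
      using C(4)[OF u, of 0] nn_integral_dyadic_avg_powr_le[OF u p2 sup]
      by (intro mult_left_mono add_mono) (auto simp: pw \<kappa>_def[symmetric])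
    also have "\<dots> = ennreal (C' * ?E powr (p / 2))"
      using C(1) D by (simp add: C'_def ennreal_mult[symmetric] ennreal_plus[symmetric] algebra_simps del: ennreal_plus)
    finally show ?thesis .
  qed
  moreover have "C' \<ge> 0" using C(1) D by (simp add: C'_def)
  ultimately show thesis by (rule that[rotated])
qed

lemma powr_integrable:
  fixes u :: "'a::euclidean_space l2"
  assumes p: "subcritical TYPE('a) p" and u: "u \<in> H2cls"
  shows "integrable lborel (\<lambda>x. cmod (rep u x) powr p)"
proof -
  obtain C where "0 \<le> C"
    "\<And>u :: 'a l2. u \<in> H2cls \<Longrightarrow> (\<integral>\<^sup>+x. ennreal (cmod (rep u x) powr p) \<partial>lborel) \<le> ennreal (C * energy u powr (p / 2))"
    by (rule sobolev_embedding[OF p]) (rule that)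
  from this(2)[OF u] show ?thesis
    by (intro integrableI_bounded) (auto intro: le_less_trans)
qed

lemma powr_int_nonneg: "0 \<le> powr_int p u"
  by (simp add: powr_int_def)

lemma nn_integral_powr_int:
  fixes u :: "'a::euclidean_space l2"
  assumes p: "subcritical TYPE('a) p" and u: "u \<in> H2cls"
  shows "(\<integral>\<^sup>+x. ennreal (cmod (rep u x) powr p) \<partial>lborel) = ennreal (powr_int p u)"
  unfolding powr_int_def by (rule nn_integral_eq_integral[OF powr_integrable[OF assms]]) simp

lemma powr_int_le_energy:
  assumes p: "subcritical TYPE('a::euclidean_space) p"
  obtains C where "0 \<le> C" "\<And>u :: 'a l2. u \<in> H2cls \<Longrightarrow> powr_int p u \<le> C * energy u powr (p / 2)"
proof -
  obtain C where C: "0 \<le> C"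
    "\<And>u :: 'a l2. u \<in> H2cls \<Longrightarrow> (\<integral>\<^sup>+x. ennreal (cmod (rep u x) powr p) \<partial>lborel) \<le> ennreal (C * energy u powr (p / 2))"
    by (rule sobolev_embedding[OF p]) (rule that)
  show thesis
  proof (rule that[OF C(1)])
    fix u :: "'a l2" assume u: "u \<in> H2cls"
    show "powr_int p u \<le> C * energy u powr (p / 2)"
      using C(2)[OF u] C(1) unfolding nn_integral_powr_int[OF p u] by (simp add: ennreal_le_iff)
  qed
qed

lemma powr_int_cong:
  assumes "AE x in lborel. rep u x = f x" "f \<in> borel_measurable borel"
  shows "powr_int p u = (LINT x|lborel. cmod (f x) powr p)"
  unfolding powr_int_def by (rule integral_cong_AE) (use assms in auto)

lemma powr_int_shift: "powr_int p (shift y u) = powr_int p u"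
proof -
  have "powr_int p (shift y u) = (LINT x|lborel. cmod (rep u (x + y)) powr p)"
    by (rule powr_int_cong[OF AE_rep_shift]) simp
  then show ?thesis
    using integral_translate[of "\<lambda>x. cmod (rep u x) powr p" y] by (simp add: powr_int_def)
qed

lemma powr_int_scaleR: "powr_int p (r *\<^sub>R u) = \<bar>r\<bar> powr p * powr_int p u"
proof -
  have "powr_int p (r *\<^sub>R u) = (LINT x|lborel. cmod (r *\<^sub>R rep u x) powr p)"
    by (rule powr_int_cong[OF AE_rep_scaleR]) simp
  also have "(\<lambda>x. cmod (r *\<^sub>R rep u x) powr p) = (\<lambda>x. \<bar>r\<bar> powr p * cmod (rep u x) powr p)"
    by (simp add: powr_mult)
  finally show ?thesis by (simp add: powr_int_def)
qed

lemma powr_int_pos: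
  fixes u :: "'a::euclidean_space l2"
  assumes p: "subcritical TYPE('a) p" and u: "u \<in> H2cls" "u \<noteq> 0"
  shows "0 < powr_int p u"
proof (rule ccontr)
  assume "\<not> ?thesis"
  then have "powr_int p u = 0" using powr_int_nonneg[of p u] by simp
  then have "AE x in lborel. cmod (rep u x) powr p = 0"
    unfolding powr_int_def
    using integral_nonneg_eq_0_iff_AE[OF powr_integrable[OF p u(1)]] by simp
  then have "AE x in lborel. rep u x = 0" by eventually_elim simp
  then have "cls (rep u) = cls (\<lambda>x. 0)" by (subst cls_eq_iff) (auto simp: sqint_zero)
  with u(2) show False by (simp add: cls_zero)
qed

section \<open>Nonvanishing\<close>

text \<open>For large \<open>J\<close> the average at scale \<open>2\<^sup>-\<^sup>J\<close> carries a fixed part of the \<open>L\<^sup>p\<close> norm. As its \<open>L\<^sup>2\<close> norm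
  is bounded and \<open>p > 2\<close>, it cannot be small everywhere.\<close>

lemma nonvanishing:
  assumes p: "subcritical TYPE('a::euclidean_space) p"
  obtains J \<delta> where "\<delta> > 0"
    "\<And>u :: 'a l2. u \<in> H2cls \<Longrightarrow> energy u \<le> B \<Longrightarrow> powr_int p u = 1 \<Longrightarrow> \<exists>x. \<delta> \<le> cmod (dyadic_avg J (rep u) x)"
proof -
  obtain C s where C: "0 \<le> C" "0 < s" "s < 1"
    "\<And>(u :: 'a l2) J. u \<in> H2cls \<Longrightarrow>
      (\<integral>\<^sup>+x. ennreal (cmod (rep u x - dyadic_avg J (rep u) x) powr p) \<partial>lborel) \<le> ennreal (C * energy u powr (p / 2) * s ^ J)"
    by (rule obtain_sobolev[OF p]) (rule that)
  have p2: "p > 2" using p by (simp add: subcritical_def)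
  define B' where "B' = max B 0"
  define \<epsilon> where "\<epsilon> = (2::real) powr (- p) / 4"
  have \<epsilon>: "\<epsilon> > 0" by (simp add: \<epsilon>_def)
  have "(\<lambda>J. C * B' powr (p / 2) * s ^ J) \<longlonglongrightarrow> C * B' powr (p / 2) * 0"
    using C(2,3) by (intro tendsto_mult_left LIMSEQ_power_zero) auto
  then have "\<forall>\<^sub>F J in sequentially. C * B' powr (p / 2) * s ^ J < \<epsilon>"
    using \<epsilon> by (intro order_tendstoD) auto
  then obtain J where J: "C * B' powr (p / 2) * s ^ J < \<epsilon>" by (auto simp: eventually_sequentially)
  define D where "D = (1 + hess_const TYPE('a))\<^sup>2 * B'"
  have D: "D \<ge> 0" by (simp add: D_def B'_def)
  define \<delta> where "\<delta> = (\<epsilon> / (D + 1)) powr (1 / (p - 2))"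
  have \<delta>: "\<delta> > 0" using \<epsilon> D by (simp add: \<delta>_def)
  have \<delta>p: "\<delta> powr (p - 2) * D \<le> \<epsilon>"
  proof -
    have "\<delta> powr (p - 2) = \<epsilon> / (D + 1)" using p2 \<epsilon> D by (simp add: \<delta>_def powr_powr)
    then show ?thesis using mult_right_mono[of D "D + 1" \<epsilon>] \<epsilon> D by (simp add: divide_le_eq mult.commute)
  qed
  have "\<exists>x. \<delta> \<le> cmod (dyadic_avg J (rep u) x)"
    if u: "u \<in> H2cls" and E: "energy u \<le> B" and one: "powr_int p u = 1" for u :: "'a l2"
  proof (rule ccontr)
    assume "\<not> ?thesis"
    then have S: "cmod (dyadic_avg J (rep u) x) \<le> \<delta>" for x by (simp add: not_le less_imp_le)
    have E': "energy u \<le> B'" using E by (simp add: B'_def)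
    have "ennreal 1 \<le> ennreal (2 powr p) * ((\<integral>\<^sup>+x. ennreal (cmod (rep u x - dyadic_avg J (rep u) x) powr p) \<partial>lborel)
        + (\<integral>\<^sup>+x. ennreal (cmod (dyadic_avg J (rep u) x) powr p) \<partial>lborel))"
      using nn_integral_powr_le_split[of "rep u" "dyadic_avg J (rep u)" p] p2
      by (simp add: nn_integral_powr_int[OF p u] one)
    also have "\<dots> \<le> ennreal (2 powr p) * (ennreal \<epsilon> + ennreal \<epsilon>)"
    proof (intro mult_left_mono add_mono)
      have "C * energy u powr (p / 2) * s ^ J \<le> C * B' powr (p / 2) * s ^ J"
        using C E' p2 energy_nonneg[of u] by (intro mult_right_mono mult_left_mono powr_mono2) auto
      then have "C * energy u powr (p / 2) * s ^ J \<le> \<epsilon>" using J by linarith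
      then show "(\<integral>\<^sup>+x. ennreal (cmod (rep u x - dyadic_avg J (rep u) x) powr p) \<partial>lborel) \<le> ennreal \<epsilon>"
        using C(4)[OF u, of J] by (meson ennreal_leI order_trans)
      have "\<delta> powr (p - 2) * ((1 + hess_const TYPE('a))\<^sup>2 * energy u) \<le> \<delta> powr (p - 2) * D"
        unfolding D_def by (intro mult_left_mono E') auto
      then have "\<delta> powr (p - 2) * ((1 + hess_const TYPE('a))\<^sup>2 * energy u) \<le> \<epsilon>" using \<delta>p by linarith
      then show "(\<integral>\<^sup>+x. ennreal (cmod (dyadic_avg J (rep u) x) powr p) \<partial>lborel) \<le> ennreal \<epsilon>"
        using nn_integral_dyadic_avg_powr_le[OF u p2 S] by (meson ennreal_leI order_trans)
    qed auto
    also have "\<dots> = ennreal (2 powr p * (\<epsilon> + \<epsilon>))"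
      unfolding ennreal_plus[OF less_imp_le[OF \<epsilon>] less_imp_le[OF \<epsilon>], symmetric]
      using \<epsilon> by (intro ennreal_mult[symmetric]) auto
    also have "2 powr p * (\<epsilon> + \<epsilon>) = 1 / 2" by (simp add: \<epsilon>_def powr_minus field_simps)
    finally have "(1::real) \<le> 1 / 2" by (subst (asm) ennreal_le_iff) auto
    then show False by simp
  qed
  with \<delta> show thesis by (rule that)
qed

section \<open>Weak compactness\<close>

lemma finite_family_weak_subsequence:
  fixes u :: "'i \<Rightarrow> nat \<Rightarrow> 'b::{real_inner,complete_space}"
  assumes "finite I" "\<And>i n. i \<in> I \<Longrightarrow> norm (u i n) \<le> M"
  shows "\<exists>r w. strict_mono (r :: nat \<Rightarrow> nat) \<and> (\<forall>i\<in>I. \<forall>\<psi>. (\<lambda>n. inner (u i (r n)) \<psi>) \<longlonglongrightarrow> inner (w i) \<psi>)"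
  using assms
proof (induct I rule: finite_induct)
  case empty
  show ?case by (intro exI[of _ id]) (auto simp: strict_mono_def)
next
  case (insert j I)
  then have "\<exists>r w. strict_mono (r :: nat \<Rightarrow> nat) \<and> (\<forall>i\<in>I. \<forall>\<psi>. (\<lambda>n. inner (u i (r n)) \<psi>) \<longlonglongrightarrow> inner (w i) \<psi>)"
    by simp
  then obtain r w where r: "strict_mono (r :: nat \<Rightarrow> nat)"
    "\<forall>i\<in>I. \<forall>\<psi>. (\<lambda>n. inner (u i (r n)) \<psi>) \<longlonglongrightarrow> inner (w i) \<psi>" by blast
  have "norm (u j (r n)) \<le> M" for n using insert by simp
  then obtain s v where s: "strict_mono (s :: nat \<Rightarrow> nat)" "\<And>\<psi>. (\<lambda>n. inner (u j (r (s n))) \<psi>) \<longlonglongrightarrow> inner v \<psi>"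
    using bounded_weakly_convergent_subsequence[of "\<lambda>n. u j (r n)" M] by metis
  have "(\<lambda>n. inner (u i ((r \<circ> s) n)) \<psi>) \<longlonglongrightarrow> inner ((w(j := v)) i) \<psi>" if "i \<in> insert j I" for i \<psi>
    using s(2) LIMSEQ_subseq_LIMSEQ[OF r(2)[rule_format] s(1)] that insert(2) by (cases "i = j") (auto simp: o_def)
  then show ?case using strict_mono_o[OF r(1) s(1)] by blast
qed

lemma H2_weak_subsequence:
  assumes u: "\<And>n. u n \<in> H2cls" and E: "\<And>n. energy (u n) \<le> B"
  obtains r w where "strict_mono (r :: nat \<Rightarrow> nat)" "w \<in> H2cls"
    "\<And>bs \<psi>. bs \<in> directions2 \<Longrightarrow> (\<lambda>n. inner (wd bs (u (r n))) \<psi>) \<longlonglongrightarrow> inner (wd bs w) \<psi>"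
proof -
  have "norm (wd bs (u n)) \<le> sqrt (3 / 2 * B)" if "bs \<in> directions2" for bs n
    using wd_le_energy[OF u that, of n] E[of n] by (meson mult_left_mono order_trans real_sqrt_le_mono zero_le_divide_iff zero_le_numeral)
  from finite_family_weak_subsequence[where u = "\<lambda>bs n. wd bs (u n)", OF finite_directions2 this]
  obtain r g where r: "strict_mono (r :: nat \<Rightarrow> nat)"
    "\<And>bs \<psi>. bs \<in> directions2 \<Longrightarrow> (\<lambda>n. inner (wd bs (u (r n))) \<psi>) \<longlonglongrightarrow> inner (g bs) \<psi>" by blast
  have "wders bs (g []) (g bs)" if bs: "bs \<in> directions2" for bs
  proof (rule wders_weak_limit)
    show "wders bs (u (r n)) (wd bs (u (r n)))" for n by (rule wders_wd[OF u bs])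
    show "(\<lambda>n. inner (u (r n)) \<psi>) \<longlonglongrightarrow> inner (g []) \<psi>" for \<psi> using r(2)[of "[]" \<psi>] by simp
  qed (rule r(2)[OF bs])
  then have w: "g [] \<in> H2cls" "\<And>bs. bs \<in> directions2 \<Longrightarrow> wd bs (g []) = g bs"
    unfolding H2cls_def using wd_eqI by blast+
  show thesis by (rule that[OF r(1) w(1)]) (use r(2) w(2) in auto)
qed

lemma weak_limit_lap:
  assumes "\<And>bs \<psi>. bs \<in> directions2 \<Longrightarrow> (\<lambda>n. inner (wd bs (u n)) \<psi>) \<longlonglongrightarrow> inner (wd bs w) \<psi>"
  shows "(\<lambda>n. inner (lap (u n)) \<psi>) \<longlonglongrightarrow> inner (lap w) \<psi>"
  unfolding lap_def inner_sum_left by (intro tendsto_sum assms) simp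

text \<open>The value of an average at a point is an inner product with a fixed square integrable function.\<close>

lemma avg_weak_limit:
  fixes u :: "nat \<Rightarrow> 'a::euclidean_space l2"
  assumes weak: "\<And>\<psi>. (\<lambda>n. inner (u n) \<psi>) \<longlonglongrightarrow> 0"
  shows "(\<lambda>n. avg h (rep (u n)) x) \<longlonglongrightarrow> 0"
proof -
  let ?i = "\<lambda>y. complex_of_real (indicat_real (cball (0::'a) h) y)"
  have cl: "cls (\<lambda>y. rep (u n) (x + y)) = shift x (u n)" for n
    by (simp add: shift_def add.commute)
  have lim: "(\<lambda>n. inner (shift x (u n)) \<psi>) \<longlonglongrightarrow> 0" for \<psi>
    unfolding inner_shift_left by (rule weak)
  let ?c = "\<lambda>n. LINT y|lborel. rep (u n) (x + y) * ?i y"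
  have Re: "Re (?c n) = inner (shift x (u n)) (cls (\<lambda>y. cnj (?i y)))"
    and Im: "Im (?c n) = - inner (shift x (u n)) (cls (\<lambda>y. cnj (\<i> * ?i y)))" for n
    using inner_cls_cnj[OF sqint_translate'[OF rep_sqint[of "u n"], of x] ball_indicator_sqint[of h]]
    unfolding cl by simp_all
  have "(\<lambda>n. ?c n) \<longlonglongrightarrow> 0"
    unfolding tendsto_complex_iff Re Im
    using lim[of "cls (\<lambda>y. cnj (?i y))"] tendsto_minus[OF lim[of "cls (\<lambda>y. cnj (\<i> * ?i y))"]] by simp
  then have "(\<lambda>n. (1 / measure lborel (cball (0::'a) h)) *\<^sub>R ?c n) \<longlonglongrightarrow> (1 / measure lborel (cball (0::'a) h)) *\<^sub>R 0"
    by (intro tendsto_scaleR tendsto_const)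
  moreover have "avg h (rep (u n)) x = (1 / measure lborel (cball (0::'a) h)) *\<^sub>R ?c n" for n
    by (simp add: avg_def scaleR_conv_of_real mult.commute)
  ultimately show ?thesis by simp
qed

lemma energy_diff_le:
  assumes "u \<in> H2cls" "v \<in> H2cls"
  shows "energy (u - v) \<le> 2 * energy u + 2 * energy v"
proof -
  have sq: "(norm (a - b))\<^sup>2 \<le> 2 * (norm a)\<^sup>2 + 2 * (norm b)\<^sup>2" for a b :: "'a l2"
  proof -
    have "(norm (a - b))\<^sup>2 \<le> (norm a + norm b)\<^sup>2" by (intro power_mono norm_triangle_ineq4) simp
    also have "\<dots> \<le> 2 * (norm a)\<^sup>2 + 2 * (norm b)\<^sup>2"
      using sum_squares_bound[of "norm a" "norm b"] by (simp add: power2_sum)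
    finally show ?thesis .
  qed
  show ?thesis
    using sq[of "lap u" "lap v"] sq[of u v] by (simp add: energy_def H2cls_diff(3)[OF assms])
qed

text \<open>This is the local compactness of the embedding of \<open>H\<^sup>2\<close> in \<open>L\<^sup>2\<close>. Averages of a weakly null
  sequence tend to zero pointwise, and in \<open>L\<^sup>2\<close> the sequence is uniformly close to its averages; a weight
  makes dominated convergence available on the whole space.\<close>

lemma weak_null_AE_subseq:
  fixes u :: "nat \<Rightarrow> 'a::euclidean_space l2"
  assumes u: "\<And>n. u n \<in> H2cls" and E: "\<And>n. energy (u n) \<le> B"
    and weak: "\<And>\<psi>. (\<lambda>n. inner (u n) \<psi>) \<longlonglongrightarrow> 0"
  obtains r where "strict_mono (r::nat\<Rightarrow>nat)" "AE x in lborel. (\<lambda>n. rep (u (r n)) x) \<longlonglongrightarrow> 0"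
proof -
  obtain \<rho> :: "'a \<Rightarrow> real" where [measurable]: "\<rho> \<in> borel_measurable borel"
    and \<rho>: "\<And>x. 0 < \<rho> x" "\<And>x. \<rho> x \<le> 1" "(\<lambda>x. complex_of_real (\<rho> x)) \<in> sqint"
    by (rule obtain_l2_weight) (rule that)
  have sc: "(\<lambda>x. \<rho> x *\<^sub>R f x) \<in> sqint" if f: "f \<in> sqint" for f
    by (rule sqint_mono[OF f, of _ 1])
      (use sqint_measurable[OF f] \<rho> in \<open>auto simp: abs_mult mult_left_le_one_le less_imp_le\<close>)
  have sc_le: "norm (cls (\<lambda>x. \<rho> x *\<^sub>R f x)) \<le> norm (cls f)" if f: "f \<in> sqint" for f
    by (rule norm_cls_mono[OF sc[OF f] f]) (use \<rho> in \<open>auto simp: mult_left_le_one_le less_imp_le\<close>)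
  have B: "B \<ge> 0" using E[of 0] energy_nonneg order_trans by blast
  define M where "M = hess_const TYPE('a) * sqrt B"
  have M: "M \<ge> 0" using B by (simp add: M_def hess_const_def)
  have close: "norm (cls (\<lambda>x. rep (u n) x - avg h (rep (u n)) x)) \<le> M * h\<^sup>2" if h: "h > 0" for n h
  proof -
    have "hess_const TYPE('a) * sqrt (energy (u n)) \<le> M"
      unfolding M_def using E[of n] by (intro mult_left_mono) (auto simp: hess_const_def)
    then show ?thesis
      using norm_diff_avg_le[OF second_diff_bound_energy[OF u[of n]] h] by (meson mult_right_mono order_trans zero_le_power2)
  qed
  have avg0: "(\<lambda>n. norm (cls (\<lambda>x. \<rho> x *\<^sub>R avg h (rep (u n)) x))) \<longlonglongrightarrow> 0" if h: "h > 0" for h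
  proof -
    let ?S = "sqrt B / sqrt (measure lborel (cball (0::'a) h))"
    have S: "cmod (avg h (rep (u n)) x) \<le> ?S" for n x
    proof -
      have "norm (u n) \<le> sqrt B" using norm_le_energy[of "u n"] E[of n] by (meson order_trans real_sqrt_le_mono)
      then show ?thesis using avg_sup_le[OF rep_sqint[of "u n"] h, of x]
        by (simp, meson divide_right_mono order_trans real_sqrt_ge_zero measure_nonneg)
    qed
    have "(\<lambda>n. LINT x|lborel. (cmod (\<rho> x *\<^sub>R avg h (rep (u n)) x))\<^sup>2) \<longlonglongrightarrow> (LINT x|(lborel :: 'a measure). 0)"
    proof (rule integral_dominated_convergence[where w = "\<lambda>x. ?S\<^sup>2 * (cmod (complex_of_real (\<rho> x)))\<^sup>2"])
      show "integrable lborel (\<lambda>x. ?S\<^sup>2 * (cmod (complex_of_real (\<rho> x)))\<^sup>2)"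
        by (intro integrable_mult_right sqint_integrable \<rho>)
      show "(\<lambda>x. (cmod (\<rho> x *\<^sub>R avg h (rep (u n)) x))\<^sup>2) \<in> borel_measurable lborel" for n
        by simp
      show "AE x in lborel. (\<lambda>n. (cmod (\<rho> x *\<^sub>R avg h (rep (u n)) x))\<^sup>2) \<longlonglongrightarrow> 0"
      proof (rule AE_I2)
        fix x
        have "(\<lambda>n. (cmod (\<rho> x *\<^sub>R avg h (rep (u n)) x))\<^sup>2) \<longlonglongrightarrow> (cmod (\<rho> x *\<^sub>R 0))\<^sup>2"
          by (intro tendsto_intros avg_weak_limit weak)
        then show "(\<lambda>n. (cmod (\<rho> x *\<^sub>R avg h (rep (u n)) x))\<^sup>2) \<longlonglongrightarrow> 0" by simp
      qed
      show "AE x in lborel. norm ((cmod (\<rho> x *\<^sub>R avg h (rep (u n)) x))\<^sup>2) \<le> ?S\<^sup>2 * (cmod (complex_of_real (\<rho> x)))\<^sup>2" for n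
      proof (rule AE_I2)
        fix x
        have "(cmod (\<rho> x *\<^sub>R avg h (rep (u n)) x))\<^sup>2 = (cmod (avg h (rep (u n)) x))\<^sup>2 * (\<rho> x)\<^sup>2"
          by (simp add: power_mult_distrib)
        also have "\<dots> \<le> ?S\<^sup>2 * (\<rho> x)\<^sup>2" by (intro mult_right_mono power_mono S) auto
        finally show "norm ((cmod (\<rho> x *\<^sub>R avg h (rep (u n)) x))\<^sup>2) \<le> ?S\<^sup>2 * (cmod (complex_of_real (\<rho> x)))\<^sup>2"
          by simp
      qed
    qed simp
    then have "(\<lambda>n. (norm (cls (\<lambda>x. \<rho> x *\<^sub>R avg h (rep (u n)) x)))\<^sup>2) \<longlonglongrightarrow> 0"
      by (simp add: norm_cls_sq[OF sc[OF avg_sqint[OF rep_sqint h]]])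
    from tendsto_real_sqrt[OF this] show ?thesis by simp
  qed
  have "(\<lambda>n. norm (cls (\<lambda>x. \<rho> x *\<^sub>R rep (u n) x))) \<longlonglongrightarrow> 0"
  proof (rule LIMSEQ_I)
    fix e :: real assume e: "e > 0"
    define h where "h = sqrt (e / (2 * (M + 1)))"
    have h: "h > 0" "M * h\<^sup>2 < e / 2"
      using e M by (auto simp: h_def field_simps)
    have ev: "\<forall>\<^sub>F n in sequentially. norm (cls (\<lambda>x. \<rho> x *\<^sub>R avg h (rep (u n)) x)) < e / 2"
      using order_tendstoD(2)[OF avg0[OF h(1)], of "e / 2"] e by simp
    have le: "norm (cls (\<lambda>x. \<rho> x *\<^sub>R rep (u n) x)) \<le> M * h\<^sup>2 + norm (cls (\<lambda>x. \<rho> x *\<^sub>R avg h (rep (u n)) x))" for n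
    proof -
      let ?d = "\<lambda>x. rep (u n) x - avg h (rep (u n)) x" and ?a = "avg h (rep (u n))"
      have d: "?d \<in> sqint" and a: "?a \<in> sqint" by (intro sqint_diff avg_sqint h rep_sqint)+
      have "(\<lambda>x. \<rho> x *\<^sub>R rep (u n) x) = (\<lambda>x. \<rho> x *\<^sub>R ?d x + \<rho> x *\<^sub>R ?a x)"
        by (simp add: algebra_simps)
      then have "cls (\<lambda>x. \<rho> x *\<^sub>R rep (u n) x) = cls (\<lambda>x. \<rho> x *\<^sub>R ?d x) + cls (\<lambda>x. \<rho> x *\<^sub>R ?a x)"
        by (simp only: cls_add[OF sc[OF d] sc[OF a]])
      then show ?thesis
        using norm_triangle_ineq[of "cls (\<lambda>x. \<rho> x *\<^sub>R ?d x)" "cls (\<lambda>x. \<rho> x *\<^sub>R ?a x)"]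
          order_trans[OF sc_le[OF d] close[OF h(1), of n]]
        by simp
    qed
    from ev have "\<forall>\<^sub>F n in sequentially. norm (cls (\<lambda>x. \<rho> x *\<^sub>R rep (u n) x)) < e"
    proof eventually_elim
      case (elim n)
      then show ?case using le[of n] h(2) by linarith
    qed
    then show "\<exists>N. \<forall>n\<ge>N. norm (norm (cls (\<lambda>x. \<rho> x *\<^sub>R rep (u n) x)) - 0) < e"
      by (simp add: eventually_sequentially)
  qed
  then obtain r where r: "strict_mono (r::nat\<Rightarrow>nat)" "AE x in lborel. (\<lambda>n. \<rho> x *\<^sub>R rep (u (r n)) x) \<longlonglongrightarrow> 0"
    by (rule L2_null_AE_subseq[rotated]) (auto intro: sc that)
  have "AE x in lborel. (\<lambda>n. rep (u (r n)) x) \<longlonglongrightarrow> 0"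
    using r(2)
  proof eventually_elim
    case (elim x)
    from tendsto_scaleR[OF tendsto_const[of "inverse (\<rho> x)"] elim] show ?case
      using \<rho>(1)[of x] by simp
  qed
  with r(1) show thesis by (rule that)
qed

section \<open>Splitting of the power integral and compactness of minimizing sequences\<close>

text \<open>Distinguish whether \<open>b\<close> is small relative to \<open>a\<close>.\<close>

lemma powr_sum_le_eps:
  fixes p \<epsilon> :: real
  assumes p: "p > 0" and \<epsilon>: "\<epsilon> > 0"
  obtains C where "C \<ge> 0" "\<And>a b :: real. 0 \<le> a \<Longrightarrow> 0 \<le> b \<Longrightarrow> (a + b) powr p \<le> (1 + \<epsilon>) * a powr p + C * b powr p"
proof -
  define \<eta> where "\<eta> = (1 + \<epsilon>) powr (1 / p) - 1"
  have \<eta>: "\<eta> > 0" using p \<epsilon> powr_less_mono2[of "1 / p" 1 "1 + \<epsilon>"] by (simp add: \<eta>_def)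
  have \<eta>p: "(1 + \<eta>) powr p = 1 + \<epsilon>" using p \<epsilon> by (simp add: \<eta>_def powr_powr)
  define C where "C = (1 + 1 / \<eta>) powr p"
  have "(a + b) powr p \<le> (1 + \<epsilon>) * a powr p + C * b powr p" if ab: "0 \<le> a" "0 \<le> b" for a b
  proof (cases "b \<le> \<eta> * a")
    case True
    then have "(a + b) powr p \<le> ((1 + \<eta>) * a) powr p"
      using p ab by (intro powr_mono2) (auto simp: algebra_simps)
    also have "\<dots> = (1 + \<epsilon>) * a powr p" by (simp add: powr_mult \<eta>p)
    finally show ?thesis by (simp add: C_def add_increasing2)
  next
    case False
    then have "a \<le> b / \<eta>" using \<eta> by (simp add: field_simps)
    then have "(a + b) powr p \<le> ((1 + 1 / \<eta>) * b) powr p"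
      using p ab by (intro powr_mono2) (auto simp: algebra_simps)
    also have "\<dots> = C * b powr p" by (simp add: powr_mult C_def)
    finally show ?thesis using \<epsilon> by (simp add: add_increasing)
  qed
  moreover have "C \<ge> 0" by (simp add: C_def)
  ultimately show thesis using that by blast
qed

text \<open>One half of the lemma of Brezis and Lieb: no part of the power integral gets lost when the limit is
  split off. The excess \<open>f n\<close> over the split sum tends to zero almost everywhere and is dominated by a
  multiple of \<open>cmod (rep w x) powr p\<close>.\<close>

lemma brezis_lieb_upper:
  fixes u :: "nat \<Rightarrow> 'a::euclidean_space l2"
  assumes p: "subcritical TYPE('a) p" and u: "\<And>n. u n \<in> H2cls" and w: "w \<in> H2cls"
    and E: "\<And>n. energy (u n) \<le> B" and one: "\<And>n. powr_int p (u n) = 1"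
    and ae: "AE x in lborel. (\<lambda>n. rep (u n - w) x) \<longlonglongrightarrow> 0" and e: "e > 0"
  shows "\<forall>\<^sub>F n in sequentially. 1 \<le> powr_int p (u n - w) + powr_int p w + e"
proof -
  have p0: "p > 0" using p by (simp add: subcritical_def)
  obtain C0 where C0: "0 \<le> C0" "\<And>u :: 'a l2. u \<in> H2cls \<Longrightarrow> powr_int p u \<le> C0 * energy u powr (p / 2)"
    by (rule powr_int_le_energy[OF p]) (rule that)
  define D where "D = C0 * (2 * B + 2 * energy w) powr (p / 2)"
  have d: "u n - w \<in> H2cls" for n by (rule H2cls_diff(1)[OF u w])
  have D: "powr_int p (u n - w) \<le> D" for n
  proof -
    have "energy (u n - w) powr (p / 2) \<le> (2 * B + 2 * energy w) powr (p / 2)"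
      using p0 energy_diff_le[OF u w, of n] E[of n] by (intro powr_mono2 energy_nonneg) auto
    then show ?thesis unfolding D_def using C0(2)[OF d[of n]] mult_left_mono[OF _ C0(1)] order_trans by blast
  qed
  have D0: "D \<ge> 0" using D[of 0] powr_int_nonneg order_trans by blast
  define \<epsilon> where "\<epsilon> = e / (2 * (D + 1))"
  have \<epsilon>: "\<epsilon> > 0" "\<epsilon> * D \<le> e / 2" using e D0 by (auto simp: \<epsilon>_def field_simps)
  obtain C where C: "C \<ge> 0" "\<And>a b :: real. 0 \<le> a \<Longrightarrow> 0 \<le> b \<Longrightarrow> (a + b) powr p \<le> (1 + \<epsilon>) * a powr p + C * b powr p"
    by (rule powr_sum_le_eps[OF p0 \<epsilon>(1)]) (rule that)
  note iu = powr_integrable[OF p u] and iw = powr_integrable[OF p w] and id = powr_integrable[OF p d]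
  define f where "f n x = max 0 (cmod (rep (u n) x) powr p - (1 + \<epsilon>) * cmod (rep (u n - w) x) powr p - cmod (rep w x) powr p)" for n x
  have [measurable]: "f n \<in> borel_measurable borel" for n unfolding f_def by measurable
  have rel: "AE x in lborel. rep (u n) x = rep (u n - w) x + rep w x" for n
    using AE_rep_diff[of "u n" w] by eventually_elim simp
  have dom: "AE x in lborel. norm (f n x) \<le> C * cmod (rep w x) powr p" for n
    using rel[of n]
  proof eventually_elim
    case (elim x)
    have "cmod (rep (u n) x) powr p \<le> (cmod (rep (u n - w) x) + cmod (rep w x)) powr p"
      unfolding elim using p0 by (intro powr_mono2 norm_triangle_ineq) auto
    also have "\<dots> \<le> (1 + \<epsilon>) * cmod (rep (u n - w) x) powr p + C * cmod (rep w x) powr p"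
      by (rule C(2)) auto
    finally have "f n x \<le> C * cmod (rep w x) powr p"
      using mult_nonneg_nonneg[OF C(1) powr_ge_zero[of "cmod (rep w x)" p]] powr_ge_zero[of "cmod (rep w x)" p]
      unfolding f_def by linarith
    moreover have "f n x \<ge> 0" by (simp add: f_def)
    ultimately show ?case by simp
  qed
  have "(\<lambda>n. LINT x|lborel. f n x) \<longlonglongrightarrow> (LINT x|(lborel :: 'a measure). 0)"
  proof (rule integral_dominated_convergence[where w = "\<lambda>x. C * cmod (rep w x) powr p"])
    have "AE x in lborel. \<forall>n. rep (u n) x = rep (u n - w) x + rep w x"
      unfolding AE_all_countable using rel by blast
    with ae show "AE x in lborel. (\<lambda>n. f n x) \<longlonglongrightarrow> 0"
    proof eventually_elim
      case (elim x)
      have "(\<lambda>n. rep (u n - w) x + rep w x) \<longlonglongrightarrow> 0 + rep w x" using elim(1) by (intro tendsto_intros)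
      then have "(\<lambda>n. rep (u n) x) \<longlonglongrightarrow> rep w x" using elim(2) by simp
      then have 1: "(\<lambda>n. cmod (rep (u n) x) powr p) \<longlonglongrightarrow> cmod (rep w x) powr p"
        using p0 by (intro tendsto_powr' tendsto_intros) auto
      have 2: "(\<lambda>n. cmod (rep (u n - w) x) powr p) \<longlonglongrightarrow> cmod 0 powr p"
        using p0 elim(1) by (intro tendsto_powr' tendsto_intros) auto
      have "(\<lambda>n. f n x) \<longlonglongrightarrow> max 0 (cmod (rep w x) powr p - (1 + \<epsilon>) * cmod 0 powr p - cmod (rep w x) powr p)"
        unfolding f_def by (intro tendsto_max tendsto_diff tendsto_mult tendsto_const 1 2)
      then show ?case by simp
    qed
  qed (use iw dom in auto)
  then have "\<forall>\<^sub>F n in sequentially. (LINT x|lborel. f n x) < e / 2"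
    using e by (intro order_tendstoD) auto
  then show ?thesis
  proof eventually_elim
    case (elim n)
    have fi: "integrable lborel (f n)"
      by (rule Bochner_Integration.integrable_bound[OF integrable_mult_right[OF iw, of C]])
        (use dom[of n] C(1) in auto)
    have "1 = (LINT x|lborel. cmod (rep (u n) x) powr p)" using one[of n] by (simp add: powr_int_def)
    also have "\<dots> \<le> (LINT x|lborel. f n x + (1 + \<epsilon>) * cmod (rep (u n - w) x) powr p + cmod (rep w x) powr p)"
    proof (rule integral_mono[OF iu])
      show "integrable lborel (\<lambda>x. f n x + (1 + \<epsilon>) * cmod (rep (u n - w) x) powr p + cmod (rep w x) powr p)"
        by (intro Bochner_Integration.integrable_add integrable_mult_right fi id iw)
      show "cmod (rep (u n) x) powr p \<le> f n x + (1 + \<epsilon>) * cmod (rep (u n - w) x) powr p + cmod (rep w x) powr p" for x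
        unfolding f_def by linarith
    qed
    also have "\<dots> = (LINT x|lborel. f n x) + (1 + \<epsilon>) * powr_int p (u n - w) + powr_int p w"
      unfolding powr_int_def
      by (subst Bochner_Integration.integral_add, (intro Bochner_Integration.integrable_add integrable_mult_right fi id iw)+,
          subst Bochner_Integration.integral_add, (intro integrable_mult_right fi id iw)+) simp
    also have "(1 + \<epsilon>) * powr_int p (u n - w) \<le> powr_int p (u n - w) + e / 2"
    proof -
      have "\<epsilon> * powr_int p (u n - w) \<le> \<epsilon> * D" by (rule mult_left_mono[OF D]) (use \<epsilon>(1) in simp)
      then show ?thesis using \<epsilon>(2) unfolding distrib_right by linarith
    qed
    finally show ?case using elim by linarith
  qed
qed

lemma energy_expand:
  assumes "u \<in> H2cls" "w \<in> H2cls"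
  shows "energy u = energy w + energy (u - w) + 2 * (inner (lap (u - w)) (lap w) + inner (u - w) w)"
  unfolding energy_def H2cls_diff(3)[OF assms]
  by (simp add: power2_norm_eq_inner inner_diff_left inner_diff_right inner_commute algebra_simps)

lemma energy_scaleR: "u \<in> H2cls \<Longrightarrow> energy (r *\<^sub>R u) = r\<^sup>2 * energy u"
  by (simp add: energy_def H2cls_scaleR(3) power_mult_distrib algebra_simps)

lemma energy_shift: "u \<in> H2cls \<Longrightarrow> energy (shift y u) = energy u"
  by (simp add: energy_def H2cls_shift(3))

text \<open>Scale \<open>z\<close> to satisfy the constraint; the energy is homogeneous of degree \<open>2\<close>, the constraint of
  degree \<open>p\<close>.\<close>

lemma energy_homogeneous_lower:
  fixes z :: "'a::euclidean_space l2"
  assumes p: "subcritical TYPE('a) p" and m: "0 \<le> m"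
    and min: "\<And>w :: 'a l2. w \<in> H2cls \<Longrightarrow> powr_int p w = 1 \<Longrightarrow> m \<le> energy w" and z: "z \<in> H2cls"
  shows "m * powr_int p z powr (2 / p) \<le> energy z"
proof (cases "powr_int p z = 0")
  case False
  have p0: "p > 0" using p by (simp add: subcritical_def)
  let ?j = "powr_int p z"
  have j: "?j > 0" using False powr_int_nonneg[of p z] by simp
  define t where "t = ?j powr (- (1 / p))"
  have t: "t > 0" using j by (simp add: t_def)
  have "powr_int p (t *\<^sub>R z) = t powr p * ?j" using t by (simp add: powr_int_scaleR)
  also have "t powr p = ?j powr (- 1)" using p0 by (simp add: t_def powr_powr)
  also have "?j powr (- 1) * ?j = 1" using j by (simp add: powr_minus)
  finally have "m \<le> energy (t *\<^sub>R z)" by (intro min H2cls_scaleR z)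
  then have m: "m \<le> t\<^sup>2 * energy z" by (simp add: energy_scaleR[OF z])
  have "t\<^sup>2 = t powr 2" using powr_realpow[OF t, of 2] by simp
  also have "\<dots> = ?j powr (- (2 / p))" unfolding t_def powr_powr by simp
  finally have t2: "t\<^sup>2 * ?j powr (2 / p) = 1" using j by (simp add: powr_minus)
  have "m * ?j powr (2 / p) \<le> (t\<^sup>2 * energy z) * ?j powr (2 / p)" by (intro mult_right_mono m) simp
  also have "\<dots> = energy z" using t2 by (simp add: algebra_simps)
  finally show ?thesis .
qed (use energy_nonneg in simp)

text \<open>After translation, averages at the origin stay away from zero, so a weak limit \<open>w\<close> is not zero.
  Let \<open>j\<close> be its power integral, with \<open>0 < j \<le> 1\<close>. The energy splits into that of \<open>w\<close> and that of the
  remainder, and the remainder has power integral at least \<open>1 - j\<close> in the limit. By homogeneity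
  \<open>m \<ge> m * (j powr (2 / p) + (1 - j) powr (2 / p))\<close>, which for \<open>m > 0\<close> and \<open>2 / p < 1\<close> is impossible
  unless \<open>j = 1\<close>. Then no energy is left for the remainder.\<close>

theorem minimizing_sequence_compact:
  fixes u :: "nat \<Rightarrow> 'a::euclidean_space l2"
  assumes p: "subcritical TYPE('a) p" and u: "\<And>n. u n \<in> H2cls" and one: "\<And>n. powr_int p (u n) = 1"
    and lim: "(\<lambda>n. energy (u n)) \<longlonglongrightarrow> m"
    and min: "\<And>w :: 'a l2. w \<in> H2cls \<Longrightarrow> powr_int p w = 1 \<Longrightarrow> m \<le> energy w"
  obtains r x w where "strict_mono (r :: nat \<Rightarrow> nat)" "w \<in> H2cls" "powr_int p w = 1" "energy w = m"
    "(\<lambda>k. energy (shift (x k) (u (r k)) - w)) \<longlonglongrightarrow> 0"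
proof -
  have p2: "p > 2" using p by (simp add: subcritical_def)
  obtain B where B: "\<And>n. energy (u n) \<le> B"
  proof -
    have "Bseq (\<lambda>n. energy (u n))" by (rule convergent_imp_Bseq[OF convergentI[OF lim]])
    then obtain K where "\<And>n. norm (energy (u n)) \<le> K" unfolding Bseq_def by blast
    then have "energy (u n) \<le> K" for n by (metis abs_le_D1 real_norm_def)
    then show thesis by (rule that)
  qed
  have mpos: "m > 0"
  proof -
    obtain C where C: "0 \<le> C" "\<And>u :: 'a l2. u \<in> H2cls \<Longrightarrow> powr_int p u \<le> C * energy u powr (p / 2)"
      by (rule powr_int_le_energy[OF p]) (rule that)
    have "(\<lambda>n. C * energy (u n) powr (p / 2)) \<longlonglongrightarrow> C * m powr (p / 2)"
      using p2 by (intro tendsto_mult_left tendsto_powr' tendsto_const lim)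
        (auto simp: energy_nonneg intro: always_eventually)
    moreover have "1 \<le> C * energy (u n) powr (p / 2)" for n using C(2)[OF u[of n]] one[of n] by simp
    ultimately have "1 \<le> C * m powr (p / 2)" by (intro LIMSEQ_le_const) auto
    then have "m \<noteq> 0" by auto
    moreover have "m \<ge> 0" by (rule LIMSEQ_le_const[OF lim]) (auto simp: energy_nonneg)
    ultimately show ?thesis by simp
  qed
  obtain J \<delta> where \<delta>: "\<delta> > 0" "\<And>u :: 'a l2. u \<in> H2cls \<Longrightarrow> energy u \<le> B \<Longrightarrow> powr_int p u = 1 \<Longrightarrow>
      \<exists>x. \<delta> \<le> cmod (dyadic_avg J (rep u) x)"
    by (rule nonvanishing[OF p, of B]) (rule that)
  have "\<forall>n. \<exists>x. \<delta> \<le> cmod (dyadic_avg J (rep (u n)) x)" using \<delta>(2) u B one by blast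
  then obtain x where x: "\<And>n. \<delta> \<le> cmod (dyadic_avg J (rep (u n)) (x n))" by metis
  define v where "v n = shift (x n) (u n)" for n
  have v: "v n \<in> H2cls" "energy (v n) = energy (u n)" "powr_int p (v n) = 1" for n
    by (simp_all add: v_def H2cls_shift u energy_shift powr_int_shift one)
  have vB: "energy (v n) \<le> B" for n using B v by simp
  have v0: "\<delta> \<le> cmod (avg ((1/2) ^ J) (rep (v n)) 0)" for n
  proof -
    have "(LINT y|lborel. indicat_real (cball 0 h) y *\<^sub>R rep (v n) (0 + y)) =
        (LINT y|lborel. indicat_real (cball 0 h) y *\<^sub>R rep (u n) (x n + y))" for h
    proof (rule integral_cong_AE)
      show "AE y in lborel. indicat_real (cball 0 h) y *\<^sub>R rep (v n) (0 + y) = indicat_real (cball 0 h) y *\<^sub>R rep (u n) (x n + y)"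
        using AE_rep_shift[of "x n" "u n"] unfolding v_def by eventually_elim (simp add: add.commute)
    qed (use borel_measurable_indicator[of "cball (0::'a) h" borel] in \<open>auto intro!: borel_measurable_scaleR\<close>)
    then have "avg ((1/2) ^ J) (rep (v n)) 0 = avg ((1/2) ^ J) (rep (u n)) (x n)" unfolding avg_def by simp
    then show ?thesis using x[of n] by (simp add: dyadic_avg_def)
  qed
  obtain r1 w where r1: "strict_mono (r1 :: nat \<Rightarrow> nat)" and w: "w \<in> H2cls"
    and weak1: "\<And>bs \<psi>. bs \<in> directions2 \<Longrightarrow> (\<lambda>n. inner (wd bs (v (r1 n))) \<psi>) \<longlonglongrightarrow> inner (wd bs w) \<psi>"
    by (rule H2_weak_subsequence[of v B, OF v(1) vB]) (rule that)
  define z where "z n = v (r1 n) - w" for n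
  have z: "z n \<in> H2cls" for n unfolding z_def by (intro H2cls_diff v w)
  have weakz: "(\<lambda>n. inner (z n) \<psi>) \<longlonglongrightarrow> 0" for \<psi>
    using tendsto_diff[OF weak1[of "[]" \<psi>] tendsto_const[of "inner w \<psi>"]] by (simp add: z_def inner_diff_left)
  have weakl: "(\<lambda>n. inner (lap (z n)) \<psi>) \<longlonglongrightarrow> 0" for \<psi>
    using tendsto_diff[OF weak_limit_lap[of "\<lambda>n. v (r1 n)" w \<psi>, OF weak1] tendsto_const[of "inner (lap w) \<psi>"]]
    by (simp add: z_def inner_diff_left H2cls_diff(3)[OF v(1) w])
  have w0: "w \<noteq> 0"
  proof
    assume "w = 0"
    then have "(\<lambda>n. avg ((1/2) ^ J) (rep (v (r1 n))) 0) \<longlonglongrightarrow> 0"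
      using avg_weak_limit[of z "(1/2) ^ J" 0, OF weakz] by (simp add: z_def)
    then have "\<forall>\<^sub>F n in sequentially. cmod (avg ((1/2) ^ J) (rep (v (r1 n))) 0) < \<delta>"
      using \<delta>(1) order_tendstoD(2)[OF tendsto_norm_zero] by blast
    then obtain n where "cmod (avg ((1/2) ^ J) (rep (v (r1 n))) 0) < \<delta>" by (auto simp: eventually_sequentially)
    with v0[of "r1 n"] show False by simp
  qed
  have zB: "energy (z n) \<le> 2 * B + 2 * energy w" for n
    unfolding z_def using energy_diff_le[OF v(1) w, of "r1 n"] vB[of "r1 n"] by linarith
  obtain r2 where r2: "strict_mono (r2 :: nat \<Rightarrow> nat)" and ae: "AE x in lborel. (\<lambda>n. rep (z (r2 n)) x) \<longlonglongrightarrow> 0"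
    by (rule weak_null_AE_subseq[of z, OF z zB weakz]) (rule that)
  define j where "j = powr_int p w"
  have j0: "j > 0" unfolding j_def by (rule powr_int_pos[OF p w w0])
  have j1: "j \<le> 1"
  proof -
    have "AE x in lborel. \<forall>n. rep (z (r2 n)) x = rep (v (r1 (r2 n))) x - rep w x"
      unfolding AE_all_countable z_def using AE_rep_diff by blast
    with ae have "AE x in lborel. (\<lambda>n. rep (v (r1 (r2 n))) x) \<longlonglongrightarrow> rep w x"
    proof eventually_elim
      case (elim x)
      from tendsto_add[OF elim(1) tendsto_const[of "rep w x"]] show ?case using elim(2) by simp
    qed
    then have "AE x in lborel. (\<lambda>n. cmod (rep (v (r1 (r2 n))) x) powr p) \<longlonglongrightarrow> cmod (rep w x) powr p"
      by eventually_elim (use p2 in \<open>intro tendsto_powr' tendsto_intros, auto\<close>)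
    from nn_integral_liminf_le[OF _ _ this, of 0 "ennreal 1"]
    have "ennreal j \<le> ennreal 1"
      using v by (simp add: nn_integral_powr_int[OF p] w j_def)
    then show ?thesis by (subst (asm) ennreal_le_iff) auto
  qed
  have Elim: "(\<lambda>n. energy (z (r2 n))) \<longlonglongrightarrow> m - energy w"
  proof -
    have sub: "(\<lambda>n. energy (u (r1 (r2 n)))) \<longlonglongrightarrow> m"
      using LIMSEQ_subseq_LIMSEQ[OF lim strict_mono_o[OF r1 r2]] by (simp add: o_def)
    have "(\<lambda>n. 2 * (inner (lap (z (r2 n))) (lap w) + inner (z (r2 n)) w)) \<longlonglongrightarrow> 2 * (0 + 0)"
      using LIMSEQ_subseq_LIMSEQ[OF weakl r2] LIMSEQ_subseq_LIMSEQ[OF weakz r2]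
      by (intro tendsto_mult_left tendsto_add) (simp_all add: o_def)
    from tendsto_diff[OF tendsto_diff[OF sub tendsto_const[of "energy w"]] this]
    have "(\<lambda>n. energy (u (r1 (r2 n))) - energy w - 2 * (inner (lap (z (r2 n))) (lap w) + inner (z (r2 n)) w)) \<longlonglongrightarrow> m - energy w"
      by simp
    moreover have "energy (u (r1 (r2 n))) - energy w - 2 * (inner (lap (z (r2 n))) (lap w) + inner (z (r2 n)) w) = energy (z (r2 n))" for n
      using energy_expand[OF v(1)[of "r1 (r2 n)"] w] v(2)[of "r1 (r2 n)"] by (simp add: z_def)
    ultimately show ?thesis by simp
  qed
  have hom: "m * powr_int p y powr (2 / p) \<le> energy y" if "y \<in> H2cls" for y :: "'a l2"
    by (rule energy_homogeneous_lower[OF p less_imp_le[OF mpos] _ that]) (rule min)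
  have "j = 1"
  proof (rule ccontr)
    assume "j \<noteq> 1"
    then have jlt: "j < 1" using j1 by simp
    define \<gamma> where "\<gamma> = j powr (2 / p) - j"
    have \<gamma>: "\<gamma> > 0"
      using powr_less_mono'[of j "2 / p" 1] j0 jlt p2 by (simp add: \<gamma>_def)
    \<comment> \<open>Strict concavity on the side of \<open>j\<close> alone suffices; for the remainder it is enough that
      \<open>t powr (2 / p)\<close> is at least the minimum of \<open>t\<close> and \<open>1\<close>.\<close>
    have "\<forall>\<^sub>F n in sequentially. 1 \<le> powr_int p (z (r2 n)) + j + \<gamma> / 2"
      unfolding z_def j_def
      by (rule brezis_lieb_upper[OF p _ w, where B = B]) (use v vB ae \<gamma> in \<open>auto simp: z_def\<close>)
    then have "\<forall>\<^sub>F n in sequentially. m * (1 - j - \<gamma> / 2) \<le> energy (z (r2 n))"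
    proof eventually_elim
      case (elim n)
      let ?t = "powr_int p (z (r2 n))"
      have "1 - j - \<gamma> / 2 \<le> ?t powr (2 / p)"
      proof (cases "?t \<le> 1")
        case True
        then have "?t \<le> ?t powr (2 / p)"
          using powr_mono'[of "2 / p" 1 ?t] p2 powr_int_nonneg[of p "z (r2 n)"] by simp
        then show ?thesis using elim by linarith
      next
        case False
        then have "1 \<le> ?t powr (2 / p)" using p2 by (intro ge_one_powr_ge_zero) auto
        then show ?thesis using j0 \<gamma> by linarith
      qed
      then have "m * (1 - j - \<gamma> / 2) \<le> m * ?t powr (2 / p)" using mpos by (intro mult_left_mono) auto
      then show ?case using hom[OF z[of "r2 n"]] by linarith
    qed
    then have "m * (1 - j - \<gamma> / 2) \<le> m - energy w" by (intro tendsto_lowerbound[OF Elim]) auto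
    moreover have "m * (j + \<gamma>) \<le> energy w" using hom[OF w] by (simp add: \<gamma>_def j_def)
    ultimately have "m * (\<gamma> / 2) \<le> 0" by (simp add: algebra_simps)
    then show False using mpos \<gamma> by (simp add: mult_le_0_iff)
  qed
  then have wone: "powr_int p w = 1" by (simp add: j_def)
  have "m \<le> energy w" by (rule min[OF w wone])
  moreover have "0 \<le> m - energy w" by (rule LIMSEQ_le_const[OF Elim]) (auto simp: energy_nonneg)
  ultimately have Ew: "energy w = m" by simp
  have "(\<lambda>k. energy (shift ((x \<circ> r1 \<circ> r2) k) (u ((r1 \<circ> r2) k)) - w)) \<longlonglongrightarrow> 0"
    using Elim Ew by (simp add: z_def v_def)
  with strict_mono_o[OF r1 r2] w wone Ew show thesis by (rule that)
qed

section \<open>Functions and their classes\<close>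

lemma lebesgue_AE_Borel:
  fixes F f :: "'a::euclidean_space \<Rightarrow> 'b::euclidean_space"
  assumes ae: "AE x in lborel. F x = f x" and f: "f \<in> borel_measurable borel"
  shows "F \<in> borel_measurable lebesgue" "integral\<^sup>L lebesgue F = integral\<^sup>L lborel f"
    "integrable lebesgue F \<longleftrightarrow> integrable lborel f"
proof -
  have f': "f \<in> borel_measurable lborel" using f by simp
  have fl: "f \<in> borel_measurable lebesgue" by (rule measurable_completion[OF f'])
  have ael: "AE x in lebesgue. F x = f x" using ae by (simp add: AE_completion_iff)
  have ael2: "AE x in lebesgue. f x = F x" using ael by eventually_elim simp
  show F: "F \<in> borel_measurable lebesgue"
    by (rule borel_measurable_AE[OF fl ael2])
  show "integral\<^sup>L lebesgue F = integral\<^sup>L lborel f"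
    using integral_cong_AE[OF F fl ael] integral_completion[OF f'] by simp
  show "integrable lebesgue F \<longleftrightarrow> integrable lborel f"
    using integrable_cong_AE[OF F fl ael] integrable_completion[OF f'] by simp
qed

lemma obtain_Borel_version:
  fixes u :: "'a::euclidean_space \<Rightarrow> complex"
  assumes u: "u \<in> borel_measurable lebesgue"
  obtains f where "f \<in> borel_measurable borel" "AE x in lborel. u x = f x"
proof -
  have "(\<lambda>x. Re (u x)) \<in> borel_measurable lebesgue" "(\<lambda>x. Im (u x)) \<in> borel_measurable lebesgue"
    using u by simp_all
  then obtain g h where g: "g \<in> borel_measurable lborel" "AE x in lborel. Re (u x) = g x"
    and h: "h \<in> borel_measurable lborel" "AE x in lborel. Im (u x) = h x"
    using completion_ex_borel_measurable_real by metis
  have "(\<lambda>x. Complex (g x) (h x)) \<in> borel_measurable borel"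
    using g(1) h(1) by (simp add: borel_measurable_complex_iff)
  moreover have "AE x in lborel. u x = Complex (g x) (h x)"
    using g(2) h(2) by eventually_elim (simp add: complex_eq_iff)
  ultimately show thesis by (rule that)
qed

definition represents :: "('a::euclidean_space \<Rightarrow> complex) \<Rightarrow> 'a l2 \<Rightarrow> bool" where
  "represents u U \<longleftrightarrow> (AE x in lborel. u x = rep U x)"

lemma represents_rep: "represents (rep U) U"
  by (simp add: represents_def)

lemma represents_diff:
  assumes "represents u U" "represents v V" shows "represents (\<lambda>x. u x - v x) (U - V)"
  using assms AE_rep_diff[of U V] unfolding represents_def by eventually_elim simp

lemma represents_shift:
  assumes "represents u U" shows "represents (\<lambda>x. u (x + y)) (shift y U)"
  using AE_translate[OF assms[unfolded represents_def], of y] AE_rep_shift[of y U]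
  unfolding represents_def by eventually_elim simp

lemma represents_sum:
  assumes "finite I" "\<And>i. i \<in> I \<Longrightarrow> represents (f i) (U i)"
  shows "represents (\<lambda>x. \<Sum>i\<in>I. f i x) (\<Sum>i\<in>I. U i)"
  using assms
proof (induct I rule: finite_induct)
  case empty
  show ?case
    using AE_rep_cls[OF sqint_zero] unfolding represents_def sum.empty cls_zero by eventually_elim simp
next
  case (insert i I)
  then have "represents (f i) (U i)" "represents (\<lambda>x. \<Sum>i\<in>I. f i x) (\<Sum>i\<in>I. U i)" by auto
  then have "AE x in lborel. f i x + (\<Sum>i\<in>I. f i x) = rep (U i + (\<Sum>i\<in>I. U i)) x"
    using AE_rep_add[of "U i" "\<Sum>i\<in>I. U i"] unfolding represents_def by eventually_elim simp
  then show ?case using insert(1,2) by (simp add: represents_def)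
qed

lemma represents_norm:
  assumes "represents u U"
  shows "(LINT x|lebesgue. (cmod (u x))\<^sup>2) = (norm U)\<^sup>2" "integrable lebesgue (\<lambda>x. (cmod (u x))\<^sup>2)"
proof -
  have ae: "AE x in lborel. (cmod (u x))\<^sup>2 = (cmod (rep U x))\<^sup>2"
    using assms unfolding represents_def by eventually_elim simp
  have m: "(\<lambda>x. (cmod (rep U x))\<^sup>2) \<in> borel_measurable borel" by simp
  show "(LINT x|lebesgue. (cmod (u x))\<^sup>2) = (norm U)\<^sup>2"
    by (simp add: lebesgue_AE_Borel(2)[OF ae m] norm_l2_rep)
  show "integrable lebesgue (\<lambda>x. (cmod (u x))\<^sup>2)"
    unfolding lebesgue_AE_Borel(3)[OF ae m] by (rule sqint_integrable) simp
qed

lemma L2_iff_represents: "u \<in> L2 \<longleftrightarrow> (\<exists>U. represents u U)"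
proof
  assume u: "u \<in> L2"
  then obtain f where f: "f \<in> borel_measurable borel" "AE x in lborel. u x = f x"
    using obtain_Borel_version[of u] unfolding L2_def by blast
  have ae: "AE x in lborel. (cmod (u x))\<^sup>2 = (cmod (f x))\<^sup>2" using f(2) by eventually_elim simp
  have "integrable lborel (\<lambda>x. (cmod (f x))\<^sup>2)"
    using lebesgue_AE_Borel(3)[OF ae] u f(1) by (simp add: L2_def)
  with f(1) have fs: "f \<in> sqint" by (rule sqintI)
  have "represents u (cls f)"
    using f(2) AE_rep_cls[OF fs] unfolding represents_def by eventually_elim simp
  then show "\<exists>U. represents u U" ..
next
  assume "\<exists>U. represents u U"
  then obtain U where U: "represents u U" ..
  then have "u \<in> borel_measurable lebesgue"
    unfolding represents_def by (rule lebesgue_AE_Borel(1)) simp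
  with represents_norm(2)[OF U] show "u \<in> L2" by (simp add: L2_def)
qed

lemma represents_locally_integrable:
  assumes U: "represents u U" shows "locally_integrable u"
  unfolding locally_integrable_def
proof (intro conjI allI impI)
  show "u \<in> borel_measurable lebesgue"
    using U unfolding represents_def by (rule lebesgue_AE_Borel(1)) simp
  fix S :: "'a set" assume S: "compact S"
  then have Sb: "S \<in> sets borel" using compact_imp_closed borel_closed by blast
  let ?i = "\<lambda>x. complex_of_real (indicat_real S x)"
  have i: "?i \<in> sqint"
    by (rule bounded_compact_support_sqint[OF _ S, of _ 1]) (use Sb in \<open>auto simp: indicator_def[abs_def]\<close>)
  have ae: "AE x in lborel. indicat_real S x *\<^sub>R u x = ?i x * rep U x"
    using U unfolding represents_def by eventually_elim (simp add: scaleR_conv_of_real)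
  have m: "(\<lambda>x. ?i x * rep U x) \<in> borel_measurable borel" using sqint_measurable[OF i] by simp
  show "set_integrable lebesgue S u"
    unfolding set_integrable_def lebesgue_AE_Borel(3)[OF ae m]
    by (rule sqint_integrable_complex_mult[OF i rep_sqint])
qed

lemma represents_integral_test:
  assumes "represents u U" "test_function \<phi>"
  shows "(LINT x|lebesgue. u x * \<phi> x) = (LINT x|lborel. rep U x * \<phi> x)"
proof (rule lebesgue_AE_Borel(2))
  show "AE x in lborel. u x * \<phi> x = rep U x * \<phi> x"
    using assms(1) unfolding represents_def by eventually_elim simp
  show "(\<lambda>x. rep U x * \<phi> x) \<in> borel_measurable borel"
    using sqint_measurable[OF test_function_sqint[OF assms(2)]] by simp
qed

lemma has_weak_pderivs_iff_wders:
  fixes u g :: "'a::euclidean_space \<Rightarrow> complex"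
  assumes U: "represents u U" and G: "represents g G" and bs: "set bs \<subseteq> Basis"
  shows "has_weak_pderivs bs u g \<longleftrightarrow> wders bs U G"
proof
  assume h: "has_weak_pderivs bs u g"
  show "wders bs U G"
    unfolding wders_def
  proof (intro allI impI)
    fix \<phi> :: "'a \<Rightarrow> complex" assume \<phi>: "test_function \<phi>"
    let ?\<psi> = "\<lambda>x. cnj (\<phi> x)"
    have \<psi>: "test_function ?\<psi>" by (rule test_function_cnj[OF \<phi>])
    have \<psi>d: "test_function (pderivs bs ?\<psi>)" by (rule test_function_pderivs[OF \<psi> bs])
    have "(\<lambda>x. cnj (pderivs bs ?\<psi> x)) = pderivs bs \<phi>"
      unfolding pderivs_bounded_linear[OF bounded_linear_cnj \<phi> bs] by simp
    then have "inner U (cls (pderivs bs \<phi>)) = Re (LINT x|lborel. rep U x * pderivs bs ?\<psi> x)"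
      using inner_cls_cnj(1)[OF rep_sqint[of U] test_function_sqint[OF \<psi>d]] by simp
    also have "(LINT x|lborel. rep U x * pderivs bs ?\<psi> x) = (LINT x|lebesgue. u x * pderivs bs ?\<psi> x)"
      by (rule represents_integral_test[OF U \<psi>d, symmetric])
    also have "\<dots> = (-1) ^ length bs * (LINT x|lebesgue. g x * ?\<psi> x)"
      using h \<psi> unfolding has_weak_pderivs_def by blast
    also have "(LINT x|lebesgue. g x * ?\<psi> x) = (LINT x|lborel. rep G x * ?\<psi> x)"
      by (rule represents_integral_test[OF G \<psi>])
    also have "Re ((-1) ^ length bs * (LINT x|lborel. rep G x * ?\<psi> x)) =
        (-1) ^ length bs * Re (LINT x|lborel. rep G x * ?\<psi> x)"
      by (cases "even (length bs)") auto
    also have "Re (LINT x|lborel. rep G x * ?\<psi> x) = inner G (cls \<phi>)"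
      using inner_cls_cnj(1)[OF rep_sqint[of G] test_function_sqint[OF \<psi>]] by simp
    finally show "inner U (cls (pderivs bs \<phi>)) = (-1) ^ length bs * inner G (cls \<phi>)" .
  qed
next
  assume w: "wders bs U G"
  show "has_weak_pderivs bs u g"
    unfolding has_weak_pderivs_def
  proof (intro conjI allI impI)
    show "locally_integrable u" "locally_integrable g"
      by (rule represents_locally_integrable[OF U] represents_locally_integrable[OF G])+
    fix \<phi> :: "'a \<Rightarrow> complex" assume \<phi>: "test_function \<phi>"
    have \<phi>d: "test_function (pderivs bs \<phi>)" by (rule test_function_pderivs[OF \<phi> bs])
    note i\<phi> = test_function_mult_i[OF \<phi>]
    note U1 = inner_cls_cnj[OF rep_sqint[of U] test_function_sqint[OF \<phi>d]]
    note G1 = inner_cls_cnj[OF rep_sqint[of G] test_function_sqint[OF \<phi>]]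
    have c1: "pderivs bs (\<lambda>x. cnj (\<phi> x)) = (\<lambda>x. cnj (pderivs bs \<phi> x))"
      by (rule pderivs_bounded_linear[OF bounded_linear_cnj \<phi> bs])
    have c2: "pderivs bs (\<lambda>x. cnj (\<i> * \<phi> x)) = (\<lambda>x. cnj (\<i> * pderivs bs \<phi> x))"
      unfolding pderivs_bounded_linear[OF bounded_linear_cnj i\<phi> bs]
        pderivs_bounded_linear[OF bounded_linear_mult_right \<phi> bs] ..
    let ?a = "LINT x|lborel. rep U x * pderivs bs \<phi> x" and ?b = "LINT x|lborel. rep G x * \<phi> x"
    have "Re ?a = (-1) ^ length bs * Re ?b"
      using wdersD[OF w test_function_cnj[OF \<phi>]] U1(1) G1(1) unfolding c1 by simp
    moreover have "Im ?a = (-1) ^ length bs * Im ?b"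
      using wdersD[OF w test_function_cnj[OF i\<phi>]] U1(2) G1(2) unfolding c2 by simp
    ultimately have "?a = (-1) ^ length bs * ?b"
      by (cases "even (length bs)") (auto simp: complex_eq_iff)
    then show "(LINT x|lebesgue. u x * pderivs bs \<phi> x) = (-1) ^ length bs * (LINT x|lebesgue. g x * \<phi> x)"
      by (simp only: represents_integral_test[OF U \<phi>d] represents_integral_test[OF G \<phi>])
  qed
qed

lemma locally_integrable_mult_test:
  assumes g: "locally_integrable g" and \<phi>: "test_function \<phi>"
  shows "integrable lebesgue (\<lambda>x. g x * \<phi> x)"
proof -
  let ?S = "closure {x. \<phi> x \<noteq> 0}"
  have S: "compact ?S" using \<phi> by (simp add: test_function_def)
  obtain B where B: "\<And>x. cmod (\<phi> x) \<le> B" by (rule test_function_bounded[OF \<phi>]) (rule that)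
  have \<phi>m: "\<phi> \<in> borel_measurable lebesgue"
    using measurable_completion[of \<phi> lborel borel] sqint_measurable[OF test_function_sqint[OF \<phi>]] by simp
  have "integrable lebesgue (\<lambda>x. B * norm (indicat_real ?S x *\<^sub>R g x))"
    using g S unfolding locally_integrable_def set_integrable_def by (intro integrable_mult_right integrable_norm) auto
  then show ?thesis
  proof (rule Bochner_Integration.integrable_bound)
    show "(\<lambda>x. g x * \<phi> x) \<in> borel_measurable lebesgue"
      using g \<phi>m unfolding locally_integrable_def by (intro borel_measurable_times) auto
    have "norm (g x * \<phi> x) \<le> norm (B * norm (indicat_real ?S x *\<^sub>R g x))" for x
    proof (cases "\<phi> x = 0")
      case False
      then have "x \<in> ?S" using closure_subset[of "{x. \<phi> x \<noteq> 0}"] by auto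
      moreover have "0 \<le> B" using B[of x] norm_ge_zero order_trans by blast
      ultimately show ?thesis using mult_right_mono[OF B[of x], of "cmod (g x)"]
        by (simp add: norm_mult mult.commute)
    qed simp
    then show "AE x in lebesgue. norm (g x * \<phi> x) \<le> norm (B * norm (indicat_real ?S x *\<^sub>R g x))" by simp
  qed
qed

text \<open>The representative chosen by \<^const>\<open>weak_pderivs\<close> is a priori only locally integrable, so it has
  to be identified among locally integrable functions.\<close>

lemma has_weak_pderivs_unique:
  assumes "has_weak_pderivs bs u g" "has_weak_pderivs bs u g'"
  shows "AE x in lborel. g x = g' x"
proof -
  have li: "locally_integrable g" "locally_integrable g'" using assms by (auto simp: has_weak_pderivs_def)
  then have "(\<lambda>x. g x - g' x) \<in> borel_measurable lebesgue"
    unfolding locally_integrable_def by (intro borel_measurable_diff) auto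
  then obtain w where w: "w \<in> borel_measurable borel" "AE x in lborel. g x - g' x = w x"
    by (rule obtain_Borel_version) (rule that)
  have "AE x in lborel. w x = 0"
  proof (rule fundamental_lemma[OF w(1)])
    fix a b :: 'a
    have ae: "AE x in lborel. indicat_real (box a b) x *\<^sub>R (g x - g' x) = indicat_real (box a b) x *\<^sub>R w x"
      using w(2) by eventually_elim simp
    have m: "(\<lambda>x. indicat_real (box a b) x *\<^sub>R w x) \<in> borel_measurable borel" using w(1) by simp
    have "integrable lebesgue (\<lambda>x. indicat_real (box a b) x *\<^sub>R (g x - g' x))"
    proof -
      have "set_integrable lebesgue (cbox a b) (\<lambda>x. g x - g' x)"
        using li unfolding locally_integrable_def by (intro set_integral_diff) auto
      then have "set_integrable lebesgue (box a b) (\<lambda>x. g x - g' x)"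
        by (rule set_integrable_subset) (auto simp: box_subset_cbox)
      then show ?thesis by (simp add: set_integrable_def)
    qed
    then show "integrable lborel (\<lambda>x. indicat_real (box a b) x *\<^sub>R w x)"
      unfolding lebesgue_AE_Borel(3)[OF ae m] .
  next
    fix \<phi> :: "'a \<Rightarrow> complex" assume \<phi>: "test_function \<phi>"
    have "(LINT x|lborel. w x * \<phi> x) = (LINT x|lebesgue. (g x - g' x) * \<phi> x)"
    proof (rule lebesgue_AE_Borel(2)[symmetric])
      show "AE x in lborel. (g x - g' x) * \<phi> x = w x * \<phi> x" using w(2) by eventually_elim simp
      show "(\<lambda>x. w x * \<phi> x) \<in> borel_measurable borel"
        using w(1) sqint_measurable[OF test_function_sqint[OF \<phi>]] by simp
    qed
    also have "\<dots> = (LINT x|lebesgue. g x * \<phi> x) - (LINT x|lebesgue. g' x * \<phi> x)"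
      unfolding left_diff_distrib
      by (intro Bochner_Integration.integral_diff locally_integrable_mult_test li \<phi>)
    also have "\<dots> = 0"
    proof -
      have "(-1) ^ length bs * (LINT x|lebesgue. g x * \<phi> x) = (-1) ^ length bs * (LINT x|lebesgue. g' x * \<phi> x)"
        using assms \<phi> unfolding has_weak_pderivs_def by metis
      then show ?thesis by simp
    qed
    finally show "(LINT x|lborel. w x * \<phi> x) = 0" .
  qed
  with w(2) show ?thesis by eventually_elim simp
qed

lemma H2_iff_H2cls:
  assumes U: "represents u U" shows "u \<in> H2 \<longleftrightarrow> U \<in> H2cls"
proof
  assume u: "u \<in> H2"
  show "U \<in> H2cls"
    unfolding H2cls_def
  proof (intro CollectI ballI)
    fix bs :: "'a list" assume bs: "bs \<in> directions2"
    then obtain g where "g \<in> L2" "has_weak_pderivs bs u g" using u unfolding H2_def by blast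
    moreover from this obtain G where "represents g G" using L2_iff_represents by blast
    ultimately show "\<exists>G. wders bs U G"
      using has_weak_pderivs_iff_wders[OF U] bs unfolding directions2_def by blast
  qed
next
  assume UH: "U \<in> H2cls"
  show "u \<in> H2"
    unfolding H2_def
  proof (intro CollectI conjI ballI)
    show "u \<in> L2" using L2_iff_represents U by blast
    fix bs :: "'a list" assume bs: "bs \<in> directions2"
    have "has_weak_pderivs bs u (rep (wd bs U))"
      using has_weak_pderivs_iff_wders[OF U represents_rep] wders_wd[OF UH bs] bs unfolding directions2_def by blast
    then show "\<exists>g\<in>L2. has_weak_pderivs bs u g" using L2_iff_represents represents_rep by blast
  qed
qed

lemma weak_pderivs_represents:
  assumes U: "represents u U" "U \<in> H2cls" and bs: "bs \<in> directions2"
  shows "represents (weak_pderivs bs u) (wd bs U)"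
proof -
  have h: "has_weak_pderivs bs u (rep (wd bs U))"
    using has_weak_pderivs_iff_wders[OF U(1) represents_rep] wders_wd[OF U(2) bs] bs unfolding directions2_def by blast
  then have "has_weak_pderivs bs u (weak_pderivs bs u)"
    unfolding weak_pderivs_def by (rule someI[of "has_weak_pderivs bs u"])
  from has_weak_pderivs_unique[OF this h] show ?thesis by (simp add: represents_def)
qed

lemma laplacian_represents:
  assumes "represents u U" "U \<in> H2cls" shows "represents (laplacian u) (lap U)"
  unfolding laplacian_def[abs_def] lap_def
  by (intro represents_sum weak_pderivs_represents assms) auto

lemma H2_norm_eq:
  assumes "represents u U" "U \<in> H2cls"
  shows "H2_norm u = sqrt (\<Sum>bs\<in>directions2. (norm (wd bs U))\<^sup>2)"
  unfolding H2_norm_def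
  by (intro arg_cong[where f = sqrt] sum.cong refl represents_norm(1) weak_pderivs_represents assms)

lemma K_eq_energy:
  assumes "represents u U" "U \<in> H2cls" shows "K u = energy U"
  unfolding K_def energy_def
  by (simp add: represents_norm(1)[OF laplacian_represents[OF assms]] represents_norm(1)[OF assms(1)])

lemma K_c_eq:
  assumes "represents u U" "U \<in> H2cls"
  shows "K_c c u = energy U - 2 / sqrt (1 + c) * (\<Sum>b\<in>Basis. (norm (wd [b] U))\<^sup>2)"
proof -
  have d: "represents (weak_pderivs [b] u) (wd [b] U)" if "b \<in> Basis" for b
    by (rule weak_pderivs_represents[OF assms]) (simp add: that)
  have "(LINT x|lebesgue. grad_sq u x) = (\<Sum>b\<in>Basis. LINT x|lebesgue. (cmod (weak_pderivs [b] u x))\<^sup>2)"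
    unfolding grad_sq_def by (rule Bochner_Integration.integral_sum) (rule represents_norm(2)[OF d])
  also have "\<dots> = (\<Sum>b\<in>Basis. (norm (wd [b] U))\<^sup>2)"
    by (intro sum.cong refl represents_norm(1) d)
  finally show ?thesis
    unfolding K_c_def energy_def
    by (simp add: represents_norm(1)[OF laplacian_represents[OF assms]] represents_norm(1)[OF assms(1)])
qed

lemma admissible_iff:
  assumes "represents u U"
  shows "u \<in> admissible \<sigma> \<longleftrightarrow> U \<in> H2cls \<and> powr_int (2 * \<sigma> + 2) U = 1"
proof -
  have "(LINT x|lebesgue. cmod (u x) powr (2 * \<sigma> + 2)) = powr_int (2 * \<sigma> + 2) U"
    unfolding powr_int_def
  proof (rule lebesgue_AE_Borel(2))
    show "AE x in lborel. cmod (u x) powr (2 * \<sigma> + 2) = cmod (rep U x) powr (2 * \<sigma> + 2)"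
      using assms unfolding represents_def by eventually_elim simp
  qed simp
  then show ?thesis by (simp add: admissible_def H2_iff_H2cls[OF assms])
qed

lemma admissible_represents: "u \<in> admissible \<sigma> \<Longrightarrow> \<exists>U. represents u U"
  unfolding admissible_def H2_def using L2_iff_represents by blast

section \<open>Convergence of minimizers\<close>

theorem proposition3p14:
  fixes \<sigma> :: real
    and c :: "nat \<Rightarrow> real"
    and v :: "nat \<Rightarrow> real ^ 'n \<Rightarrow> complex"
  assumes "0 < \<sigma>"
    and "5 \<le> CARD('n) \<Longrightarrow> \<sigma> < 4 / (real CARD('n) - 4)"
    and "\<And>n. 0 < c n"
    and "filterlim c at_top sequentially"
    and "\<And>n. minimizer (K_c (c n)) \<sigma> (v n)"
  shows "\<exists>(r :: nat \<Rightarrow> nat) (x :: nat \<Rightarrow> real ^ 'n) (w :: real ^ 'n \<Rightarrow> complex).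
           strict_mono r \<and> minimizer K \<sigma> w \<and>
           (\<lambda>k. H2_norm (\<lambda>y. v (r k) (y + x k) - w y)) \<longlonglongrightarrow> 0"
proof -
  let ?p = "2 * \<sigma> + 2"
  have p: "subcritical TYPE(real ^ 'n) ?p"
  proof -
    have "(real CARD('n) - 4) * (2 * \<sigma>) < 8"
    proof (cases "5 \<le> CARD('n)")
      case True
      then show ?thesis using assms(2) by (simp add: field_simps)
    next
      case False
      then have "(real CARD('n) - 4) * (2 * \<sigma>) \<le> 0" using assms(1) by (simp add: mult_le_0_iff)
      then show ?thesis by simp
    qed
    then show ?thesis using assms(1) by (simp add: subcritical_def)
  qed
  have adm: "v n \<in> admissible \<sigma>" for n
    using assms(5)[of n] unfolding minimizer_def by blast
  have vmin: "K_c (c n) (v n) \<le> K_c (c n) w" if "w \<in> admissible \<sigma>" for n and w :: "real ^ 'n \<Rightarrow> complex"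
    using assms(5)[of n] that unfolding minimizer_def by blast
  have "\<forall>n. \<exists>U. represents (v n) U" using adm admissible_represents by blast
  then obtain V where V: "\<And>n. represents (v n) (V n)" by metis
  have VH: "V n \<in> H2cls" and Vone: "powr_int ?p (V n) = 1" for n
    using adm[of n] admissible_iff[OF V] by auto
  define t where "t n = 1 / sqrt (1 + c n)" for n
  have t: "0 < t n" "t n < 1" for n using assms(3)[of n] by (auto simp: t_def)
  have t0: "t \<longlonglongrightarrow> 0"
    unfolding t_def using assms(4)
    by (intro tendsto_divide_0[OF tendsto_const] filterlim_at_top_imp_at_infinity
        filterlim_compose[OF sqrt_at_top] filterlim_tendsto_add_at_top[OF tendsto_const])
  \<comment> \<open>The gradient term is at most half of the rest, so the two problems have asymptotically the
    same infimum.\<close>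
  have almost: "(1 - t n) * energy (V n) \<le> energy W" if W: "W \<in> H2cls" "powr_int ?p W = 1"
    for n and W :: "(real ^ 'n) l2"
  proof -
    let ?g = "\<lambda>U. \<Sum>b\<in>Basis. (norm (wd [b] U))\<^sup>2"
    have "rep W \<in> admissible \<sigma>" using admissible_iff[OF represents_rep] W by blast
    from vmin[OF this, of n] have "energy (V n) - 2 * t n * ?g (V n) \<le> energy W - 2 * t n * ?g W"
      by (simp add: K_c_eq[OF V VH] K_c_eq[OF represents_rep W(1)] t_def)
    moreover have "2 * t n * ?g (V n) \<le> 2 * t n * (energy (V n) / 2)"
      using t(1)[of n] by (intro mult_left_mono gradient_le_energy VH) auto
    moreover have "0 \<le> 2 * t n * ?g W" using t(1)[of n] by (intro mult_nonneg_nonneg sum_nonneg) auto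
    ultimately show ?thesis by (simp add: algebra_simps)
  qed
  define A where "A = {energy W | W :: (real ^ 'n) l2. W \<in> H2cls \<and> powr_int ?p W = 1}"
  define m where "m = Inf A"
  have bdd: "bdd_below A" by (rule bdd_belowI[of _ 0]) (auto simp: A_def energy_nonneg)
  have mle: "m \<le> energy W" if "W \<in> H2cls" "powr_int ?p W = 1" for W :: "(real ^ 'n) l2"
    unfolding m_def by (rule cInf_lower[OF _ bdd]) (use that in \<open>auto simp: A_def\<close>)
  have "A \<noteq> {}" using VH Vone by (auto simp: A_def)
  then have up: "(1 - t n) * energy (V n) \<le> m" for n
    unfolding m_def by (rule cInf_greatest) (use almost in \<open>auto simp: A_def\<close>)
  have lim: "(\<lambda>n. energy (V n)) \<longlonglongrightarrow> m"
  proof (rule tendsto_sandwich[of "\<lambda>_. m" _ _ "\<lambda>n. m / (1 - t n)"])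
    have "(\<lambda>n. m / (1 - t n)) \<longlonglongrightarrow> m / (1 - 0)" by (intro tendsto_intros t0) simp
    then show "(\<lambda>n. m / (1 - t n)) \<longlonglongrightarrow> m" by simp
    have "energy (V n) \<le> m / (1 - t n)" for n
      using up[of n] t(2)[of n] by (simp add: pos_le_divide_eq mult.commute)
    then show "\<forall>\<^sub>F n in sequentially. energy (V n) \<le> m / (1 - t n)" by simp
  qed (use mle VH Vone in auto)
  obtain r x W where r: "strict_mono (r :: nat \<Rightarrow> nat)" and W: "W \<in> H2cls" "powr_int ?p W = 1" "energy W = m"
    and conv: "(\<lambda>k. energy (shift (x k) (V (r k)) - W)) \<longlonglongrightarrow> 0"
    by (rule minimizing_sequence_compact[OF p VH Vone lim mle]) (assumption, assumption, rule that)
  have "minimizer K \<sigma> (rep W)"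
    unfolding minimizer_def
  proof (intro conjI ballI)
    show "rep W \<in> admissible \<sigma>" using admissible_iff[OF represents_rep] W by blast
    fix w :: "real ^ 'n \<Rightarrow> complex" assume w: "w \<in> admissible \<sigma>"
    then obtain U where U: "represents w U" using admissible_represents by blast
    then have "U \<in> H2cls" "powr_int ?p U = 1" using w admissible_iff[OF U] by auto
    then show "K (rep W) \<le> K w"
      using mle W by (simp add: K_eq_energy[OF U] K_eq_energy[OF represents_rep W(1)])
  qed
  moreover have "(\<lambda>k. H2_norm (\<lambda>y. v (r k) (y + x k) - rep W y)) \<longlonglongrightarrow> 0"
  proof (rule tendsto_sandwich[of "\<lambda>_. 0" _ _ "\<lambda>k. sqrt (3 / 2 * energy (shift (x k) (V (r k)) - W))"])
    have "(\<lambda>k. sqrt (3 / 2 * energy (shift (x k) (V (r k)) - W))) \<longlonglongrightarrow> sqrt (3 / 2 * 0)"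
      by (intro tendsto_intros conv)
    then show "(\<lambda>k. sqrt (3 / 2 * energy (shift (x k) (V (r k)) - W))) \<longlonglongrightarrow> 0" by simp
    have H: "shift (x k) (V (r k)) - W \<in> H2cls" for k by (intro H2cls_diff H2cls_shift VH W)
    have eq: "H2_norm (\<lambda>y. v (r k) (y + x k) - rep W y) =
        sqrt (\<Sum>bs\<in>directions2. (norm (wd bs (shift (x k) (V (r k)) - W)))\<^sup>2)" for k
      by (rule H2_norm_eq[OF represents_diff[OF represents_shift[OF V] represents_rep] H])
    show "\<forall>\<^sub>F k in sequentially. H2_norm (\<lambda>y. v (r k) (y + x k) - rep W y) \<le> sqrt (3 / 2 * energy (shift (x k) (V (r k)) - W))"
      unfolding eq using sum_derivatives_le_energy[OF H] by (intro always_eventually allI real_sqrt_le_mono) auto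
    show "\<forall>\<^sub>F k in sequentially. 0 \<le> H2_norm (\<lambda>y. v (r k) (y + x k) - rep W y)"
      unfolding eq by (intro always_eventually allI real_sqrt_ge_zero sum_nonneg) auto
  qed simp
  ultimately show ?thesis using r by blast
qed

end
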